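(* Suppose $\mathfrak{A}$ is a dual subalgebra of $H^\infty$ acting on $H^2$, and let $r\ge1$. Then $\operatorname{Lat}(\mathfrak{A}^{(r)})$ is an $r\times r$ Nevanlinna-Pick family for $\mathfrak{A}$.
   Context: $H^2$ is the Hardy space on the open unit disk $\mathbb{D}$, and $H^\infty$ is its multiplier algebra, the bounded analytic functions acting by multiplication operators $M_f$. A dual subalgebra of $H^\infty$ is a subalgebra containing $1$ and closed in the weak-$*$ topology of $\mathcal{B}(H^2)$. $\mathcal{M}_r(\mathfrak{A})$ is the algebra of $r\times r$ matrices over $\mathfrak{A}$ with the operator norm on $H^2\otimes\mathbb{C}^r$. For a positive integer $s$, $\mathfrak{A}^{(s)}=\{M_f^{(s)}:f\in\mathfrak{A}\}$ acts on $H^{2(s)}$, the direct sum of $s$ copies of $H^2$, where $M_f^{(s)}$ is the direct sum of $s$ copies of $M_f$; for $F=[f_{ij}]\in\mathcal{M}_r(\mathfrak{A})$, $M_F^{(s)}=[M_{f_{ij}}^{(s)}]$ acts on $H^{2(s)}\otimes\mathbb{C}^r$. $\operatorname{Lat}$ denotes the lattice of closed invariant subspaces. $\mathfrak{A}$ separates a finite set $E\subset\mathbb{D}$ if for distinct $\lambda,\mu\in E$ some $f\in\mathfrak{A}$ has $f(\lambda)\neq f(\mu)$; $\mathfrak{J}_E=\{f\in\mathfrak{A}:f|_E=0\}$. For $L\in\operatorname{Lat}(\mathfrak{A}^{(s)})$, $N_L=L\ominus\mathfrak{J}_E^{(s)}L$ is the set of vectors of $L$ orthogonal to all $M_g^{(s)}x$,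 $g\in\mathfrak{J}_E$, $x\in L$, and $P_{N_L}$ is the orthogonal projection onto it. $\operatorname{Lat}(\mathfrak{A}^{(s)})$ is an $r\times r$ Nevanlinna-Pick family for $\mathfrak{A}$ if for every finite $E\subset\mathbb{D}$ separated by $\mathfrak{A}$ and every $F\in\mathcal{M}_r(\mathfrak{A})$, \[\operatorname{dist}(F,\mathcal{M}_r(\mathfrak{J}_E))=\sup_{L\in\operatorname{Lat}(\mathfrak{A}^{(s)})}\|(P_{N_L}\otimes I_r)M_F^{(s)}(P_{N_L}\otimes I_r)\|,\] the distance being in the norm of $\mathcal{M}_r(\mathfrak{A})$. *)

theory Defs
  imports "HOL-Complex_Analysis.Complex_Analysis"
begin

section \<open>The Hardy space\<close>

text \<open>
  Functions on the unit disk are represented by functions of type \<^typ>\<open>complex \<Rightarrow> complex\<close> that vanish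
  off the disk, so that equality of representatives is equality on the disk.
\<close>

abbreviation disk :: "complex set" where
  "disk \<equiv> ball 0 1"

definition taylor_coeff :: "(complex \<Rightarrow> complex) \<Rightarrow> nat \<Rightarrow> complex" where
  "taylor_coeff f n = (deriv ^^ n) f 0 / fact n"

definition hardy_set :: "(complex \<Rightarrow> complex) set" where
  "hardy_set = {f. f holomorphic_on disk \<and> (\<forall>z. z \<notin> disk \<longrightarrow> f z = 0) \<and>
                   summable (\<lambda>n. (norm (taylor_coeff f n))\<^sup>2)}"

lemma taylor_coeff_zero [simp]: "taylor_coeff (\<lambda>z. 0) n = 0"
  by (simp add: taylor_coeff_def)

lemma taylor_coeff_add:
  assumes "f holomorphic_on disk" "g holomorphic_on disk"
  shows "taylor_coeff (\<lambda>z. f z + g z) n = taylor_coeff f n + taylor_coeff g n"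
  using higher_deriv_add[OF assms, of 0 n]
  by (simp add: taylor_coeff_def add_divide_distrib)

lemma taylor_coeff_cmult:
  assumes "f holomorphic_on disk"
  shows "taylor_coeff (\<lambda>z. c * f z) n = c * taylor_coeff f n"
  using higher_deriv_cmult[OF assms, of 0 n c]
  by (simp add: taylor_coeff_def)

lemma summable_prod_of_square_summable:
  fixes a b :: "nat \<Rightarrow> complex"
  assumes "summable (\<lambda>n. (norm (a n))\<^sup>2)" "summable (\<lambda>n. (norm (b n))\<^sup>2)"
  shows "summable (\<lambda>n. norm (a n) * norm (b n))"
proof (rule summable_comparison_test)
  have "norm (a n) * norm (b n) \<le> (norm (a n))\<^sup>2 + (norm (b n))\<^sup>2" for n
  proof -
    have "2 * norm (a n) * norm (b n) \<le> (norm (a n))\<^sup>2 + (norm (b n))\<^sup>2"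
      by (rule sum_squares_bound)
    moreover have "0 \<le> norm (a n) * norm (b n)" by simp
    ultimately show ?thesis by linarith
  qed
  then show "\<exists>N. \<forall>n\<ge>N. norm (norm (a n) * norm (b n)) \<le> (norm (a n))\<^sup>2 + (norm (b n))\<^sup>2"
    by simp
  show "summable (\<lambda>n. (norm (a n))\<^sup>2 + (norm (b n))\<^sup>2)"
    using assms by (rule summable_add)
qed

lemma square_summable_add:
  fixes a b :: "nat \<Rightarrow> complex"
  assumes "summable (\<lambda>n. (norm (a n))\<^sup>2)" "summable (\<lambda>n. (norm (b n))\<^sup>2)"
  shows "summable (\<lambda>n. (norm (a n + b n))\<^sup>2)"
proof (rule summable_comparison_test)
  have "(norm (a n + b n))\<^sup>2 \<le> (norm (a n))\<^sup>2 + (norm (b n))\<^sup>2 + 2 * (norm (a n) * norm (b n))" for n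
    using power_mono[OF norm_triangle_ineq[of "a n" "b n"], of 2]
    by (simp add: power2_sum algebra_simps)
  then show "\<exists>N. \<forall>n\<ge>N. norm ((norm (a n + b n))\<^sup>2) \<le>
      (norm (a n))\<^sup>2 + (norm (b n))\<^sup>2 + 2 * (norm (a n) * norm (b n))"
    by simp
  show "summable (\<lambda>n. (norm (a n))\<^sup>2 + (norm (b n))\<^sup>2 + 2 * (norm (a n) * norm (b n)))"
    by (intro summable_add summable_mult assms summable_prod_of_square_summable)
qed

lemma hardy_set_zero: "(\<lambda>z. 0) \<in> hardy_set"
  by (simp add: hardy_set_def)

lemma hardy_set_cmult: "f \<in> hardy_set \<Longrightarrow> (\<lambda>z. c * f z) \<in> hardy_set"
  by (auto simp: hardy_set_def taylor_coeff_cmult norm_mult power_mult_distrib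
           intro!: holomorphic_intros summable_mult)

lemma hardy_set_add: "f \<in> hardy_set \<Longrightarrow> g \<in> hardy_set \<Longrightarrow> (\<lambda>z. f z + g z) \<in> hardy_set"
  by (auto simp: hardy_set_def taylor_coeff_add intro!: holomorphic_intros square_summable_add)

typedef hardy = hardy_set
  morphisms hardy_fun Abs_hardy
  using hardy_set_zero by blast

definition hcoeff :: "hardy \<Rightarrow> nat \<Rightarrow> complex" where
  "hcoeff x = taylor_coeff (hardy_fun x)"

definition hscale :: "complex \<Rightarrow> hardy \<Rightarrow> hardy" where
  "hscale c x = Abs_hardy (\<lambda>z. c * hardy_fun x z)"

text \<open>The inner product, linear in the first argument.\<close>

definition hinner :: "hardy \<Rightarrow> hardy \<Rightarrow> complex" where
  "hinner x y = (\<Sum>n. hcoeff x n * cnj (hcoeff y n))"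

lemma hardy_fun_hscale: "hardy_fun (hscale c x) = (\<lambda>z. c * hardy_fun x z)"
  by (simp add: hscale_def Abs_hardy_inverse hardy_set_cmult hardy_fun)

lemma holomorphic_hardy_fun: "hardy_fun x holomorphic_on disk"
  using hardy_fun[of x] by (simp add: hardy_set_def)

lemma hcoeff_hscale: "hcoeff (hscale c x) n = c * hcoeff x n"
  by (simp add: hcoeff_def hardy_fun_hscale taylor_coeff_cmult holomorphic_hardy_fun)

lemma summable_hcoeff: "summable (\<lambda>n. (norm (hcoeff x n))\<^sup>2)"
  using hardy_fun[of x] by (simp add: hardy_set_def hcoeff_def)

lemma summable_hinner: "summable (\<lambda>n. hcoeff x n * cnj (hcoeff y n))"
  by (rule summable_norm_cancel)
     (simp add: norm_mult summable_prod_of_square_summable summable_hcoeff)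

lemma hardy_eqI:
  assumes "\<And>n. hcoeff x n = hcoeff y n"
  shows "x = y"
proof -
  have "hardy_fun x z = hardy_fun y z" for z
  proof (cases "z \<in> disk")
    case True
    have "(\<lambda>n. taylor_coeff (hardy_fun u) n * z ^ n) sums hardy_fun u z" for u
      using holomorphic_power_series[OF holomorphic_hardy_fun[of u] True]
      by (simp add: taylor_coeff_def)
    from this[of x] this[of y] show ?thesis
      using assms by (simp add: hcoeff_def sums_unique2)
  next
    case False
    then show ?thesis
      using hardy_fun[of x] hardy_fun[of y] by (simp add: hardy_set_def)
  qed
  then show ?thesis
    using hardy_fun_inject[of x y] by auto
qed

instantiation hardy :: real_vector
begin

definition zero_hardy :: hardy where
  "0 = Abs_hardy (\<lambda>z. 0)"

definition plus_hardy :: "hardy \<Rightarrow> hardy \<Rightarrow> hardy" where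
  "x + y = Abs_hardy (\<lambda>z. hardy_fun x z + hardy_fun y z)"

definition uminus_hardy :: "hardy \<Rightarrow> hardy" where
  "- x = hscale (- 1) x"

definition minus_hardy :: "hardy \<Rightarrow> hardy \<Rightarrow> hardy" where
  "(x :: hardy) - y = x + (- y)"

definition scaleR_hardy :: "real \<Rightarrow> hardy \<Rightarrow> hardy" where
  "scaleR_hardy t = hscale (complex_of_real t)"

lemma hardy_fun_zero: "hardy_fun 0 = (\<lambda>z. 0)"
  by (simp add: zero_hardy_def Abs_hardy_inverse hardy_set_zero)

lemma hardy_fun_add: "hardy_fun (x + y) = (\<lambda>z. hardy_fun x z + hardy_fun y z)"
  by (simp add: plus_hardy_def Abs_hardy_inverse hardy_set_add hardy_fun)

instance
  by intro_classes
     (simp_all add: hardy_fun_inject[symmetric] hardy_fun_add hardy_fun_zero hardy_fun_hscale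
        uminus_hardy_def minus_hardy_def scaleR_hardy_def fun_eq_iff algebra_simps)

end

lemma hcoeff_add: "hcoeff (x + y) n = hcoeff x n + hcoeff y n"
  by (simp add: hcoeff_def hardy_fun_add taylor_coeff_add holomorphic_hardy_fun)

lemma hcoeff_zero: "hcoeff 0 n = 0"
  by (simp add: hcoeff_def hardy_fun_zero)

instantiation hardy :: real_inner
begin

definition inner_hardy :: "hardy \<Rightarrow> hardy \<Rightarrow> real" where
  "inner (x::hardy) y = Re (hinner x y)"

definition norm_hardy :: "hardy \<Rightarrow> real" where
  "norm (x::hardy) = sqrt (inner x x)"

definition sgn_hardy :: "hardy \<Rightarrow> hardy" where
  "sgn (x::hardy) = x /\<^sub>R norm x"

definition dist_hardy :: "hardy \<Rightarrow> hardy \<Rightarrow> real" where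
  "dist (x::hardy) y = norm (x - y)"

definition uniformity_hardy :: "(hardy \<times> hardy) filter" where
  "uniformity = (INF e\<in>{0<..}. principal {(x::hardy, y). dist x y < e})"

definition open_hardy :: "hardy set \<Rightarrow> bool" where
  "open (U::hardy set) \<longleftrightarrow> (\<forall>x\<in>U. \<forall>\<^sub>F (x', y) in uniformity. x' = x \<longrightarrow> y \<in> U)"

lemma hinner_self: "hinner x x = complex_of_real (\<Sum>n. (norm (hcoeff x n))\<^sup>2)"
  unfolding hinner_def
  by (simp add: complex_norm_square[symmetric] suminf_of_real summable_hcoeff flip: of_real_power)

instance
proof
  fix x y z :: hardy and t :: real
  show "dist x y = norm (x - y)" by (rule dist_hardy_def)
  show "sgn x = x /\<^sub>R norm x" by (rule sgn_hardy_def)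
  show "uniformity = (INF e\<in>{0<..}. principal {(x, y::hardy). dist x y < e})"
    by (rule uniformity_hardy_def)
  show "open U \<longleftrightarrow> (\<forall>x\<in>U. \<forall>\<^sub>F (x', y) in uniformity. x' = x \<longrightarrow> y \<in> U)" for U :: "hardy set"
    by (rule open_hardy_def)
  show "norm x = sqrt (inner x x)" by (rule norm_hardy_def)
  have "hinner y x = cnj (hinner x y)"
    unfolding hinner_def bounded_linear.suminf[OF bounded_linear_cnj summable_hinner]
    by (simp add: mult.commute)
  then show "inner x y = inner y x" by (simp add: inner_hardy_def)
  show "inner (x + y) z = inner x z + inner y z"
    by (simp add: inner_hardy_def hinner_def hcoeff_add distrib_right
        suminf_add[symmetric] summable_hinner)
  show "inner (t *\<^sub>R x) y = t * inner x y"
    by (simp add: inner_hardy_def hinner_def scaleR_hardy_def hcoeff_hscale mult.assoc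
        suminf_mult summable_hinner)
  show "0 \<le> inner x x"
    by (simp add: inner_hardy_def hinner_self suminf_nonneg summable_hcoeff)
  show "inner x x = 0 \<longleftrightarrow> x = 0"
  proof
    assume "inner x x = 0"
    then have "hcoeff x n = 0" for n
      by (simp add: inner_hardy_def hinner_self suminf_eq_zero_iff summable_hcoeff)
    then show "x = 0" by (intro hardy_eqI) (simp add: hcoeff_zero)
  qed (simp add: inner_hardy_def hinner_def hcoeff_zero)
qed

end


section \<open>Bounded analytic functions as multiplication operators\<close>

definition H_infty :: "(complex \<Rightarrow> complex) set" where
  "H_infty = {f. f holomorphic_on disk \<and> (\<forall>z. z \<notin> disk \<longrightarrow> f z = 0) \<and> bounded (f ` disk)}"

definition mult_op :: "(complex \<Rightarrow> complex) \<Rightarrow> hardy \<Rightarrow> hardy" where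
  "mult_op f x = Abs_hardy (\<lambda>z. f z * hardy_fun x z)"

definition bounded_ops :: "(hardy \<Rightarrow> hardy) set" where
  "bounded_ops = {T. bounded_linear T \<and> (\<forall>c x. T (hscale c x) = hscale c (T x))}"

text \<open>
  The trace class operators on the Hardy space are the operators
  $K = \sum_n \langle \cdot, y_n\rangle x_n$ with $\sum_n \|x_n\|^2 < \infty$ and
  $\sum_n \|y_n\|^2 < \infty$, and $\mathrm{tr}(TK) = \sum_n \langle T x_n, y_n\rangle$.  The
  weak-* topology is generated by the functionals $T \mapsto \mathrm{tr}(TK)$.
\<close>

definition square_summable :: "(nat \<Rightarrow> hardy) \<Rightarrow> bool" where
  "square_summable x \<longleftrightarrow> summable (\<lambda>n. (norm (x n))\<^sup>2)"

definition trace_pairing :: "(nat \<Rightarrow> hardy) \<Rightarrow> (nat \<Rightarrow> hardy) \<Rightarrow> (hardy \<Rightarrow> hardy) \<Rightarrow> complex" where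
  "trace_pairing x y T = (\<Sum>n. hinner (T (x n)) (y n))"

definition weak_star_topology :: "(hardy \<Rightarrow> hardy) topology" where
  "weak_star_topology = topology_generated_by
     {{T \<in> bounded_ops. trace_pairing x y T \<in> U} | x y U.
        square_summable x \<and> square_summable y \<and> open U}"

definition dual_subalgebra :: "(complex \<Rightarrow> complex) set \<Rightarrow> bool" where
  "dual_subalgebra A \<longleftrightarrow>
     A \<subseteq> H_infty \<and>
     indicator disk \<in> A \<and>
     (\<forall>f\<in>A. \<forall>g\<in>A. (\<lambda>z. f z + g z) \<in> A) \<and>
     (\<forall>f\<in>A. \<forall>g\<in>A. (\<lambda>z. f z * g z) \<in> A) \<and>
     (\<forall>c. \<forall>f\<in>A. (\<lambda>z. c * f z) \<in> A) \<and>
     closedin weak_star_topology (mult_op ` A)"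


section \<open>Ampliations and matrices\<close>

text \<open>
  The direct sum of copies of the Hardy space indexed by a finite type \<open>'s\<close> is \<^typ>\<open>hardy^'s\<close>, with
  the Euclidean combination of the norms; its tensor product with $\mathbb{C}^r$, where \<open>'r\<close> has
  $r$ elements, is \<^typ>\<open>(hardy^'s)^'r\<close>.
\<close>

definition vscale :: "complex \<Rightarrow> hardy^'s \<Rightarrow> hardy^'s" where
  "vscale c x = (\<chi> k. hscale c (x $ k))"

definition vinner :: "hardy^'s \<Rightarrow> hardy^'s \<Rightarrow> complex" where
  "vinner x y = (\<Sum>k\<in>UNIV. hinner (x $ k) (y $ k))"

definition ampl_op :: "(complex \<Rightarrow> complex) \<Rightarrow> hardy^'s \<Rightarrow> hardy^'s" where
  "ampl_op f x = (\<chi> k. mult_op f (x $ k))"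

definition matrices :: "(complex \<Rightarrow> complex) set \<Rightarrow> ((complex \<Rightarrow> complex)^'r^'r) set" where
  "matrices B = {F. \<forall>i j. F $ i $ j \<in> B}"

definition matrix_op :: "(complex \<Rightarrow> complex)^'r^'r \<Rightarrow> hardy^'r \<Rightarrow> hardy^'r" where
  "matrix_op F x = (\<chi> i. \<Sum>j\<in>UNIV. mult_op (F $ i $ j) (x $ j))"

definition ampl_matrix_op ::
    "(complex \<Rightarrow> complex)^'r^'r \<Rightarrow> (hardy^'s)^'r \<Rightarrow> (hardy^'s)^'r" where
  "ampl_matrix_op F x = (\<chi> i. \<Sum>j\<in>UNIV. ampl_op (F $ i $ j) (x $ j))"

definition matrix_dist ::
    "(complex \<Rightarrow> complex)^'r^'r \<Rightarrow> ((complex \<Rightarrow> complex)^'r^'r) set \<Rightarrow> real" where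
  "matrix_dist F S = (INF G\<in>S. onorm (\<lambda>x. matrix_op F x - matrix_op G x))"


section \<open>Invariant subspaces and Nevanlinna--Pick families\<close>

definition closed_subspace :: "(hardy^'s) set \<Rightarrow> bool" where
  "closed_subspace L \<longleftrightarrow>
     closed L \<and> 0 \<in> L \<and> (\<forall>x\<in>L. \<forall>y\<in>L. x + y \<in> L) \<and> (\<forall>c. \<forall>x\<in>L. vscale c x \<in> L)"

text \<open>The invariant subspace lattice of the ampliation of \<open>A\<close> to \<^typ>\<open>hardy^'s\<close>.\<close>

definition Lat :: "(complex \<Rightarrow> complex) set \<Rightarrow> (hardy^'s) set set" where
  "Lat A = {L. closed_subspace L \<and> (\<forall>f\<in>A. \<forall>x\<in>L. ampl_op f x \<in> L)}"

definition separates :: "(complex \<Rightarrow> complex) set \<Rightarrow> complex set \<Rightarrow> bool" where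
  "separates A E \<longleftrightarrow> (\<forall>u\<in>E. \<forall>v\<in>E. u \<noteq> v \<longrightarrow> (\<exists>f\<in>A. f u \<noteq> f v))"

definition vanishing_ideal :: "(complex \<Rightarrow> complex) set \<Rightarrow> complex set \<Rightarrow> (complex \<Rightarrow> complex) set" where
  "vanishing_ideal A E = {f \<in> A. \<forall>z\<in>E. f z = 0}"

definition residual_space ::
    "(complex \<Rightarrow> complex) set \<Rightarrow> complex set \<Rightarrow> (hardy^'s) set \<Rightarrow> (hardy^'s) set" where
  "residual_space A E L =
     {v \<in> L. \<forall>g\<in>vanishing_ideal A E. \<forall>x\<in>L. vinner v (ampl_op g x) = 0}"

definition orth_proj :: "(hardy^'s) set \<Rightarrow> hardy^'s \<Rightarrow> hardy^'s" where
  "orth_proj N x = (THE y. y \<in> N \<and> (\<forall>v\<in>N. vinner (x - y) v = 0))"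

definition proj_tensor_id :: "(hardy^'s) set \<Rightarrow> (hardy^'s)^'r \<Rightarrow> (hardy^'s)^'r" where
  "proj_tensor_id N x = (\<chi> i. orth_proj N (x $ i))"

text \<open>The type argument supplies the matrix size $r$, the cardinality of \<open>'r\<close>.\<close>

definition nevanlinna_pick_family ::
    "'r::finite itself \<Rightarrow> (complex \<Rightarrow> complex) set \<Rightarrow> (hardy^'s) set set \<Rightarrow> bool" where
  "nevanlinna_pick_family _ A \<L> \<longleftrightarrow>
     (\<forall>E. finite E \<and> E \<subseteq> disk \<and> separates A E \<longrightarrow>
       (\<forall>F \<in> (matrices A :: ((complex \<Rightarrow> complex)^'r^'r) set).
         matrix_dist F (matrices (vanishing_ideal A E)) =
         (SUP L\<in>\<L>. onorm (\<lambda>x.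
            proj_tensor_id (residual_space A E L)
              (ampl_matrix_op F (proj_tensor_id (residual_space A E L) x))))))"

end

theory Submission
  imports Defs
begin

text \<open>
  Let \<open>J\<close> be the ideal of functions in \<open>A\<close> that vanish on \<open>E\<close>, and let \<open>s\<close> be the supremum of the norms
  of the compressions.

  The inequality \<open>s \<le> dist(F, J)\<close> is a matter of orthogonality: a multiplier in \<open>J\<close> maps \<open>N\<^sub>L\<close> into
  \<open>J L\<close>, which is orthogonal to \<open>N\<^sub>L\<close>, so a matrix \<open>G\<close> over \<open>J\<close> has compression \<open>0\<close> and the compression
  of \<open>F\<close> is that of \<open>F - G\<close> (lemma \<open>onorm_compression_le\<close>).

  The inequality \<open>dist(F, J) \<le> s\<close> is obtained by duality with the weak-* continuous real functionals
  \<open>G \<mapsto> \<Sum>n. Re \<langle>G x\<^sub>n, y\<^sub>n\<rangle>\<close>, where \<open>x\<close> and \<open>y\<close> are square summable sequences in the direct sum of \<open>r\<close>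
  copies of the Hardy space.

  First, every such functional is of the form \<open>G \<mapsto> Re \<langle>G X, Y\<rangle>\<close>, where \<open>X\<close> and \<open>Y\<close> are \<open>r\<close>-tuples of
  vectors in the direct sum of \<open>r\<close> copies, and norms do not grow. Indeed \<open>x\<close> consists of \<open>r\<close> vectors in
  a direct sum of infinitely many copies of the Hardy space. The closed subspace that they generate
  under the shift \<open>S\<close> is, by the Wold decomposition, the orthogonal sum of the \<open>S\<^sup>n W\<close>, where the
  wandering subspace \<open>W\<close> is spanned by the projections of the \<open>r\<close> generators. An orthonormal basis of
  \<open>W\<close> therefore identifies the subspace with a direct sum of at most \<open>r\<close> copies of the Hardy space, and
  \<open>X\<close>, \<open>Y\<close> are the coordinates of \<open>x\<close>, \<open>y\<close> (theorems \<open>multiplicity_reduction\<close> and \<open>pairing_reduction\<close>).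

  Secondly, if the functional kills the matrices over \<open>J\<close>, let \<open>L\<close> be the invariant subspace generated
  by the entries of \<open>X\<close>. Projecting the entries of \<open>Y\<close> to \<open>L\<close> puts them into \<open>N\<^sub>L\<close>, and then the entries of
  \<open>X\<close> may be projected to \<open>N\<^sub>L\<close> as well. So the value at \<open>F\<close> is an inner product of the compression of \<open>F\<close>,
  and is at most \<open>s \<parallel>X\<parallel> \<parallel>Y\<parallel>\<close> (theorem \<open>functional_bounded_by_compressions\<close>).

  Thirdly, evaluation at \<open>F\<close>, a linear form of norm at most \<open>s\<close> on the functionals that kill the matrices
  over \<open>J\<close>, extends to all functionals with the same norm (lemma \<open>functional_extension\<close>, a Hahn-Banach
  argument). On the functionals of rank one the extension is a bounded form which commutes with the
  shift, hence is given by a matrix \<open>H\<close> of multipliers with norm at most \<open>s\<close> (theorem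
  \<open>functional_represented_by_multiplier\<close>). Every functional that kills the matrices over \<open>J\<close> kills
  \<open>F - H\<close>. Since \<open>A\<close> is weak-* closed and point evaluations are weak-* continuous, \<open>F - H\<close> has entries in
  \<open>J\<close> (lemma \<open>vanishing_ideal_if_annihilated\<close>). Thus \<open>dist(F, J) \<le> \<parallel>H\<parallel> \<le> s\<close>.
\<close>

section \<open>Hilbert space geometry\<close>

text \<open>
  By the parallelogram law a sequence in \<open>S\<close> that minimizes the distance to \<open>x\<close> is Cauchy. At a nearest
  point the first variation of the distance vanishes, which is the orthogonality.
\<close>

lemma orthogonal_projection_exists:
  fixes S :: "'a::{real_inner,complete_space} set"
  assumes S: "subspace S" "closed S"
  shows "\<exists>y\<in>S. \<forall>v\<in>S. inner (x - y) v = 0"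
proof -
  define d where "d = (INF y\<in>S. (norm (x - y))\<^sup>2)"
  have bdd: "bdd_below ((\<lambda>y. (norm (x - y))\<^sup>2) ` S)"
    by (rule bdd_belowI2[of _ 0]) simp
  have ne: "S \<noteq> {}" using subspace_0[OF S(1)] by blast
  have dle: "d \<le> (norm (x - y))\<^sup>2" if "y \<in> S" for y
    unfolding d_def using that by (intro cINF_lower[OF bdd])
  have "\<exists>y\<in>S. (norm (x - y))\<^sup>2 < d + 1 / real (Suc n)" for n
  proof -
    have "d < d + 1 / real (Suc n)" by simp
    then show ?thesis
      using cINF_less_iff[OF ne bdd, folded d_def] by blast
  qed
  then obtain y where yS: "\<And>n. y n \<in> S" and yd: "\<And>n. (norm (x - y n))\<^sup>2 < d + 1 / real (Suc n)"
    by metis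
  have par: "(norm (y m - y n))\<^sup>2 \<le> 2 / real (Suc m) + 2 / real (Suc n)" for m n
  proof -
    have "(1/2) *\<^sub>R (y m + y n) \<in> S"
      using S(1) yS by (intro subspace_scale subspace_add)
    then have "d \<le> (norm (x - (1/2) *\<^sub>R (y m + y n)))\<^sup>2" by (rule dle)
    moreover have "(norm (y m - y n))\<^sup>2 = 2 * (norm (x - y m))\<^sup>2 + 2 * (norm (x - y n))\<^sup>2
        - 4 * (norm (x - (1/2) *\<^sub>R (y m + y n)))\<^sup>2"
      unfolding power2_norm_eq_inner
      by (simp add: inner_diff_left inner_diff_right inner_add_left inner_add_right
          inner_commute algebra_simps)
    moreover have "2 / real (Suc k) = 2 * (1 / real (Suc k))" for k by simp
    ultimately show ?thesis using yd[of m] yd[of n] by linarith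
  qed
  have "Cauchy y"
  proof (rule metric_CauchyI)
    fix e :: real assume e: "e > 0"
    obtain N :: nat where N: "4 / e\<^sup>2 < real N" using reals_Archimedean2 by blast
    have "dist (y m) (y n) < e" if "m \<ge> N" "n \<ge> N" for m n
    proof -
      have Np: "real N > 0" using N e by (smt (verit) divide_pos_pos zero_less_power)
      have a: "2 / real (Suc k) < e\<^sup>2 / 2" if "k \<ge> N" for k
      proof -
        have "4 < e\<^sup>2 * real N" using N e by (simp add: field_simps)
        also have "\<dots> \<le> e\<^sup>2 * real (Suc k)" using that by (intro mult_left_mono) auto
        finally show ?thesis by (simp add: field_simps)
      qed
      have "(norm (y m - y n))\<^sup>2 < e\<^sup>2" using par[of m n] a[OF that(1)] a[OF that(2)] by linarith
      then show ?thesis using e by (simp add: dist_norm power2_less_imp_less)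
    qed
    then show "\<exists>M. \<forall>m\<ge>M. \<forall>n\<ge>M. dist (y m) (y n) < e" by blast
  qed
  then obtain z where z: "y \<longlonglongrightarrow> z" using Cauchy_convergent_iff convergent_def by blast
  have zS: "z \<in> S" using closed_sequentially[OF S(2)] yS z by blast
  have zd: "(norm (x - z))\<^sup>2 \<le> d"
  proof (rule LIMSEQ_le)
    show "(\<lambda>n. (norm (x - y n))\<^sup>2) \<longlonglongrightarrow> (norm (x - z))\<^sup>2" by (intro tendsto_intros z)
    show "(\<lambda>n. d + 1 / real (Suc n)) \<longlonglongrightarrow> d"
      using tendsto_add[OF tendsto_const LIMSEQ_inverse_real_of_nat, of d]
      by (simp add: inverse_eq_divide)
    show "\<exists>N. \<forall>n\<ge>N. (norm (x - y n))\<^sup>2 \<le> d + 1 / real (Suc n)"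
      using yd less_imp_le by blast
  qed
  have "inner (x - z) v = 0" if v: "v \<in> S" for v
  proof (rule ccontr)
    assume nz: "inner (x - z) v \<noteq> 0"
    then have vv: "inner v v > 0" by auto
    define t where "t = inner (x - z) v / inner v v"
    have "z + t *\<^sub>R v \<in> S" using S(1) zS v by (intro subspace_add subspace_scale)
    from dle[OF this] zd have "(norm (x - z))\<^sup>2 \<le> (norm (x - (z + t *\<^sub>R v)))\<^sup>2" by linarith
    also have "\<dots> = (norm (x - z))\<^sup>2 - 2 * t * inner (x - z) v + t\<^sup>2 * inner v v"
      unfolding power2_norm_eq_inner
      by (simp add: inner_diff_left inner_diff_right inner_add_left inner_add_right
          inner_commute algebra_simps power2_eq_square)
    also have "t\<^sup>2 * inner v v = t * inner (x - z) v"
      using vv by (simp add: t_def power2_eq_square)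
    finally have "t * inner (x - z) v \<le> 0" by simp
    moreover have "t * inner (x - z) v > 0"
      using vv nz by (simp add: t_def power2_eq_square[symmetric])
    ultimately show False by simp
  qed
  then show ?thesis using zS by blast
qed

text \<open>
  A vector orthogonal to the kernel of \<open>f\<close> represents \<open>f\<close> after rescaling, because the kernel has
  codimension one.
\<close>

lemma riesz_representation:
  fixes f :: "'a::{real_inner,complete_space} \<Rightarrow> real"
  assumes f: "bounded_linear f"
  shows "\<exists>y. \<forall>x. f x = inner x y"
proof (cases "\<forall>x. f x = 0")
  case True
  then show ?thesis by (intro exI[of _ 0]) simp
next
  case False
  then obtain x0 where x0: "f x0 \<noteq> 0" by blast
  interpret bounded_linear f by (rule f)
  define K where "K = {x. f x = 0}"
  have "subspace K" unfolding K_def subspace_def by (simp add: zero add scaleR)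
  moreover have "closed K" unfolding K_def
    by (intro closed_Collect_eq continuous_intros linear_continuous_on f)
  ultimately obtain k where k: "k \<in> K" "\<And>v. v \<in> K \<Longrightarrow> inner (x0 - k) v = 0"
    using orthogonal_projection_exists by metis
  define w where "w = x0 - k"
  have fw: "f w \<noteq> 0" using x0 k(1) by (simp add: w_def diff K_def)
  then have "w \<noteq> 0" using zero by auto
  then have ww: "inner w w \<noteq> 0" by simp
  have "f x = inner x ((f w / inner w w) *\<^sub>R w)" for x
  proof -
    have "x - (f x / f w) *\<^sub>R w \<in> K" using fw by (simp add: K_def diff scaleR)
    then have "inner w (x - (f x / f w) *\<^sub>R w) = 0" using k(2) by (simp add: w_def)
    then have "inner w x = f x / f w * inner w w" by (simp add: inner_diff_right)
    then show ?thesis using fw ww by (simp add: inner_commute)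
  qed
  then show ?thesis by blast
qed

section \<open>Sublinear functionals and linear functionals below them\<close>

text \<open>
  The vector spaces of functionals that occur below are sets of real functions, with the pointwise
  operations.
\<close>

definition fun_space :: "('a \<Rightarrow> real) set \<Rightarrow> bool" where
  "fun_space X \<longleftrightarrow> X \<noteq> {} \<and> (\<forall>u\<in>X. \<forall>v\<in>X. (\<lambda>a. u a + v a) \<in> X) \<and> (\<forall>c. \<forall>u\<in>X. (\<lambda>a. c * u a) \<in> X)"

definition sublinear_on :: "('a \<Rightarrow> real) set \<Rightarrow> (('a \<Rightarrow> real) \<Rightarrow> real) \<Rightarrow> bool" where
  "sublinear_on X q \<longleftrightarrow>
     (\<forall>u\<in>X. \<forall>v\<in>X. q (\<lambda>a. u a + v a) \<le> q u + q v) \<and> (\<forall>c>0. \<forall>u\<in>X. q (\<lambda>a. c * u a) = c * q u)"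

lemma fun_space_add: "fun_space X \<Longrightarrow> u \<in> X \<Longrightarrow> v \<in> X \<Longrightarrow> (\<lambda>a. u a + v a) \<in> X"
  and fun_space_cmult: "fun_space X \<Longrightarrow> u \<in> X \<Longrightarrow> (\<lambda>a. c * u a) \<in> X"
  by (auto simp: fun_space_def)

lemma fun_space_uminus: "fun_space X \<Longrightarrow> u \<in> X \<Longrightarrow> (\<lambda>a. - u a) \<in> X"
  using fun_space_cmult[of X u "-1"] by simp

lemma sublinear_on_add:
    "sublinear_on X q \<Longrightarrow> u \<in> X \<Longrightarrow> v \<in> X \<Longrightarrow> q (\<lambda>a. u a + v a) \<le> q u + q v"
  and sublinear_on_cmult: "sublinear_on X q \<Longrightarrow> c > 0 \<Longrightarrow> u \<in> X \<Longrightarrow> q (\<lambda>a. c * u a) = c * q u"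
  by (auto simp: sublinear_on_def)

lemma sublinear_onI:
  assumes X: "fun_space X"
    and "\<And>u v. u \<in> X \<Longrightarrow> v \<in> X \<Longrightarrow> q (\<lambda>a. u a + v a) \<le> q u + q v"
    and h: "\<And>c u. c > 0 \<Longrightarrow> u \<in> X \<Longrightarrow> q (\<lambda>a. c * u a) \<le> c * q u"
  shows "sublinear_on X q"
  unfolding sublinear_on_def
proof (intro conjI ballI allI impI)
  fix c :: real and u assume c: "c > 0" and u: "u \<in> X"
  have "(\<lambda>a. c * u a) \<in> X" using X u by (auto simp: fun_space_def)
  from h[OF _ this, of "inverse c"] have "q u \<le> inverse c * q (\<lambda>a. c * u a)"
    using c by (simp add: mult.assoc[symmetric])
  then have "c * q u \<le> q (\<lambda>a. c * u a)" using c by (simp add: field_simps)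
  then show "q (\<lambda>a. c * u a) = c * q u" using h[OF c u] by simp
qed (use assms in auto)

lemma sublinear_on_zero:
  assumes X: "fun_space X" and q: "sublinear_on X q"
  shows "(\<lambda>a. 0) \<in> X" "q (\<lambda>a. 0) = 0"
proof -
  obtain u where "u \<in> X" using X by (auto simp: fun_space_def)
  then have "(\<lambda>a. 0 * u a) \<in> X" using X by (simp only: fun_space_def)
  then show z: "(\<lambda>a. 0) \<in> X" by simp
  have "q (\<lambda>a. 2 * 0) = 2 * q (\<lambda>a. 0)"
    using q z unfolding sublinear_on_def by (meson zero_less_numeral)
  then show "q (\<lambda>a. 0) = 0" by simp
qed

lemma sublinear_on_diff:
  assumes X: "fun_space X" and q: "sublinear_on X q" and u: "u \<in> X" and v: "v \<in> X"
  shows "q u \<le> q (\<lambda>a. u a + v a) + q (\<lambda>a. - v a)"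
proof -
  have "q (\<lambda>a. (u a + v a) + (- v a)) \<le> q (\<lambda>a. u a + v a) + q (\<lambda>a. - v a)"
    by (rule sublinear_on_add[OF q fun_space_add[OF X u v] fun_space_uminus[OF X v]])
  then show ?thesis by simp
qed

text \<open>
  The sublinear functionals constructed below are all infima of sets of values attached to the argument.
  It suffices that such values can be added and scaled without loss.
\<close>

lemma sublinear_on_Inf:
  assumes X: "fun_space X" and ne: "\<And>u. u \<in> X \<Longrightarrow> S u \<noteq> {}" and bdd: "\<And>u. u \<in> X \<Longrightarrow> bdd_below (S u)"
    and add: "\<And>u v d e. u \<in> X \<Longrightarrow> v \<in> X \<Longrightarrow> d \<in> S u \<Longrightarrow> e \<in> S v \<Longrightarrow> \<exists>b\<in>S (\<lambda>a. u a + v a). b \<le> d + e"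
    and cmult: "\<And>c u e. c > 0 \<Longrightarrow> u \<in> X \<Longrightarrow> e \<in> S u \<Longrightarrow> \<exists>b\<in>S (\<lambda>a. c * u a). b \<le> c * e"
  shows "sublinear_on X (\<lambda>u. Inf (S u))"
proof (rule sublinear_onI[OF X])
  fix u v assume u: "u \<in> X" and v: "v \<in> X"
  let ?i = "Inf (S (\<lambda>a. u a + v a))"
  have *: "?i \<le> d + e" if "d \<in> S u" "e \<in> S v" for d e
    using add[OF u v that] cInf_lower[OF _ bdd[OF fun_space_add[OF X u v]]] by force
  have "?i - Inf (S v) \<le> Inf (S u)"
  proof (rule cInf_greatest[OF ne[OF u]])
    fix d assume d: "d \<in> S u"
    have "?i - d \<le> Inf (S v)"
      by (rule cInf_greatest[OF ne[OF v]]) (use *[OF d] in \<open>simp add: algebra_simps\<close>)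
    then show "?i - Inf (S v) \<le> d" by simp
  qed
  then show "?i \<le> Inf (S u) + Inf (S v)" by simp
next
  fix c :: real and u assume c: "c > 0" and u: "u \<in> X"
  have "Inf (S (\<lambda>a. c * u a)) / c \<le> Inf (S u)"
  proof (rule cInf_greatest[OF ne[OF u]])
    fix e assume "e \<in> S u"
    then have "Inf (S (\<lambda>a. c * u a)) \<le> c * e"
      using cmult[OF c u] cInf_lower[OF _ bdd[OF fun_space_cmult[OF X u]]] by force
    then show "Inf (S (\<lambda>a. c * u a)) / c \<le> e" using c by (simp add: field_simps)
  qed
  then show "Inf (S (\<lambda>a. c * u a)) \<le> c * Inf (S u)" using c by (simp add: field_simps)
qed

text \<open>
  The infimum over \<open>s \<ge> 0\<close> of \<open>q (u + s v) - s q v\<close> is sublinear in \<open>u\<close> and at most \<open>q\<close>, so by minimality it is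
  equal to \<open>q\<close>. Its value at \<open>- v\<close> is at most \<open>- q v\<close>, as one sees from \<open>s = 1\<close>.
\<close>

lemma minimal_sublinear_is_odd:
  assumes X: "fun_space X" and q: "sublinear_on X q"
    and min: "\<And>q'. sublinear_on X q' \<Longrightarrow> (\<And>u. u \<in> X \<Longrightarrow> q' u \<le> q u) \<Longrightarrow> (\<And>u. u \<in> X \<Longrightarrow> q' u = q u)"
    and v: "v \<in> X"
  shows "q (\<lambda>a. - v a) \<le> - q v"
proof -
  define r where "r = (\<lambda>u. INF s\<in>{0..}. q (\<lambda>a. u a + s * v a) - s * q v)"
  have sv: "(\<lambda>a. s * v a) \<in> X" for s by (rule fun_space_cmult[OF X v])
  have usv: "(\<lambda>a. u a + s * v a) \<in> X" if "u \<in> X" for u s by (rule fun_space_add[OF X that sv])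
  define S where "S u = {q (\<lambda>a. u a + s * v a) - s * q v | s. s \<ge> 0}" for u
  define r where "r u = Inf (S u)" for u
  have bdd: "bdd_below (S u)" if u: "u \<in> X" for u
  proof (rule bdd_belowI)
    fix e assume "e \<in> S u"
    then obtain s where e: "e = q (\<lambda>a. u a + s * v a) - s * q v" and s: "s \<ge> 0" by (auto simp: S_def)
    have "q (\<lambda>a. s * v a) \<le> q (\<lambda>a. s * v a + u a) + q (\<lambda>a. - u a)"
      by (rule sublinear_on_diff[OF X q sv u])
    moreover have "q (\<lambda>a. s * v a) = s * q v"
      using sublinear_on_zero[OF X q] sublinear_on_cmult[OF q _ v, of s] s by (cases "s = 0") auto
    ultimately show "- q (\<lambda>a. - u a) \<le> e" by (simp add: e add.commute)
  qed
  have r_le: "r u \<le> q (\<lambda>a. u a + s * v a) - s * q v" if "u \<in> X" "s \<ge> 0" for u s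
    unfolding r_def by (rule cInf_lower[OF _ bdd[OF that(1)]]) (use that in \<open>auto simp: S_def\<close>)
  have "sublinear_on X r"
    unfolding r_def
  proof (rule sublinear_on_Inf[OF X _ bdd])
    show "S u \<noteq> {}" for u by (auto simp: S_def)
    fix u w d e assume u: "u \<in> X" and w: "w \<in> X" and "d \<in> S u" "e \<in> S w"
    then obtain s t where s: "d = q (\<lambda>a. u a + s * v a) - s * q v" "s \<ge> 0"
      and t: "e = q (\<lambda>a. w a + t * v a) - t * q v" "t \<ge> 0" by (auto simp: S_def)
    have "q (\<lambda>a. (u a + s * v a) + (w a + t * v a)) \<le> q (\<lambda>a. u a + s * v a) + q (\<lambda>a. w a + t * v a)"
      by (rule sublinear_on_add[OF q usv[OF u] usv[OF w]])
    then have "q (\<lambda>a. u a + w a + (s + t) * v a) - (s + t) * q v \<le> d + e"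
      by (simp add: s t algebra_simps)
    moreover have "q (\<lambda>a. u a + w a + (s + t) * v a) - (s + t) * q v \<in> S (\<lambda>a. u a + w a)"
      using s(2) t(2) unfolding S_def by (intro CollectI exI[of _ "s + t"]) simp
    ultimately show "\<exists>b\<in>S (\<lambda>a. u a + w a). b \<le> d + e" by blast
  next
    fix c :: real and u e assume c: "c > 0" and u: "u \<in> X" and "e \<in> S u"
    then obtain s where s: "e = q (\<lambda>a. u a + s * v a) - s * q v" "s \<ge> 0" by (auto simp: S_def)
    have "q (\<lambda>a. c * (u a + s * v a)) = c * q (\<lambda>a. u a + s * v a)"
      by (rule sublinear_on_cmult[OF q c usv[OF u]])
    then have "q (\<lambda>a. c * u a + (c * s) * v a) - (c * s) * q v = c * e"
      by (simp add: s algebra_simps)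
    moreover have "q (\<lambda>a. c * u a + (c * s) * v a) - (c * s) * q v \<in> S (\<lambda>a. c * u a)"
      using s(2) c unfolding S_def by (intro CollectI exI[of _ "c * s"]) simp
    ultimately show "\<exists>b\<in>S (\<lambda>a. c * u a). b \<le> c * e" by (metis order_refl)
  qed
  moreover have "r u \<le> q u" if "u \<in> X" for u using r_le[OF that, of 0] by simp
  ultimately have eq: "r u = q u" if "u \<in> X" for u using min that by blast
  have m: "(\<lambda>a. - v a) \<in> X" using sv[of "-1"] by simp
  have "q (\<lambda>a. - v a) \<le> q (\<lambda>a. - v a + 1 * v a) - 1 * q v" using r_le[OF m, of 1] eq[OF m] by simp
  then show ?thesis using sublinear_on_zero[OF X q] by simp
qed

text \<open>
  Zorn's lemma: a chain has a pointwise infimum since \<open>q u \<ge> - q (- u) \<ge> - p (- u)\<close>.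
\<close>

lemma minimal_sublinear_exists:
  assumes X: "fun_space X" and p: "sublinear_on X p"
  shows "\<exists>q. sublinear_on X q \<and> (\<forall>u\<in>X. q u \<le> p u) \<and>
    (\<forall>q'. sublinear_on X q' \<and> (\<forall>u\<in>X. q' u \<le> q u) \<longrightarrow> (\<forall>u\<in>X. q' u = q u))"
proof -
  \<comment> \<open>Outside \<open>X\<close> the functionals are set to \<open>0\<close>, so that comparing them as functions means comparing them on \<open>X\<close>.\<close>
  define Q where "Q = {q. sublinear_on X q \<and> (\<forall>u\<in>X. q u \<le> p u) \<and> (\<forall>u. u \<notin> X \<longrightarrow> q u = 0)}"
  note neg = fun_space_uminus[OF X]
  have restr: "(\<lambda>u. if u \<in> X then q u else 0) \<in> Q" if "sublinear_on X q" "\<forall>u\<in>X. q u \<le> p u" for q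
    using that fun_space_add[OF X] fun_space_cmult[OF X] unfolding Q_def sublinear_on_def by simp
  have "\<exists>m\<in>Q. \<forall>a\<in>Q. a \<le> m \<longrightarrow> a = m"
  proof (rule predicate_Zorn)
    show "partial_order_on Q (relation_of (\<lambda>x y. y \<le> x) Q)"
      by (rule partial_order_on_relation_ofI) auto
    fix C assume C: "C \<in> Chains (relation_of (\<lambda>x y. y \<le> x) Q)"
    then have CQ: "C \<subseteq> Q" and chain: "\<And>a b. a \<in> C \<Longrightarrow> b \<in> C \<Longrightarrow> a \<le> b \<or> b \<le> a"
      unfolding Chains_def relation_of_def by auto
    show "\<exists>u\<in>Q. \<forall>a\<in>C. u \<le> a"
    proof (cases "C = {}")
      case True
      then show ?thesis using restr[OF p] by auto
    next
      case False
      have sub: "sublinear_on X q" and le: "\<And>u. u \<in> X \<Longrightarrow> q u \<le> p u"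
        and out: "\<And>u. u \<notin> X \<Longrightarrow> q u = 0" if "q \<in> C" for q
        using that CQ by (auto simp: Q_def)
      define r where "r u = (INF q\<in>C. q u)" for u
      have bdd: "bdd_below ((\<lambda>q. q u) ` C)" if u: "u \<in> X" for u
      proof (rule bdd_belowI2)
        fix q assume q: "q \<in> C"
        have "q (\<lambda>a. 0) \<le> q (\<lambda>a. 0 + u a) + q (\<lambda>a. - u a)"
          by (rule sublinear_on_diff[OF X sub[OF q] sublinear_on_zero(1)[OF X p] u])
        then show "- p (\<lambda>a. - u a) \<le> q u"
          using sublinear_on_zero[OF X sub[OF q]] le[OF q neg[OF u]] by simp
      qed
      have r_le: "r u \<le> q u" if "u \<in> X" "q \<in> C" for u q
        unfolding r_def by (rule cINF_lower[OF bdd[OF that(1)] that(2)])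
      have "sublinear_on X r"
        unfolding r_def
      proof (rule sublinear_on_Inf[OF X _ bdd])
        fix u w d e assume u: "u \<in> X" and w: "w \<in> X" and "d \<in> (\<lambda>q. q u) ` C" "e \<in> (\<lambda>q. q w) ` C"
        then obtain q q' where q: "q \<in> C" "q' \<in> C" "d = q u" "e = q' w" by blast
        obtain m where m: "m \<in> C" "m u \<le> q u" "m w \<le> q' w"
          using chain[OF q(1,2)] q(1,2) by (auto simp: le_fun_def)
        show "\<exists>b\<in>(\<lambda>q. q (\<lambda>a. u a + w a)) ` C. b \<le> d + e"
          using m sublinear_on_add[OF sub[OF m(1)] u w] q(3,4)
          by (intro bexI[of _ "m (\<lambda>a. u a + w a)"]) auto
      next
        fix c :: real and u e assume c: "c > 0" and u: "u \<in> X" and "e \<in> (\<lambda>q. q u) ` C"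
        then obtain q where q: "q \<in> C" "e = q u" by blast
        show "\<exists>b\<in>(\<lambda>q. q (\<lambda>a. c * u a)) ` C. b \<le> c * e"
          by (rule bexI[OF _ imageI[OF q(1)]]) (simp add: sublinear_on_cmult[OF sub[OF q(1)] c u] q(2))
      qed (use False in auto)
      moreover have "\<forall>u\<in>X. r u \<le> p u"
        using False r_le le by (meson all_not_in_conv order_trans)
      ultimately have "(\<lambda>u. if u \<in> X then r u else 0) \<in> Q" by (rule restr)
      moreover have "\<forall>a\<in>C. (\<lambda>u. if u \<in> X then r u else 0) \<le> a"
      proof
        fix a assume "a \<in> C"
        then show "(\<lambda>u. if u \<in> X then r u else 0) \<le> a"
          using r_le out[of a] by (auto simp: le_fun_def)
      qed
      ultimately show ?thesis by blast
    qed
  qed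
  then obtain m where m: "m \<in> Q" "\<And>a. a \<in> Q \<Longrightarrow> a \<le> m \<Longrightarrow> a = m" by blast
  have "\<forall>u\<in>X. q' u = m u" if q': "sublinear_on X q'" "\<forall>u\<in>X. q' u \<le> m u" for q'
  proof -
    have "(\<lambda>u. if u \<in> X then q' u else 0) \<in> Q"
      by (rule restr[OF q'(1)]) (use q'(2) m(1) in \<open>force simp: Q_def\<close>)
    moreover have "(\<lambda>u. if u \<in> X then q' u else 0) \<le> m"
      using q'(2) m(1) by (auto simp: le_fun_def Q_def)
    ultimately have "(\<lambda>u. if u \<in> X then q' u else 0) = m" using m(2) by blast
    then show ?thesis by auto
  qed
  then show ?thesis using m(1) unfolding Q_def by blast
qed

text \<open>
  The Hahn-Banach theorem in its sublinear form: a minimal sublinear functional is odd, and a sublinear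
  functional that is odd is linear.
\<close>

theorem linear_below_sublinear:
  assumes X: "fun_space X" and p: "sublinear_on X p"
  obtains l where "\<And>u v. u \<in> X \<Longrightarrow> v \<in> X \<Longrightarrow> l (\<lambda>a. u a + v a) = l u + l v"
    "\<And>c u. u \<in> X \<Longrightarrow> l (\<lambda>a. c * u a) = c * l u" "\<And>u. u \<in> X \<Longrightarrow> l u \<le> p u"
proof -
  obtain q where q: "sublinear_on X q" "\<And>u. u \<in> X \<Longrightarrow> q u \<le> p u"
    and min: "\<forall>q'. sublinear_on X q' \<and> (\<forall>u\<in>X. q' u \<le> q u) \<longrightarrow> (\<forall>u\<in>X. q' u = q u)"
    using minimal_sublinear_exists[OF X p] by auto
  note neg = fun_space_uminus[OF X]
  have odd: "q (\<lambda>a. - u a) = - q u" if u: "u \<in> X" for u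
  proof -
    have "q (\<lambda>a. 0) \<le> q (\<lambda>a. 0 + u a) + q (\<lambda>a. - u a)"
      by (rule sublinear_on_diff[OF X q(1) sublinear_on_zero(1)[OF X p] u])
    then have "- q u \<le> q (\<lambda>a. - u a)" using sublinear_on_zero[OF X q(1)] by simp
    then show ?thesis using minimal_sublinear_is_odd[OF X q(1) _ u] min by auto
  qed
  show thesis
  proof (rule that[of q])
    fix u v assume u: "u \<in> X" and v: "v \<in> X"
    have "q u \<le> q (\<lambda>a. u a + v a) + q (\<lambda>a. - v a)" by (rule sublinear_on_diff[OF X q(1) u v])
    then show "q (\<lambda>a. u a + v a) = q u + q v"
      using odd[OF v] sublinear_on_add[OF q(1) u v] by simp
  next
    fix c :: real and u assume u: "u \<in> X"
    have hom: "q (\<lambda>a. d * w a) = d * q w" if "d > 0" "w \<in> X" for d w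
      by (rule sublinear_on_cmult[OF q(1) that])
    consider "c > 0" | "c = 0" | "c < 0" by linarith
    then show "q (\<lambda>a. c * u a) = c * q u"
    proof cases
      case 3
      have "q (\<lambda>a. - c * - u a) = - c * q (\<lambda>a. - u a)" using hom[OF _ neg[OF u], of "- c"] 3 by simp
      then show ?thesis using odd[OF u] by simp
    qed (use hom u sublinear_on_zero[OF X q(1)] in auto)
  qed (use q in auto)
qed

section \<open>The Hardy space as a Hilbert space of coefficient sequences\<close>

lemma taylor_coeff_power_series:
  assumes "\<And>z. z \<in> disk \<Longrightarrow> (\<lambda>n. a n * z ^ n) sums h z"
  shows "h holomorphic_on disk" "taylor_coeff h n = a n"
proof -
  show "h holomorphic_on disk"
    using power_series_holomorphic[of 0 1 a h] assms by simp
  have "h has_fps_expansion Abs_fps a"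
  proof (rule has_fps_expansionI)
    have "eventually (\<lambda>z::complex. z \<in> disk) (nhds 0)"
      by (rule eventually_nhds_in_open) auto
    then show "\<forall>\<^sub>F u in nhds 0. (\<lambda>n. fps_nth (Abs_fps a) n * u ^ n) sums h u"
      by eventually_elim (use assms in auto)
  qed
  from fps_nth_fps_expansion[OF this, of n] show "taylor_coeff h n = a n"
    by (simp add: taylor_coeff_def)
qed

lemma taylor_series_sums:
  assumes "h holomorphic_on disk" "z \<in> disk"
  shows "(\<lambda>n. taylor_coeff h n * z ^ n) sums h z"
  using holomorphic_power_series[OF assms] by (simp add: taylor_coeff_def)

lemma taylor_coeff_mult:
  assumes "f holomorphic_on disk" "g holomorphic_on disk"
  shows "taylor_coeff (\<lambda>z. f z * g z) n = (\<Sum>i\<le>n. taylor_coeff f i * taylor_coeff g (n - i))"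
proof -
  have "of_nat (n choose i) / fact n = (1 / fact i) * (1 / fact (n - i) :: complex)" if "i \<le> n" for i
    using binomial_fact[OF that, where 'a = complex] by simp
  then have "of_nat (n choose i) * a * b / fact n = a / fact i * (b / fact (n - i))" if "i \<le> n" for i and a b :: complex
    using that by (metis (no_types, lifting) mult.assoc mult.commute times_divide_eq_right times_divide_times_eq mult_1)
  then show ?thesis
    unfolding taylor_coeff_def higher_deriv_mult[OF assms open_ball, of 0 n, simplified]
    by (simp add: sum_divide_distrib atLeast0AtMost)
qed

text \<open>
  The series converges at a radius between \<open>\<rho>\<close> and \<open>1\<close>, hence absolutely at \<open>\<rho>\<close>.
\<close>

lemma summable_taylor_norm:
  assumes "h holomorphic_on disk" "0 \<le> \<rho>" "\<rho> < 1"
  shows "summable (\<lambda>n. norm (taylor_coeff h n) * \<rho> ^ n)"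
proof -
  obtain r where r: "\<rho> < r" "r < 1" using assms dense by blast
  have "summable (\<lambda>n. taylor_coeff h n * of_real r ^ n)"
    by (rule sums_summable[OF taylor_series_sums[OF assms(1)]]) (use r assms in auto)
  then have "summable (\<lambda>n. norm (taylor_coeff h n * of_real \<rho> ^ n))"
    by (rule powser_insidea) (use r assms in auto)
  then show ?thesis using assms by (simp add: norm_mult norm_power)
qed

definition hardy_of :: "(nat \<Rightarrow> complex) \<Rightarrow> hardy" where
  "hardy_of a = Abs_hardy (\<lambda>z. if z \<in> disk then \<Sum>n. a n * z ^ n else 0)"

lemma hcoeff_hardy_of:
  assumes a: "summable (\<lambda>n. (norm (a n))\<^sup>2)"
  shows "hcoeff (hardy_of a) n = a n"
proof -
  let ?h = "\<lambda>z. if z \<in> disk then \<Sum>n. a n * z ^ n else 0"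
  have "(\<lambda>n. a n * z ^ n) sums ?h z" if z: "z \<in> disk" for z
  proof -
    have "summable (\<lambda>n. (norm (z ^ n))\<^sup>2)"
      using z by (simp add: norm_power power_mult[symmetric] mult.commute[of _ 2])
        (simp add: power_mult summable_geometric abs_square_less_1)
    then have "summable (\<lambda>n. norm (a n) * norm (z ^ n))"
      by (rule summable_prod_of_square_summable[OF a])
    then have "summable (\<lambda>n. a n * z ^ n)"
      by (intro summable_norm_cancel[of "\<lambda>n. a n * z ^ n"]) (simp add: norm_mult)
    then show ?thesis using z by (simp add: summable_sums)
  qed
  note h = this taylor_coeff_power_series[OF this]
  have "?h \<in> hardy_set"
    using h(2) h(3) a by (auto simp: hardy_set_def)
  then have eq: "hardy_fun (hardy_of a) = ?h"
    unfolding hardy_of_def by (rule Abs_hardy_inverse)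
  show "hcoeff (hardy_of a) n = a n" unfolding hcoeff_def eq by (rule h(3))
qed

lemma hardy_fun_sums: "z \<in> disk \<Longrightarrow> (\<lambda>n. hcoeff x n * z ^ n) sums hardy_fun x z"
  unfolding hcoeff_def by (rule taylor_series_sums[OF holomorphic_hardy_fun])

lemma hardy_fun_outside: "z \<notin> disk \<Longrightarrow> hardy_fun x z = 0"
  using hardy_fun[of x] by (simp add: hardy_set_def)

lemma hcoeff_scaleR: "hcoeff (t *\<^sub>R x) n = t *\<^sub>R hcoeff x n"
  by (simp add: scaleR_hardy_def hcoeff_hscale scaleR_conv_of_real)

lemma hcoeff_diff: "hcoeff (x - y) n = hcoeff x n - hcoeff y n"
  by (simp add: minus_hardy_def uminus_hardy_def hcoeff_add hcoeff_hscale)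

lemma hcoeff_sum: "hcoeff (\<Sum>i\<in>I. x i) n = (\<Sum>i\<in>I. hcoeff (x i) n)"
  by (induction I rule: infinite_finite_induct) (auto simp: hcoeff_zero hcoeff_add)

lemma norm_hardy_square: "(norm (x::hardy))\<^sup>2 = (\<Sum>n. (norm (hcoeff x n))\<^sup>2)"
  by (simp add: power2_norm_eq_inner inner_hardy_def hinner_self)

lemma norm_hardy_sums: "(\<lambda>n. (norm (hcoeff x n))\<^sup>2) sums (norm (x::hardy))\<^sup>2"
  unfolding norm_hardy_square by (rule summable_sums[OF summable_hcoeff])

lemma norm_hardy_leI:
  assumes "\<And>N. (\<Sum>n<N. (norm (hcoeff x n))\<^sup>2) \<le> c\<^sup>2" "c \<ge> 0"
  shows "norm (x::hardy) \<le> c"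
proof (rule power2_le_imp_le[OF _ assms(2)])
  show "(norm x)\<^sup>2 \<le> c\<^sup>2"
    unfolding norm_hardy_square by (rule suminf_le_const[OF summable_hcoeff assms(1)])
qed

lemma sum_hcoeff_le_norm: "(\<Sum>n<N. (norm (hcoeff x n))\<^sup>2) \<le> (norm (x::hardy))\<^sup>2"
  unfolding norm_hardy_square by (rule sum_le_suminf[OF summable_hcoeff]) auto

lemma norm_hcoeff_le: "norm (hcoeff x n) \<le> norm (x::hardy)"
proof -
  have "(norm (hcoeff x n))\<^sup>2 \<le> (\<Sum>k<Suc n. (norm (hcoeff x k))\<^sup>2)"
    by (simp add: sum_nonneg)
  also have "\<dots> \<le> (norm x)\<^sup>2" by (rule sum_hcoeff_le_norm)
  finally show ?thesis by (rule power2_le_imp_le) simp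
qed

lemma bounded_linear_hcoeff: "bounded_linear (\<lambda>x. hcoeff x n)"
  by (rule bounded_linear_intro[of _ 1])
     (auto simp: hcoeff_add hcoeff_scaleR norm_hcoeff_le)

lemma hardy_of_if_partial_sums_bounded:
  assumes "\<And>N. (\<Sum>n<N. (norm (a n))\<^sup>2) \<le> c\<^sup>2" "c \<ge> 0"
  shows "summable (\<lambda>n. (norm (a n))\<^sup>2)" "norm (hardy_of a) \<le> c"
proof -
  show *: "summable (\<lambda>n. (norm (a n))\<^sup>2)"
    by (rule summableI_nonneg_bounded[of _ "c\<^sup>2"]) (use assms in auto)
  show "norm (hardy_of a) \<le> c"
    by (rule norm_hardy_leI) (use assms in \<open>auto simp: hcoeff_hardy_of[OF *]\<close>)
qed

text \<open>
  A Cauchy sequence converges coefficientwise, and the Cauchy estimates pass to the limit on finitely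
  many coefficients at a time.
\<close>

instance hardy :: complete_space
proof
  fix X :: "nat \<Rightarrow> hardy" assume X: "Cauchy X"
  define a where "a n = lim (\<lambda>k. hcoeff (X k) n)" for n
  have a: "(\<lambda>k. hcoeff (X k) n) \<longlonglongrightarrow> a n" for n
    using Cauchy_convergent[OF bounded_linear.Cauchy[OF bounded_linear_hcoeff X]]
    unfolding a_def convergent_LIMSEQ_iff .
  have part: "\<exists>N. \<forall>k\<ge>N. \<forall>m. (\<Sum>n<m. (norm (a n - hcoeff (X k) n))\<^sup>2) \<le> e\<^sup>2" if e: "e > 0" for e
  proof -
    obtain N where N: "\<And>k l. k \<ge> N \<Longrightarrow> l \<ge> N \<Longrightarrow> norm (X k - X l) < e"
      using CauchyD[OF X e] by blast
    have "(\<Sum>n<m. (norm (a n - hcoeff (X k) n))\<^sup>2) \<le> e\<^sup>2" if k: "k \<ge> N" for k m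
    proof (rule LIMSEQ_le_const2)
      show "(\<lambda>l. \<Sum>n<m. (norm (hcoeff (X l) n - hcoeff (X k) n))\<^sup>2)
          \<longlonglongrightarrow> (\<Sum>n<m. (norm (a n - hcoeff (X k) n))\<^sup>2)"
        by (intro tendsto_intros a)
      have "(\<Sum>n<m. (norm (hcoeff (X l) n - hcoeff (X k) n))\<^sup>2) \<le> e\<^sup>2" if "l \<ge> N" for l
      proof -
        have "(\<Sum>n<m. (norm (hcoeff (X l) n - hcoeff (X k) n))\<^sup>2) \<le> (norm (X l - X k))\<^sup>2"
          using sum_hcoeff_le_norm[of "X l - X k" m] by (simp add: hcoeff_diff)
        also have "\<dots> \<le> e\<^sup>2" using N[OF that k] by (intro power_mono) auto
        finally show ?thesis .
      qed
      then show "\<exists>N. \<forall>l\<ge>N. (\<Sum>n<m. (norm (hcoeff (X l) n - hcoeff (X k) n))\<^sup>2) \<le> e\<^sup>2" by blast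
    qed
    then show ?thesis by blast
  qed
  obtain k where k: "\<And>m. (\<Sum>n<m. (norm (a n - hcoeff (X k) n))\<^sup>2) \<le> 1\<^sup>2"
    using part[of 1] by auto
  have "summable (\<lambda>n. (norm ((a n - hcoeff (X k) n) + hcoeff (X k) n))\<^sup>2)"
    by (rule square_summable_add[OF _ summable_hcoeff])
       (rule hardy_of_if_partial_sums_bounded(1)[OF k], simp)
  then have sa: "summable (\<lambda>n. (norm (a n))\<^sup>2)" by simp
  have "X \<longlonglongrightarrow> hardy_of a"
  proof (rule LIMSEQ_I)
    fix r :: real assume r: "r > 0"
    then obtain N where N: "\<And>k m. k \<ge> N \<Longrightarrow> (\<Sum>n<m. (norm (a n - hcoeff (X k) n))\<^sup>2) \<le> (r/2)\<^sup>2"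
      using part[of "r/2"] by auto
    have "norm (X k - hardy_of a) < r" if "k \<ge> N" for k
    proof -
      have "norm (hardy_of a - X k) \<le> r/2"
        by (rule norm_hardy_leI) (use N[OF that] r in \<open>auto simp: hcoeff_diff hcoeff_hardy_of[OF sa]\<close>)
      then show ?thesis using r by (simp add: norm_minus_commute)
    qed
    then show "\<exists>no. \<forall>n\<ge>no. norm (X n - hardy_of a) < r" by blast
  qed
  then show "convergent X" by (auto simp: convergent_def)
qed

instance hardy :: banach ..

subsection \<open>The complex inner product\<close>

lemma hinner_add_left: "hinner (x + y) z = hinner x z + hinner y z"
  by (simp add: hinner_def hcoeff_add distrib_right suminf_add[symmetric] summable_hinner)

lemma hinner_commute: "hinner y x = cnj (hinner x y)"
  unfolding hinner_def bounded_linear.suminf[OF bounded_linear_cnj summable_hinner]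
  by (simp add: mult.commute)

lemma hinner_add_right: "hinner x (y + z) = hinner x y + hinner x z"
  by (subst (1 2 3) hinner_commute) (simp add: hinner_add_left)

lemma hinner_hscale_left: "hinner (hscale c x) y = c * hinner x y"
  by (simp add: hinner_def hcoeff_hscale mult.assoc suminf_mult summable_hinner)

lemma hinner_hscale_right: "hinner x (hscale c y) = cnj c * hinner x y"
  by (subst (1 2) hinner_commute) (simp add: hinner_hscale_left)

lemma inner_hscale: "inner (hscale c x) y = inner x (hscale (cnj c) y)"
  by (simp add: inner_hardy_def hinner_hscale_left hinner_hscale_right)

text \<open>
  The real inner product determines the complex one. Hence the real projection theorem yields complex
  orthogonality as soon as the subspace is invariant under \<open>\<i>\<close>.
\<close>

lemma hinner_eq_inner: "hinner x y = Complex (inner x y) (inner x (hscale \<i> y))"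
  by (simp add: complex_eq_iff inner_hardy_def hinner_hscale_right)

lemma hscale_hscale: "hscale c (hscale d x) = hscale (c * d) x"
  by (rule hardy_eqI) (simp add: hcoeff_hscale)

lemma hscale_of_real: "hscale (of_real t) x = t *\<^sub>R x"
  by (simp add: scaleR_hardy_def)

lemma hscale_one [simp]: "hscale 1 x = x" by (rule hardy_eqI) (simp add: hcoeff_hscale)
lemma hscale_zero_left [simp]: "hscale 0 x = 0" by (rule hardy_eqI) (simp add: hcoeff_hscale hcoeff_zero)
lemma hscale_zero [simp]: "hscale c 0 = 0" by (rule hardy_eqI) (simp add: hcoeff_hscale hcoeff_zero)
lemma hscale_add: "hscale c (x + y) = hscale c x + hscale c y"
  by (rule hardy_eqI) (simp add: hcoeff_hscale hcoeff_add algebra_simps)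

lemma norm_hscale: "norm (hscale c x) = norm c * norm x"
proof -
  have "hinner (hscale c x) (hscale c x) = (c * cnj c) * hinner x x"
    by (simp add: hinner_hscale_left hinner_hscale_right)
  also have "c * cnj c = complex_of_real ((norm c)\<^sup>2)" by (simp only: complex_norm_square)
  finally have "(norm (hscale c x))\<^sup>2 = (norm c)\<^sup>2 * (norm x)\<^sup>2"
    by (simp add: power2_norm_eq_inner inner_hardy_def)
  then have "(norm (hscale c x))\<^sup>2 = (norm c * norm x)\<^sup>2" by (simp add: power_mult_distrib)
  then show ?thesis by (simp only: power2_eq_iff_nonneg norm_ge_zero mult_nonneg_nonneg)
qed

lemma bounded_linear_hscale: "bounded_linear (hscale c)"
proof (rule bounded_linear_intro[of _ "norm c"])
  fix t x
  show "hscale c (t *\<^sub>R x) = t *\<^sub>R hscale c x"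
    by (simp add: hscale_of_real[symmetric] hscale_hscale mult.commute)
qed (auto simp: hscale_add norm_hscale mult.commute)

lemma norm_hinner_le: "norm (hinner x y) \<le> norm x * norm y"
proof (cases "hinner x y = 0")
  case False
  \<comment> \<open>Multiplying \<open>x\<close> by this unimodular number makes the inner product real and nonnegative.\<close>
  define c where "c = cnj (hinner x y) / of_real (norm (hinner x y))"
  have c: "norm c = 1" using False by (simp add: c_def norm_divide)
  have "c * hinner x y = of_real (norm (hinner x y))"
    using False by (simp add: c_def complex_norm_square[symmetric] power2_eq_square mult.commute)
  then have "norm (hinner x y) = inner (hscale c x) y"
    by (simp add: inner_hardy_def hinner_hscale_left)
  also have "\<dots> \<le> norm (hscale c x) * norm y" by (rule norm_cauchy_schwarz)
  finally show ?thesis by (simp add: norm_hscale c)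
qed simp

lemma hinner_diff_left: "hinner (x - y) z = hinner x z - hinner y z"
  using hinner_add_left[of "x - y" y z] by simp

lemma hinner_zero [simp]: "hinner 0 x = 0" "hinner x 0 = 0"
  by (simp_all add: hinner_def hcoeff_zero)

lemma hinner_sum_left: "hinner (\<Sum>i\<in>I. x i) y = (\<Sum>i\<in>I. hinner (x i) y)"
  by (induction I rule: infinite_finite_induct) (auto simp: hinner_add_left)

lemma bounded_linear_hinner_left: "bounded_linear (\<lambda>x. hinner x y)"
  by (rule bounded_linear_intro[of _ "norm y"])
     (auto simp: hinner_add_left norm_hinner_le hscale_of_real[symmetric] hinner_hscale_left scaleR_conv_of_real)

definition monomial :: "nat \<Rightarrow> hardy" where
  "monomial n = hardy_of (\<lambda>m. if m = n then 1 else 0)"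

lemma hcoeff_monomial: "hcoeff (monomial n) m = (if m = n then 1 else 0)"
proof -
  have "summable (\<lambda>m. (norm (if m = n then 1 else 0 :: complex))\<^sup>2)"
    by (rule summable_finite[of "{n}"]) auto
  then show ?thesis unfolding monomial_def by (rule hcoeff_hardy_of)
qed

lemma hinner_monomial: "hinner x (monomial n) = hcoeff x n"
proof -
  have "hinner x (monomial n) = (\<Sum>m\<in>{n}. hcoeff x m * cnj (hcoeff (monomial n) m))"
    unfolding hinner_def by (rule suminf_finite) (auto simp: hcoeff_monomial)
  then show ?thesis by (simp add: hcoeff_monomial)
qed

lemma monomial_expansion: "(\<lambda>N. \<Sum>n<N. hscale (hcoeff x n) (monomial n)) \<longlonglongrightarrow> x"
proof -
  let ?s = "\<lambda>N. \<Sum>n<N. hscale (hcoeff x n) (monomial n)"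
  have co: "hcoeff (?s N) n = (if n < N then hcoeff x n else 0)" for N n
    by (simp add: hcoeff_sum hcoeff_hscale hcoeff_monomial if_distrib[of "(*) _"] cong: if_cong)
  have nn: "(norm (x - ?s N))\<^sup>2 = (norm x)\<^sup>2 - (\<Sum>n<N. (norm (hcoeff x n))\<^sup>2)" for N
  proof -
    have "(\<lambda>n. if n < N then (norm (hcoeff x n))\<^sup>2 else 0) sums (\<Sum>n<N. (norm (hcoeff x n))\<^sup>2)"
      using sums_If_finite_set[of "{..<N}" "\<lambda>n. (norm (hcoeff x n))\<^sup>2"] by simp
    from sums_diff[OF norm_hardy_sums[of x] this]
    have "(\<lambda>n. (norm (hcoeff (x - ?s N) n))\<^sup>2) sums ((norm x)\<^sup>2 - (\<Sum>n<N. (norm (hcoeff x n))\<^sup>2))"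
      by (rule back_subst[of "\<lambda>f. f sums _"]) (auto simp: hcoeff_diff co)
    then show ?thesis using norm_hardy_sums[of "x - ?s N"] sums_unique2 by blast
  qed
  have "(\<lambda>N. (norm (x - ?s N))\<^sup>2) \<longlonglongrightarrow> (norm x)\<^sup>2 - (norm x)\<^sup>2"
    unfolding nn by (intro tendsto_diff tendsto_const) (use norm_hardy_sums[of x] in \<open>simp add: sums_def\<close>)
  then have "(\<lambda>N. sqrt ((norm (x - ?s N))\<^sup>2)) \<longlonglongrightarrow> sqrt 0" by (intro tendsto_real_sqrt) simp
  then have "(\<lambda>N. x - ?s N) \<longlonglongrightarrow> 0" by (simp add: tendsto_norm_zero_iff)
  from tendsto_diff[OF tendsto_const[of x] this] show ?thesis by simp
qed

lemma bounded_linear_eq_on_monomials: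
  assumes "bounded_linear T" "bounded_linear T'"
    and "\<And>c n. T (hscale c (monomial n)) = T' (hscale c (monomial n))"
  shows "T x = T' x"
proof -
  interpret T: bounded_linear T by fact
  interpret T': bounded_linear T' by fact
  have "(\<lambda>N. T (\<Sum>n<N. hscale (hcoeff x n) (monomial n))) \<longlonglongrightarrow> T x"
    by (rule T.tendsto[OF monomial_expansion])
  moreover have "(\<lambda>N. T (\<Sum>n<N. hscale (hcoeff x n) (monomial n))) \<longlonglongrightarrow> T' x"
    using T'.tendsto[OF monomial_expansion[of x]] by (simp add: T.sum T'.sum assms(3))
  ultimately show ?thesis by (rule LIMSEQ_unique)
qed

subsection \<open>Multiplication by bounded analytic functions\<close>

text \<open>
  A discrete Parseval identity. It plays the role of integration over a circle, and only involves finite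
  sums.
\<close>

lemma sum_norm_square_roots_of_unity:
  fixes a :: "nat \<Rightarrow> complex"
  assumes N: "N > 0"
  defines "w \<equiv> \<lambda>j::nat. exp (2 * of_real pi * \<i> * of_nat j / of_nat N)"
  shows "(\<Sum>j<N. (norm (\<Sum>n<N. a n * w j ^ n))\<^sup>2) = real N * (\<Sum>n<N. (norm (a n))\<^sup>2)"
proof -
  have wpow: "w j ^ n = w n ^ j" for j n
    by (simp add: w_def exp_of_nat_mult[symmetric] algebra_simps)
  have w1: "w j * cnj (w j) = 1" for j
    by (simp add: w_def complex_norm_square[symmetric] norm_exp_eq_Re)
  have orth: "(\<Sum>j<N. (w n * cnj (w m)) ^ j) = (if n = m then of_nat N else 0)"
    if "n < N" "m < N" for n m
  proof (cases "n = m")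
    case False
    have "w n \<noteq> w m"
      using complex_root_unity_eq[of N n m] N False that by (simp add: w_def)
    then have ne: "w n * cnj (w m) \<noteq> 1"
      using w1[of m] by (metis mult.assoc mult.commute mult_1)
    have wN: "w j ^ N = 1" for j
      using wpow[of j N] N by (simp add: w_def)
    have "(w n * cnj (w m)) ^ N = w n ^ N * cnj (w m ^ N)"
      by (simp add: power_mult_distrib)
    then have "(w n * cnj (w m)) ^ N = 1" by (simp only: wN complex_cnj_one mult_1)
    then show ?thesis using False sum_gp_strict[of "w n * cnj (w m)" N] ne by simp
  qed (simp add: w1)
  have "complex_of_real (\<Sum>j<N. (norm (\<Sum>n<N. a n * w j ^ n))\<^sup>2)
      = (\<Sum>j<N. (\<Sum>n<N. a n * w j ^ n) * cnj (\<Sum>m<N. a m * w j ^ m))"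
    by (simp only: of_real_sum complex_norm_square)
  also have "\<dots> = (\<Sum>j<N. \<Sum>n<N. \<Sum>m<N. a n * cnj (a m) * (w n * cnj (w m)) ^ j)"
    unfolding cnj_sum sum_product
  proof (intro sum.cong refl)
    fix j n m
    show "a n * w j ^ n * cnj (a m * w j ^ m) = a n * cnj (a m) * (w n * cnj (w m)) ^ j"
      by (simp add: wpow[of j n] wpow[of j m] power_mult_distrib)
  qed
  also have "\<dots> = (\<Sum>n<N. \<Sum>m<N. \<Sum>j<N. a n * cnj (a m) * (w n * cnj (w m)) ^ j)"
    by (subst sum.swap) (intro sum.cong refl sum.swap)
  also have "\<dots> = (\<Sum>n<N. \<Sum>m<N. a n * cnj (a m) * (if n = m then of_nat N else 0))"
    unfolding sum_distrib_left[symmetric] by (intro sum.cong refl) (simp add: orth)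
  also have "\<dots> = (\<Sum>n<N. a n * cnj (a n) * of_nat N)"
    by (simp add: if_distrib[of "(*) _"] cong: if_cong)
  also have "\<dots> = complex_of_real (real N * (\<Sum>n<N. (norm (a n))\<^sup>2))"
    unfolding of_real_mult of_real_sum complex_norm_square sum_distrib_left by (simp add: mult.commute)
  finally show ?thesis by (simp only: of_real_eq_iff)
qed

text \<open>
  Both series are truncated at degree \<open>N\<close> and averaged over the \<open>N\<close>-th roots of unity on the circle of
  radius \<open>\<rho>\<close>. The pointwise bound \<open>norm (h z) \<le> M * norm (k z)\<close> survives truncation up to an error \<open>err N\<close>,
  which tends to zero since both series converge absolutely at \<open>\<rho>\<close>.
\<close>

lemma mean_square_bound:
  assumes h: "\<And>z. z \<in> disk \<Longrightarrow> (\<lambda>n. b n * z ^ n) sums h z"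
    and k: "\<And>z. z \<in> disk \<Longrightarrow> (\<lambda>n. a n * z ^ n) sums k z"
    and le: "\<And>z. z \<in> disk \<Longrightarrow> norm (h z) \<le> M * norm (k z)"
    and M: "M \<ge> 0" and C: "\<And>N. (\<Sum>n<N. (norm (a n))\<^sup>2) \<le> C"
    and \<rho>: "0 < \<rho>" "\<rho> < 1"
  shows "(\<Sum>n<K. (norm (b n * of_real \<rho> ^ n))\<^sup>2) \<le> M\<^sup>2 * C"
proof -
  have hol: "h holomorphic_on disk" "k holomorphic_on disk" and
    tc: "\<And>n. taylor_coeff h n = b n" "\<And>n. taylor_coeff k n = a n"
    using taylor_coeff_power_series[of b h] taylor_coeff_power_series[of a k] h k by auto
  have sb: "summable (\<lambda>n. norm (b n) * \<rho> ^ n)" and sa: "summable (\<lambda>n. norm (a n) * \<rho> ^ n)"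
    using summable_taylor_norm[OF hol(1), of \<rho>] summable_taylor_norm[OF hol(2), of \<rho>] \<rho> by (auto simp: tc)
  define eb where "eb N = (\<Sum>n. norm (b (n + N)) * \<rho> ^ (n + N))" for N
  define ea where "ea N = (\<Sum>n. norm (a (n + N)) * \<rho> ^ (n + N))" for N
  have eb0: "eb \<longlonglongrightarrow> 0" and ea0: "ea \<longlonglongrightarrow> 0"
    using suminf_exist_split2[OF sb] suminf_exist_split2[OF sa] by (simp_all add: eb_def[abs_def] ea_def[abs_def])
  have tail: "norm (v - (\<Sum>n<N. c n * z ^ n)) \<le> (\<Sum>n. norm (c (n + N)) * \<rho> ^ (n + N))"
    if g: "(\<lambda>n. c n * z ^ n) sums v" and s: "summable (\<lambda>n. norm (c n) * \<rho> ^ n)" and z: "norm z = \<rho>"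
    for v :: complex and c z N
  proof -
    have e: "norm (c n * z ^ n) = norm (c n) * \<rho> ^ n" for n by (simp add: norm_mult norm_power z)
    have "v = (\<Sum>n. c (n + N) * z ^ (n + N)) + (\<Sum>n<N. c n * z ^ n)"
      unfolding sums_unique[OF g] by (rule suminf_split_initial_segment[OF sums_summable[OF g]])
    then have "v - (\<Sum>n<N. c n * z ^ n) = (\<Sum>n. c (n + N) * z ^ (n + N))" by simp
    also have "norm \<dots> \<le> (\<Sum>n. norm (c (n + N) * z ^ (n + N)))"
      by (rule summable_norm) (simp only: e summable_iff_shift[of "\<lambda>n. norm (c n) * \<rho> ^ n"] s)
    finally show ?thesis by (simp only: e)
  qed
  define B where "B = (\<Sum>n. norm (a n) * \<rho> ^ n)"
  have B0: "B \<ge> 0" unfolding B_def by (rule suminf_nonneg[OF sa]) (use \<rho> in auto)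
  define err where "err N = M * ea N + eb N" for N
  have err0: "err \<longlonglongrightarrow> 0"
    unfolding err_def[abs_def] using tendsto_add[OF tendsto_mult[OF tendsto_const[of M] ea0] eb0] by simp
  have trunc: "(\<Sum>n<N. (norm (b n * of_real \<rho> ^ n))\<^sup>2)
      \<le> M\<^sup>2 * (\<Sum>n<N. (norm (a n * of_real \<rho> ^ n))\<^sup>2) + (2 * M * B * err N + (err N)\<^sup>2)"
    if N: "N > 0" for N
  proof -
    define w where "w = (\<lambda>j::nat. exp (2 * of_real pi * \<i> * of_nat j / of_nat N) :: complex)"
    define z where "z j = of_real \<rho> * w j" for j
    have w1: "norm (w j) = 1" for j by (simp add: w_def norm_exp_eq_Re)
    have z: "norm (z j) = \<rho>" "z j \<in> disk" for j using \<rho> w1[of j] by (auto simp: z_def norm_mult)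
    define p where "p j = (\<Sum>n<N. b n * z j ^ n)" for j
    define r where "r j = (\<Sum>n<N. a n * z j ^ n)" for j
    have rB: "norm (r j) \<le> B" for j
    proof -
      have "norm (r j) \<le> (\<Sum>n<N. norm (a n) * \<rho> ^ n)"
        unfolding r_def by (rule order_trans[OF norm_sum]) (simp add: norm_mult norm_power z)
      also have "\<dots> \<le> B" unfolding B_def by (rule sum_le_suminf[OF sa]) (use \<rho> in auto)
      finally show ?thesis .
    qed
    have pr: "norm (p j) \<le> M * norm (r j) + err N" for j
    proof -
      have "norm (h (z j) - p j) \<le> eb N" unfolding p_def eb_def by (rule tail[OF h[OF z(2)] sb z(1)])
      moreover have "norm (k (z j) - r j) \<le> ea N" unfolding r_def ea_def by (rule tail[OF k[OF z(2)] sa z(1)])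
      moreover have "norm (p j) \<le> norm (h (z j)) + norm (h (z j) - p j)"
        using norm_triangle_ineq4[of "h (z j)" "h (z j) - p j"] by simp
      moreover have "norm (k (z j)) \<le> norm (r j) + norm (k (z j) - r j)"
        using norm_triangle_ineq[of "r j" "k (z j) - r j"] by simp
      moreover have "norm (h (z j)) \<le> M * norm (k (z j))" by (rule le[OF z(2)])
      ultimately have "norm (p j) \<le> M * norm (k (z j)) + eb N" "norm (k (z j)) \<le> norm (r j) + ea N"
        by linarith+
      moreover from this(2) have "M * norm (k (z j)) \<le> M * (norm (r j) + ea N)"
        by (rule mult_left_mono[OF _ M])
      ultimately have "norm (p j) \<le> M * (norm (r j) + ea N) + eb N" by linarith
      then show ?thesis by (simp add: err_def algebra_simps)
    qed
    have errN: "err N \<ge> 0"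
      unfolding err_def ea_def eb_def using M \<rho>
      by (intro add_nonneg_nonneg mult_nonneg_nonneg suminf_nonneg)
         (simp_all add: summable_iff_shift[of "\<lambda>n. norm (a n) * \<rho> ^ n"] summable_iff_shift[of "\<lambda>n. norm (b n) * \<rho> ^ n"] sa sb)
    have sq: "(norm (p j))\<^sup>2 \<le> M\<^sup>2 * (norm (r j))\<^sup>2 + (2 * M * B * err N + (err N)\<^sup>2)" for j
    proof -
      have "(norm (p j))\<^sup>2 \<le> (M * norm (r j) + err N)\<^sup>2" using pr by (intro power_mono) auto
      also have "\<dots> = M\<^sup>2 * (norm (r j))\<^sup>2 + (2 * M * err N) * norm (r j) + (err N)\<^sup>2"
        by (simp add: power2_eq_square algebra_simps)
      also have "(2 * M * err N) * norm (r j) \<le> (2 * M * err N) * B"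
        using M errN rB by (intro mult_left_mono) auto
      finally show ?thesis by (simp add: algebra_simps)
    qed
    have zz: "(\<Sum>n<N. c n * z j ^ n) = (\<Sum>n<N. (c n * of_real \<rho> ^ n) * w j ^ n)" for c j
      by (simp add: z_def power_mult_distrib mult.assoc)
    have "real N * (\<Sum>n<N. (norm (b n * of_real \<rho> ^ n))\<^sup>2) = (\<Sum>j<N. (norm (p j))\<^sup>2)"
      using sum_norm_square_roots_of_unity[OF N, of "\<lambda>n. b n * of_real \<rho> ^ n"]
      by (simp only: p_def zz w_def)
    also have "\<dots> \<le> (\<Sum>j<N. M\<^sup>2 * (norm (r j))\<^sup>2 + (2 * M * B * err N + (err N)\<^sup>2))"
      by (intro sum_mono sq)
    also have "\<dots> = M\<^sup>2 * (\<Sum>j<N. (norm (r j))\<^sup>2) + real N * (2 * M * B * err N + (err N)\<^sup>2)"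
      by (simp add: sum.distrib sum_distrib_left)
    also have "(\<Sum>j<N. (norm (r j))\<^sup>2) = real N * (\<Sum>n<N. (norm (a n * of_real \<rho> ^ n))\<^sup>2)"
      using sum_norm_square_roots_of_unity[OF N, of "\<lambda>n. a n * of_real \<rho> ^ n"]
      by (simp only: r_def zz w_def)
    finally have "real N * (\<Sum>n<N. (norm (b n * of_real \<rho> ^ n))\<^sup>2)
      \<le> real N * (M\<^sup>2 * (\<Sum>n<N. (norm (a n * of_real \<rho> ^ n))\<^sup>2) + (2 * M * B * err N + (err N)\<^sup>2))"
      by (simp add: algebra_simps)
    then show ?thesis using N by simp
  qed
  have aC: "(\<Sum>n<N. (norm (a n * of_real \<rho> ^ n))\<^sup>2) \<le> C" for N
  proof -
    have "(norm (a n * of_real \<rho> ^ n))\<^sup>2 \<le> (norm (a n))\<^sup>2" for n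
      using \<rho> by (intro power_mono) (auto simp: norm_mult norm_power intro!: mult_left_le power_le_one)
    then have "(\<Sum>n<N. (norm (a n * of_real \<rho> ^ n))\<^sup>2) \<le> (\<Sum>n<N. (norm (a n))\<^sup>2)" by (rule sum_mono)
    then show ?thesis using C[of N] by linarith
  qed
  show ?thesis
  proof (rule LIMSEQ_le_const)
    have "(\<lambda>N. M\<^sup>2 * C + (2 * M * B * err N + (err N)\<^sup>2)) \<longlonglongrightarrow> M\<^sup>2 * C + (2 * M * B * 0 + 0\<^sup>2)"
      by (intro tendsto_intros err0)
    then show "(\<lambda>N. M\<^sup>2 * C + (2 * M * B * err N + (err N)\<^sup>2)) \<longlonglongrightarrow> M\<^sup>2 * C" by simp
    have "(\<Sum>n<K. (norm (b n * of_real \<rho> ^ n))\<^sup>2) \<le> M\<^sup>2 * C + (2 * M * B * err N + (err N)\<^sup>2)"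
      if "N \<ge> Suc K" for N
    proof -
      have "(\<Sum>n<K. (norm (b n * of_real \<rho> ^ n))\<^sup>2) \<le> (\<Sum>n<N. (norm (b n * of_real \<rho> ^ n))\<^sup>2)"
        using that by (intro sum_mono2) auto
      also have "\<dots> \<le> M\<^sup>2 * (\<Sum>n<N. (norm (a n * of_real \<rho> ^ n))\<^sup>2) + (2 * M * B * err N + (err N)\<^sup>2)"
        by (rule trunc) (use that in auto)
      also have "M\<^sup>2 * (\<Sum>n<N. (norm (a n * of_real \<rho> ^ n))\<^sup>2) \<le> M\<^sup>2 * C"
        by (intro mult_left_mono aC) auto
      finally show ?thesis by simp
    qed
    then show "\<exists>N. \<forall>n\<ge>N. (\<Sum>n<K. (norm (b n * of_real \<rho> ^ n))\<^sup>2) \<le> M\<^sup>2 * C + (2 * M * B * err n + (err n)\<^sup>2)"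
      by blast
  qed
qed

lemma H_inftyD:
  assumes "f \<in> H_infty"
  shows "f holomorphic_on disk" "z \<notin> disk \<Longrightarrow> f z = 0" "\<exists>M\<ge>0. \<forall>z\<in>disk. norm (f z) \<le> M"
proof -
  have "bounded (f ` disk)" using assms by (simp add: H_infty_def)
  then obtain b where b': "\<forall>w\<in>f ` disk. norm w \<le> b" unfolding bounded_iff by (rule exE)
  have b: "norm (f z) \<le> b" if "z \<in> disk" for z using b' imageI[OF that] by (rule bspec)
  have "norm (f 0) \<le> b" by (rule b) simp
  then have "b \<ge> 0" using norm_ge_zero[of "f 0"] by linarith
  then show "\<exists>M\<ge>0. \<forall>z\<in>disk. norm (f z) \<le> M" using b by blast
qed (use assms in \<open>auto simp: H_infty_def\<close>)

text \<open>
  The bound on the circle of radius \<open>\<rho>\<close> is uniform, so \<open>\<rho>\<close> may tend to \<open>1\<close>.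
\<close>

lemma H_infty_mult_hardy:
  assumes f: "f \<in> H_infty" and M: "M \<ge> 0" "\<And>z. z \<in> disk \<Longrightarrow> norm (f z) \<le> M"
  shows "(\<lambda>z. f z * hardy_fun x z) \<in> hardy_set"
    and "(\<Sum>n<K. (norm (taylor_coeff (\<lambda>z. f z * hardy_fun x z) n))\<^sup>2) \<le> (M * norm x)\<^sup>2"
proof -
  let ?h = "\<lambda>z. f z * hardy_fun x z"
  let ?b = "taylor_coeff ?h"
  have hol: "?h holomorphic_on disk"
    by (intro holomorphic_intros H_inftyD(1)[OF f] holomorphic_hardy_fun)
  have part: "(\<Sum>n<K. (norm (?b n * of_real \<rho> ^ n))\<^sup>2) \<le> (M * norm x)\<^sup>2" if "0 < \<rho>" "\<rho> < 1" for \<rho> K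
  proof -
    have "(\<Sum>n<K. (norm (?b n * of_real \<rho> ^ n))\<^sup>2) \<le> M\<^sup>2 * (norm x)\<^sup>2"
      by (rule mean_square_bound[OF taylor_series_sums[OF hol] hardy_fun_sums[of _ x] _ M(1) sum_hcoeff_le_norm that])
         (use M(2) in \<open>auto simp: norm_mult intro: mult_right_mono\<close>)
    then show ?thesis by (simp add: power_mult_distrib)
  qed
  show le: "(\<Sum>n<K. (norm (?b n))\<^sup>2) \<le> (M * norm x)\<^sup>2" for K
  proof (rule tendsto_upperbound)
    have "((\<lambda>\<rho>::real. \<Sum>n<K. (norm (?b n * of_real \<rho> ^ n))\<^sup>2) \<longlongrightarrow> (\<Sum>n<K. (norm (?b n * of_real 1 ^ n))\<^sup>2)) (at_left 1)"
      by (intro tendsto_intros)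
    then show "((\<lambda>\<rho>::real. \<Sum>n<K. (norm (?b n * of_real \<rho> ^ n))\<^sup>2) \<longlongrightarrow> (\<Sum>n<K. (norm (?b n))\<^sup>2)) (at_left 1)"
      by simp
    have "eventually (\<lambda>\<rho>::real. \<rho> \<in> {0<..<1}) (at_left 1)"
      by (rule eventually_at_leftI[of 0]) auto
    then show "\<forall>\<^sub>F \<rho> in at_left 1. (\<Sum>n<K. (norm (?b n * of_real \<rho> ^ n))\<^sup>2) \<le> (M * norm x)\<^sup>2"
      by eventually_elim (rule part, auto)
  qed simp
  have "summable (\<lambda>n. (norm (?b n))\<^sup>2)"
    by (rule summableI_nonneg_bounded[OF _ le]) auto
  then show "?h \<in> hardy_set" using hol hardy_fun_outside by (auto simp: hardy_set_def)
qed

lemma hardy_fun_mult_op: "f \<in> H_infty \<Longrightarrow> hardy_fun (mult_op f x) = (\<lambda>z. f z * hardy_fun x z)"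
  unfolding mult_op_def using H_inftyD(3)[of f] H_infty_mult_hardy(1)[of f]
  by (intro Abs_hardy_inverse) blast

lemma norm_mult_op_le:
  assumes "f \<in> H_infty" "M \<ge> 0" "\<And>z. z \<in> disk \<Longrightarrow> norm (f z) \<le> M"
  shows "norm (mult_op f x) \<le> M * norm x"
  by (rule norm_hardy_leI)
     (use H_infty_mult_hardy(2)[OF assms] assms(2) in \<open>auto simp: hcoeff_def hardy_fun_mult_op[OF assms(1)]\<close>)

lemma hardy_fun_eqI: "(\<And>z. z \<in> disk \<Longrightarrow> hardy_fun x z = hardy_fun y z) \<Longrightarrow> x = y"
  using hardy_fun_inject[of x y] hardy_fun_outside[of _ x] hardy_fun_outside[of _ y] by (metis ext)

lemma mult_op_add: "f \<in> H_infty \<Longrightarrow> mult_op f (x + y) = mult_op f x + mult_op f y"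
  by (rule hardy_fun_eqI) (simp add: hardy_fun_mult_op hardy_fun_add algebra_simps)

lemma mult_op_hscale: "f \<in> H_infty \<Longrightarrow> mult_op f (hscale c x) = hscale c (mult_op f x)"
  by (rule hardy_fun_eqI) (simp add: hardy_fun_mult_op hardy_fun_hscale)

lemma bounded_linear_mult_op:
  assumes "f \<in> H_infty" shows "bounded_linear (mult_op f)"
proof -
  obtain M where M: "M \<ge> 0" "\<And>z. z \<in> disk \<Longrightarrow> norm (f z) \<le> M" using H_inftyD(3)[OF assms] by blast
  show ?thesis
    by (rule bounded_linear_intro[of _ M])
       (use norm_mult_op_le[OF assms M] in \<open>auto simp: mult_op_add assms mult_op_hscale hscale_of_real[symmetric] mult.commute\<close>)
qed

lemma mult_op_bounded_ops: "f \<in> H_infty \<Longrightarrow> mult_op f \<in> bounded_ops"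
  by (simp add: bounded_ops_def bounded_linear_mult_op mult_op_hscale)

lemma hcoeff_mult_op:
  "f \<in> H_infty \<Longrightarrow> hcoeff (mult_op f x) n = (\<Sum>i\<le>n. taylor_coeff f i * hcoeff x (n - i))"
  by (simp add: hcoeff_def hardy_fun_mult_op taylor_coeff_mult H_inftyD holomorphic_hardy_fun)

lemma H_infty_add: "f \<in> H_infty \<Longrightarrow> g \<in> H_infty \<Longrightarrow> (\<lambda>z. f z + g z) \<in> H_infty"
proof -
  assume f: "f \<in> H_infty" and g: "g \<in> H_infty"
  obtain M where M: "\<And>z. z \<in> disk \<Longrightarrow> norm (f z) \<le> M" using H_inftyD(3)[OF f] by blast
  obtain M' where M': "\<And>z. z \<in> disk \<Longrightarrow> norm (g z) \<le> M'" using H_inftyD(3)[OF g] by blast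
  have "norm (f z + g z) \<le> M + M'" if "z \<in> disk" for z
    using M[OF that] M'[OF that] norm_triangle_ineq[of "f z" "g z"] by linarith
  then show ?thesis using f g by (auto simp: H_infty_def bounded_iff intro!: holomorphic_intros exI[of _ "M + M'"])
qed

lemma H_infty_cmult: "f \<in> H_infty \<Longrightarrow> (\<lambda>z. c * f z) \<in> H_infty"
proof -
  assume f: "f \<in> H_infty"
  obtain M where M: "\<And>z. z \<in> disk \<Longrightarrow> norm (f z) \<le> M" using H_inftyD(3)[OF f] by blast
  have "norm (c * f z) \<le> norm c * M" if "z \<in> disk" for z
    using M[OF that] by (simp add: norm_mult mult_left_mono)
  then show ?thesis using f by (auto simp: H_infty_def bounded_iff intro!: holomorphic_intros exI[of _ "norm c * M"])
qed

lemma mult_op_add_left: "f \<in> H_infty \<Longrightarrow> g \<in> H_infty \<Longrightarrow> mult_op (\<lambda>z. f z + g z) x = mult_op f x + mult_op g x"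
  by (rule hardy_fun_eqI) (simp add: hardy_fun_mult_op H_infty_add hardy_fun_add algebra_simps)

lemma mult_op_cmult_left: "f \<in> H_infty \<Longrightarrow> mult_op (\<lambda>z. c * f z) x = hscale c (mult_op f x)"
  by (rule hardy_fun_eqI) (simp add: hardy_fun_mult_op H_infty_cmult hardy_fun_hscale algebra_simps)

lemma mult_op_mult_left:
  "f \<in> H_infty \<Longrightarrow> g \<in> H_infty \<Longrightarrow> (\<lambda>z. f z * g z) \<in> H_infty \<Longrightarrow> mult_op (\<lambda>z. f z * g z) x = mult_op f (mult_op g x)"
  by (rule hardy_fun_eqI) (simp add: hardy_fun_mult_op algebra_simps)

lemma mult_op_indicator: "indicator disk \<in> H_infty \<Longrightarrow> mult_op (indicator disk) x = x"
  by (rule hardy_fun_eqI) (simp add: hardy_fun_mult_op)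

section \<open>The shift of infinite multiplicity\<close>

text \<open>
  Since \<open>prod_encode (k, m)\<close> is at least \<open>k\<close> and \<open>m\<close>, the first \<open>N\<close> codes lie in a square of side \<open>N\<close>.
\<close>

lemma enc_coefficients_bounded:
  assumes x: "square_summable x"
  shows "(\<Sum>p<N. (norm (hcoeff (x (fst (prod_decode p))) (snd (prod_decode p))))\<^sup>2)
    \<le> (sqrt (\<Sum>k. (norm (x k))\<^sup>2))\<^sup>2"
proof -
  let ?g = "\<lambda>(k,m). (norm (hcoeff (x k) m))\<^sup>2"
  have le: "fst (prod_decode p) \<le> p \<and> snd (prod_decode p) \<le> p" for p
    using le_prod_encode_1[of "fst (prod_decode p)" "snd (prod_decode p)"]
      le_prod_encode_2[of "snd (prod_decode p)" "fst (prod_decode p)"] by simp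
  have "(\<Sum>p<N. (norm (hcoeff (x (fst (prod_decode p))) (snd (prod_decode p))))\<^sup>2) = (\<Sum>q\<in>prod_decode ` {..<N}. ?g q)"
    by (subst sum.reindex[OF inj_prod_decode]) (simp add: case_prod_unfold)
  also have "\<dots> \<le> (\<Sum>q\<in>{..<N} \<times> {..<N}. ?g q)"
  proof (rule sum_mono2)
    show "prod_decode ` {..<N} \<subseteq> {..<N} \<times> {..<N}"
    proof
      fix q assume "q \<in> prod_decode ` {..<N}"
      then obtain p where p: "q = prod_decode p" "p < N" by auto
      then show "q \<in> {..<N} \<times> {..<N}" using le[of p] by (simp add: mem_Times_iff)
    qed
  qed auto
  also have "\<dots> = (\<Sum>k<N. \<Sum>m<N. (norm (hcoeff (x k) m))\<^sup>2)"
    by (simp add: sum.cartesian_product)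
  also have "\<dots> \<le> (\<Sum>k<N. (norm (x k))\<^sup>2)" by (intro sum_mono sum_hcoeff_le_norm)
  also have "\<dots> \<le> (\<Sum>k. (norm (x k))\<^sup>2)"
    using x unfolding square_summable_def by (intro sum_le_suminf) auto
  also have "\<dots> = (sqrt (\<Sum>k. (norm (x k))\<^sup>2))\<^sup>2"
    using x unfolding square_summable_def by (simp add: suminf_nonneg)
  finally show ?thesis .
qed

text \<open>
  The Hardy space is used as its own model of a direct sum of infinitely many copies of itself:
  coefficient \<open>m\<close> of the \<open>k\<close>-th entry of a sequence is stored as coefficient \<open>prod_encode (k, m)\<close>. The
  inverse map is \<open>dec\<close>.
\<close>

definition enc :: "(nat \<Rightarrow> hardy) \<Rightarrow> hardy" where
  "enc x = hardy_of (\<lambda>p. hcoeff (x (fst (prod_decode p))) (snd (prod_decode p)))"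

definition dec :: "hardy \<Rightarrow> nat \<Rightarrow> hardy" where
  "dec v k = hardy_of (\<lambda>m. hcoeff v (prod_encode (k, m)))"

lemma hardy_eqI_pair:
  assumes "\<And>k m. hcoeff x (prod_encode (k, m)) = hcoeff y (prod_encode (k, m))"
  shows "x = y"
  by (rule hardy_eqI) (metis assms prod_decode_inverse surj_pair)

lemma hcoeff_enc: "square_summable x \<Longrightarrow> hcoeff (enc x) (prod_encode (k, m)) = hcoeff (x k) m"
  unfolding enc_def
  by (subst hcoeff_hardy_of[OF hardy_of_if_partial_sums_bounded(1)[OF enc_coefficients_bounded]])
     (auto simp: square_summable_def suminf_nonneg)

lemma norm_enc_le:
  assumes "square_summable x"
  shows "(norm (enc x))\<^sup>2 \<le> (\<Sum>k. (norm (x k))\<^sup>2)"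
proof -
  have nn: "(\<Sum>k. (norm (x k))\<^sup>2) \<ge> 0"
    using assms unfolding square_summable_def by (intro suminf_nonneg) auto
  have "norm (enc x) \<le> sqrt (\<Sum>k. (norm (x k))\<^sup>2)"
    unfolding enc_def
    by (rule hardy_of_if_partial_sums_bounded(2)[OF enc_coefficients_bounded[OF assms]]) (use nn in simp)
  then have "(norm (enc x))\<^sup>2 \<le> (sqrt (\<Sum>k. (norm (x k))\<^sup>2))\<^sup>2" by (intro power_mono) auto
  then show ?thesis using nn by simp
qed

lemma sum_hcoeff_pair_le:
  assumes "finite I"
  shows "(\<Sum>q\<in>I. (norm (hcoeff v (prod_encode q)))\<^sup>2) \<le> (norm v)\<^sup>2"
proof -
  have "(\<Sum>q\<in>I. (norm (hcoeff v (prod_encode q)))\<^sup>2) = (\<Sum>p\<in>prod_encode ` I. (norm (hcoeff v p))\<^sup>2)"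
    by (subst sum.reindex[OF inj_prod_encode]) simp
  also have "\<dots> \<le> (norm v)\<^sup>2"
    unfolding norm_hardy_square by (rule sum_le_suminf[OF summable_hcoeff]) (use assms in auto)
  finally show ?thesis .
qed

lemma hcoeff_dec: "hcoeff (dec v k) m = hcoeff v (prod_encode (k, m))"
proof -
  have "(\<Sum>m<N. (norm (hcoeff v (prod_encode (k, m))))\<^sup>2) \<le> (norm v)\<^sup>2" for N
    using sum_hcoeff_pair_le[of "Pair k ` {..<N}" v] by (simp add: sum.reindex inj_on_def)
  from hardy_of_if_partial_sums_bounded(1)[OF this] show ?thesis
    unfolding dec_def by (subst hcoeff_hardy_of) auto
qed

lemma sum_norm_dec_le: "(\<Sum>k<K. (norm (dec v k))\<^sup>2) \<le> (norm v)\<^sup>2"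
proof (rule LIMSEQ_le_const2)
  show "(\<lambda>N. \<Sum>k<K. \<Sum>m<N. (norm (hcoeff (dec v k) m))\<^sup>2) \<longlonglongrightarrow> (\<Sum>k<K. (norm (dec v k))\<^sup>2)"
    by (intro tendsto_sum) (use norm_hardy_sums in \<open>simp add: sums_def\<close>)
  have "(\<Sum>k<K. \<Sum>m<N. (norm (hcoeff (dec v k) m))\<^sup>2) \<le> (norm v)\<^sup>2" for N
    using sum_hcoeff_pair_le[of "{..<K} \<times> {..<N}" v] by (simp add: hcoeff_dec sum.cartesian_product case_prod_unfold)
  then show "\<exists>N. \<forall>n\<ge>N. (\<Sum>k<K. \<Sum>m<n. (norm (hcoeff (dec v k) m))\<^sup>2) \<le> (norm v)\<^sup>2" by blast
qed

lemma square_summable_dec: "square_summable (dec v)" "(\<Sum>k. (norm (dec v k))\<^sup>2) \<le> (norm v)\<^sup>2"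
proof -
  show *: "square_summable (dec v)"
    unfolding square_summable_def by (rule summableI_nonneg_bounded[OF _ sum_norm_dec_le]) auto
  show "(\<Sum>k. (norm (dec v k))\<^sup>2) \<le> (norm v)\<^sup>2"
    by (rule suminf_le_const[OF _ sum_norm_dec_le]) (use * in \<open>simp add: square_summable_def\<close>)
qed

lemma enc_dec: "enc (dec v) = v"
  by (rule hardy_eqI_pair) (simp add: hcoeff_enc square_summable_dec hcoeff_dec)

lemma dec_enc: "square_summable x \<Longrightarrow> dec (enc x) k = x k"
  by (rule hardy_eqI) (simp add: hcoeff_enc hcoeff_dec)

lemma square_summable_single: "square_summable (\<lambda>j. if j = k then u else 0)"
  unfolding square_summable_def by (rule summable_finite[of "{k}"]) auto

text \<open>
  The \<open>k\<close>-th decoding is the adjoint of the embedding of the \<open>k\<close>-th summand. On monomials this is a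
  comparison of coefficients.
\<close>

lemma hinner_enc_single: "hinner (enc (\<lambda>j. if j = k then u else 0)) v = hinner u (dec v k)"
proof -
  let ?e = "\<lambda>u. enc (\<lambda>j. if j = k then u else 0)"
  have co: "hcoeff (?e u) (prod_encode (j, m)) = (if j = k then hcoeff u m else 0)" for u j m
    by (simp add: hcoeff_enc square_summable_single hcoeff_zero)
  have bl: "bounded_linear ?e"
  proof (rule bounded_linear_intro[of _ 1])
    show "?e (x + y) = ?e x + ?e y" for x y by (rule hardy_eqI_pair) (simp add: co hcoeff_add)
    show "?e (t *\<^sub>R x) = t *\<^sub>R ?e x" for t x by (rule hardy_eqI_pair) (simp add: co hcoeff_scaleR)
    show "norm (?e x) \<le> norm x * 1" for x
    proof -
      have "(\<lambda>j. (norm (if j = k then x else 0))\<^sup>2) sums (\<Sum>j\<in>{k}. (norm (if j = k then x else 0))\<^sup>2)"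
        by (rule sums_finite) auto
      then have "(norm (?e x))\<^sup>2 \<le> (norm x)\<^sup>2"
        using norm_enc_le[OF square_summable_single[of k x]] by (simp add: sums_iff)
      then show ?thesis using power2_le_imp_le[of "norm (?e x)" "norm x"] by simp
    qed
  qed
  have mon: "?e (hscale c (monomial m)) = hscale c (monomial (prod_encode (k, m)))" for c m
    by (rule hardy_eqI_pair) (auto simp: co hcoeff_hscale hcoeff_monomial)
  show ?thesis
  proof (rule bounded_linear_eq_on_monomials[of "\<lambda>u. hinner (?e u) v" "\<lambda>u. hinner u (dec v k)"])
    show "bounded_linear (\<lambda>u. hinner (?e u) v)"
      by (rule bounded_linear_compose[OF bounded_linear_hinner_left bl])
    show "bounded_linear (\<lambda>u. hinner u (dec v k))" by (rule bounded_linear_hinner_left)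
    show "hinner (?e (hscale c (monomial n))) v = hinner (hscale c (monomial n)) (dec v k)" for c n
      unfolding mon hinner_hscale_left
      by (subst (1 2) hinner_commute) (simp add: hinner_monomial hcoeff_dec)
  qed
qed

text \<open>
  The encoding is isometric: a sequence is the limit of its truncations, for which the identity is the
  previous lemma.
\<close>

lemma hinner_enc_sums:
  assumes x: "square_summable x"
  shows "(\<lambda>k. hinner (x k) (dec v k)) sums hinner (enc x) v"
proof -
  let ?t = "\<lambda>K j. if j < K then 0 else x j"
  have sst: "square_summable (?t K)" for K
    unfolding square_summable_def
    by (rule summable_comparison_test'[of "\<lambda>k. (norm (x k))\<^sup>2" 0])
       (use x in \<open>auto simp: square_summable_def\<close>)
  have dif: "enc x - (\<Sum>k<K. enc (\<lambda>j. if j = k then x k else 0)) = enc (?t K)" for K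
  proof (rule hardy_eqI_pair)
    fix k m
    have "(\<Sum>i<K. hcoeff (if k = i then x i else 0) m) = (if k < K then hcoeff (x k) m else 0)"
      by (simp add: if_distrib[of "\<lambda>u. hcoeff u m"] hcoeff_zero cong: if_cong)
    then show "hcoeff (enc x - (\<Sum>k<K. enc (\<lambda>j. if j = k then x k else 0))) (prod_encode (k, m))
        = hcoeff (enc (?t K)) (prod_encode (k, m))"
      by (simp add: hcoeff_diff hcoeff_sum hcoeff_enc x sst square_summable_single hcoeff_zero)
  qed
  have "(\<lambda>K. enc (?t K)) \<longlonglongrightarrow> 0"
  proof (rule Lim_null_comparison)
    have sx: "summable (\<lambda>k. (norm (x k))\<^sup>2)" using x by (simp add: square_summable_def)
    show "\<forall>\<^sub>F K in sequentially. norm (enc (?t K)) \<le> sqrt (\<Sum>k. (norm (x (k + K)))\<^sup>2)"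
    proof (rule always_eventually, rule allI)
      fix K
      have "(\<Sum>k. (norm (?t K k))\<^sup>2) = (\<Sum>k. (norm (?t K (k + K)))\<^sup>2) + (\<Sum>k<K. (norm (?t K k))\<^sup>2)"
        using sst[of K] by (intro suminf_split_initial_segment) (simp add: square_summable_def)
      then have "(norm (enc (?t K)))\<^sup>2 \<le> (\<Sum>k. (norm (x (k + K)))\<^sup>2)"
        using norm_enc_le[OF sst[of K]] by simp
      then show "norm (enc (?t K)) \<le> sqrt (\<Sum>k. (norm (x (k + K)))\<^sup>2)" by (rule real_le_rsqrt)
    qed
    have "(\<lambda>K. sqrt (\<Sum>k. (norm (x (k + K)))\<^sup>2)) \<longlonglongrightarrow> sqrt 0"
      by (intro tendsto_real_sqrt suminf_exist_split2[OF sx])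
    then show "(\<lambda>K. sqrt (\<Sum>k. (norm (x (k + K)))\<^sup>2)) \<longlonglongrightarrow> 0" by simp
  qed
  from tendsto_diff[OF tendsto_const[of "enc x"] this]
  have "(\<lambda>K. \<Sum>k<K. enc (\<lambda>j. if j = k then x k else 0)) \<longlonglongrightarrow> enc x"
    by (simp add: dif[symmetric])
  from bounded_linear.tendsto[OF bounded_linear_hinner_left this, of v]
  show ?thesis by (simp add: sums_def hinner_sum_left hinner_enc_single)
qed

lemma square_summable_mult_op:
  assumes f: "f \<in> H_infty" and x: "square_summable x"
  shows "square_summable (\<lambda>k. mult_op f (x k))"
proof -
  obtain M where M: "M \<ge> 0" "\<And>z. z \<in> disk \<Longrightarrow> norm (f z) \<le> M" using H_inftyD(3)[OF f] by blast
  have le: "(norm (mult_op f (x k)))\<^sup>2 \<le> M\<^sup>2 * (norm (x k))\<^sup>2" for k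
    using power_mono[OF norm_mult_op_le[OF f M, of "x k"], of 2] by (simp add: power_mult_distrib)
  show ?thesis
    unfolding square_summable_def
  proof (rule summable_comparison_test)
    show "summable (\<lambda>k. M\<^sup>2 * (norm (x k))\<^sup>2)"
      by (rule summable_mult) (use x in \<open>simp add: square_summable_def\<close>)
  qed (use le in simp)
qed

text \<open>
  The ampliation of the multiplication operator to infinitely many copies, in encoded form.
\<close>

definition inf_ampl :: "(complex \<Rightarrow> complex) \<Rightarrow> hardy \<Rightarrow> hardy" where
  "inf_ampl f v = enc (\<lambda>k. mult_op f (dec v k))"

lemma hcoeff_inf_ampl:
  "f \<in> H_infty \<Longrightarrow> hcoeff (inf_ampl f v) (prod_encode (k, m))
    = (\<Sum>i\<le>m. taylor_coeff f i * hcoeff v (prod_encode (k, m - i)))"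
  by (simp add: inf_ampl_def hcoeff_enc square_summable_mult_op square_summable_dec hcoeff_mult_op hcoeff_dec)

lemma inf_ampl_hscale: "f \<in> H_infty \<Longrightarrow> inf_ampl f (hscale c v) = hscale c (inf_ampl f v)"
  by (rule hardy_eqI_pair) (simp add: hcoeff_inf_ampl hcoeff_hscale sum_distrib_left mult_ac)

lemma bounded_linear_inf_ampl: assumes f: "f \<in> H_infty" shows "bounded_linear (inf_ampl f)"
proof -
  obtain M where M: "M \<ge> 0" "\<And>z. z \<in> disk \<Longrightarrow> norm (f z) \<le> M" using H_inftyD(3)[OF f] by blast
  show ?thesis
  proof (rule bounded_linear_intro[of _ M])
    show "inf_ampl f (x + y) = inf_ampl f x + inf_ampl f y" for x y
      by (rule hardy_eqI_pair) (simp add: hcoeff_inf_ampl f hcoeff_add algebra_simps sum.distrib)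
    show "inf_ampl f (t *\<^sub>R x) = t *\<^sub>R inf_ampl f x" for t x
      using inf_ampl_hscale[OF f, of "of_real t" x] by (simp add: hscale_of_real)
    show "norm (inf_ampl f x) \<le> norm x * M" for x
    proof (rule power2_le_imp_le)
      have sd: "summable (\<lambda>k. (norm (dec x k))\<^sup>2)" using square_summable_dec(1) by (simp add: square_summable_def)
      have le: "(norm (mult_op f (dec x k)))\<^sup>2 \<le> M\<^sup>2 * (norm (dec x k))\<^sup>2" for k
        using power_mono[OF norm_mult_op_le[OF f M, of "dec x k"], of 2] by (simp add: power_mult_distrib)
      have "(norm (inf_ampl f x))\<^sup>2 \<le> (\<Sum>k. (norm (mult_op f (dec x k)))\<^sup>2)"
        unfolding inf_ampl_def by (rule norm_enc_le[OF square_summable_mult_op[OF f square_summable_dec(1)]])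
      also have "\<dots> \<le> (\<Sum>k. M\<^sup>2 * (norm (dec x k))\<^sup>2)"
        using square_summable_mult_op[OF f square_summable_dec(1)[of x]]
        by (intro suminf_le le summable_mult sd) (simp add: square_summable_def)
      also have "\<dots> = M\<^sup>2 * (\<Sum>k. (norm (dec x k))\<^sup>2)" by (rule suminf_mult[OF sd])
      also have "\<dots> \<le> M\<^sup>2 * (norm x)\<^sup>2" by (intro mult_left_mono square_summable_dec(2)) auto
      finally show "(norm (inf_ampl f x))\<^sup>2 \<le> (norm x * M)\<^sup>2" by (simp add: power_mult_distrib mult.commute)
    qed (use M in auto)
  qed
qed

definition coord_fun :: "complex \<Rightarrow> complex" where
  "coord_fun z = (if z \<in> disk then z else 0)"

lemma coord_fun_sums: "z \<in> disk \<Longrightarrow> (\<lambda>n. (if n = 1 then 1 else 0) * z ^ n) sums coord_fun z"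
  using sums_If_finite_set[of "{1}" "\<lambda>n. z ^ n"] by (simp add: coord_fun_def if_distrib[of "\<lambda>a. a * _"] cong: if_cong)

lemma coord_fun_H_infty: "coord_fun \<in> H_infty"
proof -
  have "coord_fun holomorphic_on disk" by (rule taylor_coeff_power_series(1)[OF coord_fun_sums])
  moreover have "norm (coord_fun z) \<le> 1" "z \<notin> disk \<Longrightarrow> coord_fun z = 0" for z
    by (auto simp: coord_fun_def)
  ultimately show ?thesis by (auto simp: H_infty_def bounded_iff)
qed

lemma taylor_coeff_coord_fun: "taylor_coeff coord_fun n = (if n = 1 then 1 else 0)"
  by (rule taylor_coeff_power_series(2)[OF coord_fun_sums])

abbreviation shift :: "hardy \<Rightarrow> hardy" where "shift \<equiv> mult_op coord_fun"

lemma sum_taylor_coord_fun: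
  "(\<Sum>i\<le>n. taylor_coeff coord_fun i * a i) = (if n = 0 then 0 else a 1)"
proof -
  have "(\<Sum>i\<le>n. taylor_coeff coord_fun i * a i) = (\<Sum>i\<le>n. if i = 1 then a i else 0)"
    by (intro sum.cong) (auto simp: taylor_coeff_coord_fun)
  then show ?thesis by (simp add: sum.delta)
qed

lemma hcoeff_shift: "hcoeff (shift x) n = (if n = 0 then 0 else hcoeff x (n - 1))"
  by (simp add: hcoeff_mult_op coord_fun_H_infty sum_taylor_coord_fun)

lemma hinner_shift: "hinner (shift x) (shift y) = hinner x y"
proof -
  have "(\<lambda>n. hcoeff (shift x) (Suc n) * cnj (hcoeff (shift y) (Suc n))) sums hinner x y"
    using summable_hinner[of x y] by (simp add: hcoeff_shift hinner_def summable_sums)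
  from sums_Suc[OF this] show ?thesis
    unfolding hinner_def[of "shift x"] by (simp add: hcoeff_shift sums_iff)
qed

abbreviation Shift :: "hardy \<Rightarrow> hardy" where "Shift \<equiv> inf_ampl coord_fun"

lemma hcoeff_Shift:
  "hcoeff (Shift v) (prod_encode (k, m)) = (if m = 0 then 0 else hcoeff v (prod_encode (k, m - 1)))"
  by (simp add: hcoeff_inf_ampl coord_fun_H_infty sum_taylor_coord_fun)

lemma hcoeff_Shift_power:
  "hcoeff ((Shift ^^ n) v) (prod_encode (k, m)) = (if m < n then 0 else hcoeff v (prod_encode (k, m - n)))"
  by (induction n arbitrary: m) (auto simp: hcoeff_Shift)

lemma hinner_Shift: "hinner (Shift v) (Shift w) = hinner v w"
proof -
  note sq = square_summable_mult_op[OF coord_fun_H_infty square_summable_dec(1)]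
  have "(\<lambda>k. hinner (shift (dec v k)) (dec (Shift w) k)) sums hinner (Shift v) (Shift w)"
    unfolding inf_ampl_def[of _ v] by (rule hinner_enc_sums[OF sq])
  moreover have "dec (Shift w) k = shift (dec w k)" for k
    unfolding inf_ampl_def by (rule dec_enc[OF sq])
  moreover have "(\<lambda>k. hinner (dec v k) (dec w k)) sums hinner v w"
    using hinner_enc_sums[OF square_summable_dec(1)[of v], of w] by (simp add: enc_dec)
  ultimately show ?thesis by (simp add: hinner_shift sums_iff)
qed

lemma Shift_power_hscale: "(Shift ^^ n) (hscale c v) = hscale c ((Shift ^^ n) v)"
  by (induction n) (auto simp: inf_ampl_hscale coord_fun_H_infty)

lemma bounded_linear_Shift: "bounded_linear Shift"
  by (rule bounded_linear_inf_ampl[OF coord_fun_H_infty])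

lemma hinner_Shift_power: "hinner ((Shift ^^ n) v) ((Shift ^^ n) w) = hinner v w"
  by (induction n) (auto simp: hinner_Shift)

section \<open>Wandering vectors and factorization\<close>

lemma closure_span_subset:
  assumes "G \<subseteq> Q" "subspace Q" "closed Q"
  shows "closure (span G) \<subseteq> Q"
  using assms by (meson closure_minimal span_minimal)

lemma subspace_closure_span: "subspace (closure (span (G :: 'a::real_normed_vector set)))"
  unfolding subspace_def
proof (intro conjI ballI allI)
  let ?S = "span G"
  show "0 \<in> closure ?S" using closure_subset span_zero by blast
  fix x assume x: "x \<in> closure ?S"
  show "c *\<^sub>R x \<in> closure ?S" for c
    using x by (auto simp: closure_sequential intro!: tendsto_scaleR span_scale tendsto_const
      intro: exI[of _ "\<lambda>n. c *\<^sub>R u n" for u])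
  fix y assume y: "y \<in> closure ?S"
  obtain u v where "\<And>n. u n \<in> ?S" "u \<longlonglongrightarrow> x" "\<And>n. v n \<in> ?S" "v \<longlonglongrightarrow> y"
    using x y by (auto simp: closure_sequential)
  then show "x + y \<in> closure ?S"
    unfolding closure_sequential by (intro exI[of _ "\<lambda>n. u n + v n"]) (auto intro: span_add tendsto_add)
qed

text \<open>
  Closed linear conditions on a closed span need only be checked on the generators.
\<close>

lemma closure_span_linear_image:
  assumes T: "bounded_linear T" and G: "\<And>g. g \<in> G \<Longrightarrow> T g \<in> Q" and Q: "subspace Q" "closed Q"
    and v: "v \<in> closure (span G)"
  shows "T v \<in> Q"
proof -
  interpret T: bounded_linear T by (rule T)
  have "closure (span G) \<subseteq> T -` Q"
  proof (rule closure_span_subset)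
    show "subspace (T -` Q)"
      using Q(1) by (auto simp: subspace_def T.add T.scaleR T.zero)
    show "closed (T -` Q)"
      by (rule continuous_closed_vimage[OF Q(2)]) (rule linear_continuous_at[OF T])
  qed (use G in auto)
  then show ?thesis using v by auto
qed

lemma closure_span_linear_eq:
  assumes T: "bounded_linear T" "bounded_linear T'" and G: "\<And>g. g \<in> G \<Longrightarrow> T g = T' g"
    and v: "v \<in> closure (span G)"
  shows "T v = T' v"
proof -
  have "T v - T' v \<in> {0}"
    by (rule closure_span_linear_image[OF bounded_linear_sub[OF T] _ _ _ v]) (use G in auto)
  then show ?thesis by simp
qed

lemma sum_mem:
  assumes "0 \<in> Q" "\<And>x y. x \<in> Q \<Longrightarrow> y \<in> Q \<Longrightarrow> x + y \<in> Q" "\<And>i. i \<in> I \<Longrightarrow> f i \<in> Q"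
  shows "sum f I \<in> Q"
  using assms(3) by (induction I rule: infinite_finite_induct) (auto intro: assms)

text \<open>
  The complex multiples of the vectors \<open>S\<^sup>n g\<^sub>k\<close> are included, so that the real span is a complex space.
\<close>

definition gens :: "('k \<Rightarrow> hardy) \<Rightarrow> hardy set" where
  "gens g = {hscale c ((Shift ^^ n) (g k)) | c n k. True}"

definition shift_module :: "('k \<Rightarrow> hardy) \<Rightarrow> hardy set" where
  "shift_module g = closure (span (gens g))"

lemma shift_module_basic:
  shows shift_module_closed: "closed (shift_module g)"
    and shift_module_subspace: "subspace (shift_module g)"
    and gens_in_shift_module: "hscale c ((Shift ^^ n) (g k)) \<in> shift_module g"
proof -
  show "closed (shift_module g)" "subspace (shift_module g)"
    by (simp_all add: shift_module_def subspace_closure_span)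
  have "hscale c ((Shift ^^ n) (g k)) \<in> gens g" by (auto simp: gens_def)
  then show "hscale c ((Shift ^^ n) (g k)) \<in> shift_module g"
    unfolding shift_module_def using closure_subset span_base by blast
qed

lemma shift_module_in: "g k \<in> shift_module g"
  using gens_in_shift_module[of 1 0 g k] by simp

lemma shift_module_hscale: "v \<in> shift_module g \<Longrightarrow> hscale c v \<in> shift_module g"
  unfolding shift_module_def
  by (rule closure_span_linear_image[OF bounded_linear_hscale, where G = "gens g"])
     (use gens_in_shift_module in \<open>auto simp: gens_def hscale_hscale shift_module_def subspace_closure_span\<close>)

lemma shift_module_Shift: "v \<in> shift_module g \<Longrightarrow> Shift v \<in> shift_module g"
  unfolding shift_module_def
proof (rule closure_span_linear_image[OF bounded_linear_Shift, where G = "gens g"])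
  fix h assume "h \<in> gens g"
  then obtain c n k where h: "h = hscale c ((Shift ^^ n) (g k))" by (auto simp: gens_def)
  show "Shift h \<in> closure (span (gens g))"
    using gens_in_shift_module[of c "Suc n" g k]
    by (simp add: h inf_ampl_hscale coord_fun_H_infty shift_module_def)
qed (auto simp: subspace_closure_span)

lemma shift_module_Shift_power: "v \<in> shift_module g \<Longrightarrow> (Shift ^^ n) v \<in> shift_module g"
  by (induction n) (auto intro: shift_module_Shift)

lemma shift_module_subset:
  assumes "\<And>k. g k \<in> shift_module h"
  shows "shift_module g \<subseteq> shift_module h"
  unfolding shift_module_def[of g]
proof (rule closure_span_subset)
  show "gens g \<subseteq> shift_module h"
    using assms by (auto simp: gens_def intro: shift_module_hscale shift_module_Shift_power)
qed (rule shift_module_basic)+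

definition complex_subspace :: "hardy set \<Rightarrow> bool" where
  "complex_subspace Q \<longleftrightarrow> 0 \<in> Q \<and> (\<forall>x\<in>Q. \<forall>y\<in>Q. x + y \<in> Q) \<and> (\<forall>c. \<forall>x\<in>Q. hscale c x \<in> Q)"

text \<open>
  Vectors that depend on their predecessors contribute the vector \<open>0\<close>, so that \<open>u\<close> can have the same index
  type as \<open>w\<close>. The last property says that \<open>u\<close> lies in the complex span of \<open>w\<close>.
\<close>

lemma gram_schmidt:
  fixes w :: "'k::finite \<Rightarrow> hardy"
  obtains u :: "'k \<Rightarrow> hardy" where
    "\<And>k l. hinner (u k) (u l) = (if k = l \<and> u k \<noteq> 0 then 1 else 0)"
    "\<And>j. w j = (\<Sum>k\<in>UNIV. hscale (hinner (w j) (u k)) (u k))"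
    "\<And>Q k. complex_subspace Q \<Longrightarrow> range w \<subseteq> Q \<Longrightarrow> u k \<in> Q"
proof -
  define sub where "sub Q \<longleftrightarrow> complex_subspace Q \<and> range w \<subseteq> Q" for Q
  note sub_defs = sub_def complex_subspace_def
  have "\<exists>u :: 'k \<Rightarrow> hardy. (\<forall>k l. hinner (u k) (u l) = (if k = l \<and> u k \<noteq> 0 then 1 else 0)) \<and>
      (\<forall>k. k \<notin> J \<longrightarrow> u k = 0) \<and> (\<forall>j\<in>J. w j = (\<Sum>k\<in>UNIV. hscale (hinner (w j) (u k)) (u k))) \<and>
      (\<forall>Q. sub Q \<longrightarrow> (\<forall>k. u k \<in> Q))" for J :: "'k set"
  proof (induction J rule: finite_induct[OF finite])
    case 1
    show ?case by (rule exI[of _ "\<lambda>_. 0"]) (simp add: sub_defs)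
  next
    case (2 a J)
    then obtain u where orth: "\<And>k l. hinner (u k) (u l) = (if k = l \<and> u k \<noteq> 0 then 1 else 0)"
      and out: "\<And>k. k \<notin> J \<Longrightarrow> u k = 0"
      and ex: "\<And>j. j \<in> J \<Longrightarrow> w j = (\<Sum>k\<in>UNIV. hscale (hinner (w j) (u k)) (u k))"
      and Q: "\<And>Q k. sub Q \<Longrightarrow> u k \<in> Q" by blast
    define p where "p = (\<Sum>k\<in>UNIV. hscale (hinner (w a) (u k)) (u k))"
    define r where "r = w a - p"
    have ua: "u a = 0" using 2 out by blast
    have pu: "hinner p (u l) = hinner (w a) (u l)" for l
    proof -
      have "hinner p (u l) = (\<Sum>k\<in>UNIV. if k = l \<and> u k \<noteq> 0 then hinner (w a) (u k) else 0)"
        unfolding p_def hinner_sum_left hinner_hscale_left by (intro sum.cong) (auto simp: orth)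
      also have "\<dots> = (\<Sum>k\<in>UNIV. if k = l then hinner (w a) (u k) else 0)"
        by (intro sum.cong) auto
      finally show ?thesis by simp
    qed
    have ru: "hinner r (u l) = 0" for l by (simp add: r_def hinner_diff_left pu)
    have ur: "hinner (u l) r = 0" for l using ru[of l] hinner_commute[of r "u l"] by simp
    show ?case
    proof (cases "r = 0")
      case True
      then have "w a = p" by (simp add: r_def)
      then show ?thesis using orth out ex Q by (intro exI[of _ u]) (auto simp: p_def)
    next
      case False
      define e where "e = hscale (of_real (1 / norm r)) r"
      define u' where "u' = u(a := e)"
      have rr: "hinner r r = of_real ((norm r)\<^sup>2)"
        by (simp add: hinner_self norm_hardy_square)
      have ee: "hinner e e = 1"
        using False by (simp add: e_def hinner_hscale_left hinner_hscale_right rr power2_eq_square)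
      have eu: "hinner e (u l) = 0" "hinner (u l) e = 0" for l
        by (simp_all add: e_def hinner_hscale_left hinner_hscale_right ru ur)
      have e0: "e \<noteq> 0" using ee by auto
      have sum': "(\<Sum>k\<in>UNIV. hscale (hinner x (u' k)) (u' k))
          = (\<Sum>k\<in>UNIV. hscale (hinner x (u k)) (u k)) + hscale (hinner x e) e" for x
      proof -
        have "(\<Sum>k\<in>UNIV. hscale (hinner x (u' k)) (u' k))
            = hscale (hinner x e) e + (\<Sum>k\<in>UNIV - {a}. hscale (hinner x (u' k)) (u' k))"
          by (subst sum.remove[of _ a]) (auto simp: u'_def)
        also have "(\<Sum>k\<in>UNIV - {a}. hscale (hinner x (u' k)) (u' k)) = (\<Sum>k\<in>UNIV - {a}. hscale (hinner x (u k)) (u k))"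
          by (intro sum.cong) (auto simp: u'_def)
        also have "\<dots> = (\<Sum>k\<in>UNIV. hscale (hinner x (u k)) (u k))"
          by (subst (2) sum.remove[of _ a]) (auto simp: ua)
        finally show ?thesis by (simp add: add.commute)
      qed
      have wj: "hinner (w j) e = 0" if "j \<in> J" for j
        by (subst ex[OF that]) (simp add: hinner_sum_left hinner_hscale_left eu)
      have "hinner (w a) e = hinner r e + hinner p e" by (simp add: r_def flip: hinner_add_left)
      also have "hinner p e = 0" by (simp add: p_def hinner_sum_left hinner_hscale_left eu)
      also have "hinner r e = of_real (norm r)"
        using False by (simp add: e_def hinner_hscale_right rr power2_eq_square)
      finally have "hscale (hinner (w a) e) e = r"
        using False by (simp add: e_def hscale_hscale)
      then have wa: "w a = (\<Sum>k\<in>UNIV. hscale (hinner (w a) (u' k)) (u' k))"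
        unfolding sum' by (simp add: r_def p_def)
      have "u' k \<in> Q'" if s: "sub Q'" for Q' k
      proof -
        have "p \<in> Q'" unfolding p_def
          using s Q[OF s] by (intro sum_mem) (auto simp: sub_defs)
        moreover have "w a \<in> Q'" using s by (auto simp: sub_def)
        ultimately have "w a + hscale (- 1) p \<in> Q'" using s by (simp add: sub_defs)
        moreover have "w a + hscale (- 1) p = r" by (simp add: r_def minus_hardy_def uminus_hardy_def)
        ultimately have "e \<in> Q'" using s by (simp add: e_def sub_defs)
        then show ?thesis using Q[OF s] by (simp add: u'_def)
      qed
      moreover have "hinner (u' k) (u' l) = (if k = l \<and> u' k \<noteq> 0 then 1 else 0)" for k l
        using orth[of k l] by (auto simp: u'_def ee eu e0)
      moreover have "w j = (\<Sum>k\<in>UNIV. hscale (hinner (w j) (u' k)) (u' k))" if "j \<in> J" for j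
        unfolding sum' using ex[OF that] wj[OF that] by simp
      moreover have "u' k = 0" if "k \<notin> insert a J" for k using that out by (simp add: u'_def)
      ultimately show ?thesis using wa by (intro exI[of _ u']) auto
    qed
  qed
  from this[of UNIV] obtain u :: "'k \<Rightarrow> hardy" where
    orth: "\<forall>k l. hinner (u k) (u l) = (if k = l \<and> u k \<noteq> 0 then 1 else 0)"
    and ex: "\<forall>j\<in>UNIV. w j = (\<Sum>k\<in>UNIV. hscale (hinner (w j) (u k)) (u k))"
    and Q: "\<And>Q. sub Q \<Longrightarrow> (\<forall>k. u k \<in> Q)" by blast
  show thesis
  proof (rule that[of u])
    show "hinner (u k) (u l) = (if k = l \<and> u k \<noteq> 0 then 1 else 0)" for k l using orth by blast
    show "w j = (\<Sum>k\<in>UNIV. hscale (hinner (w j) (u k)) (u k))" for j using ex by blast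
    fix Q k
    assume "complex_subspace Q" "range w \<subseteq> Q"
    then have "sub Q" by (simp add: sub_def)
    then show "u k \<in> Q" using Q by blast
  qed
qed

text \<open>
  The vectors \<open>S\<^sup>n u\<^sub>k\<close> are orthonormal, except that \<open>u\<^sub>k\<close> may be \<open>0\<close>.
\<close>

definition wandering :: "('k \<Rightarrow> hardy) \<Rightarrow> bool" where
  "wandering u \<longleftrightarrow> (\<forall>k l n m. hinner ((Shift ^^ n) (u k)) ((Shift ^^ m) (u l))
      = (if k = l \<and> n = m \<and> u k \<noteq> 0 then 1 else 0))"

lemma hinner_eq_zero_if_inner:
  assumes "inner x y = 0" "inner x (hscale \<i> y) = 0"
  shows "hinner x y = 0"
  using assms by (simp add: hinner_eq_inner zero_complex.code)

text \<open>
  The Wold decomposition of the invariant subspace \<open>M\<close> generated by \<open>\<xi>\<close>. The vectors \<open>w\<^sub>j\<close>, the components of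
  the generators orthogonal to \<open>S M\<close>, span the wandering subspace \<open>W\<close>, and \<open>u\<close> orthonormalizes them. A
  vector of \<open>M\<close> that is orthogonal to all \<open>S\<^sup>n u\<^sub>k\<close> lies in \<open>S\<^sup>N M\<close> for every \<open>N\<close>, and is \<open>0\<close> because its
  coefficients vanish to every order. Hence the \<open>S\<^sup>n u\<^sub>k\<close> generate \<open>M\<close>.
\<close>

lemma wandering_generators:
  fixes \<xi> :: "'k::finite \<Rightarrow> hardy"
  obtains u :: "'k \<Rightarrow> hardy" where "wandering u" "\<And>j. \<xi> j \<in> shift_module u"
proof -
  define M where "M = shift_module \<xi>"
  have Msub: "subspace M" and Mclosed: "closed M" unfolding M_def by (rule shift_module_basic)+
  have Mh: "hscale c v \<in> M" if "v \<in> M" for c v using that unfolding M_def by (rule shift_module_hscale)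
  have MS: "Shift v \<in> M" if "v \<in> M" for v using that unfolding M_def by (rule shift_module_Shift)
  have \<xi>M: "\<xi> j \<in> M" for j unfolding M_def by (rule shift_module_in)
  interpret S: bounded_linear Shift by (rule bounded_linear_Shift)
  have nS: "norm (Shift v) = norm v" for v
    using hinner_Shift[of v v] by (simp add: norm_eq_sqrt_inner inner_hardy_def)
  have SMsub: "subspace (Shift ` M)" by (rule linear_subspace_image[OF S.linear_axioms Msub])
  have SMclosed: "closed (Shift ` M)"
    unfolding complete_eq_closed[symmetric]
    by (rule complete_isometric_image[of 1])
       (use Msub Mclosed bounded_linear_Shift nS in \<open>auto simp: complete_eq_closed\<close>)
  have SMh: "hscale c v \<in> Shift ` M" if v: "v \<in> Shift ` M" for c v
  proof -
    obtain m where "v = Shift m" "m \<in> M" using v by blast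
    then show ?thesis
      using Mh[of m c] inf_ampl_hscale[OF coord_fun_H_infty, of c m] by (metis imageI)
  qed
  have proj: "\<exists>y\<in>Shift ` M. \<forall>v\<in>M. hinner (x - y) (Shift v) = 0" for x
  proof -
    obtain y where y: "y \<in> Shift ` M" "\<And>v. v \<in> Shift ` M \<Longrightarrow> inner (x - y) v = 0"
      using orthogonal_projection_exists[OF SMsub SMclosed, of x] by blast
    have "hinner (x - y) (Shift v) = 0" if "v \<in> M" for v
      by (rule hinner_eq_zero_if_inner) (use that SMh in \<open>auto intro!: y(2)\<close>)
    then show ?thesis using y(1) by blast
  qed
  have "\<forall>j. \<exists>y. y \<in> Shift ` M \<and> (\<forall>v\<in>M. hinner (\<xi> j - y) (Shift v) = 0)" using proj by blast
  from choice[OF this] obtain y where yM: "\<And>j. y j \<in> Shift ` M"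
    and y: "\<And>j v. v \<in> M \<Longrightarrow> hinner (\<xi> j - y j) (Shift v) = 0" by blast
  define w where "w j = \<xi> j - y j" for j
  define W where "W = {x \<in> M. \<forall>v\<in>M. hinner x (Shift v) = 0}"
  have SMM: "v \<in> M" if "v \<in> Shift ` M" for v using that MS by auto
  have wW: "w j \<in> W" for j
    unfolding W_def w_def using y subspace_diff[OF Msub \<xi>M SMM[OF yM]] by auto
  obtain u :: "'k \<Rightarrow> hardy" where orth: "\<And>k l. hinner (u k) (u l) = (if k = l \<and> u k \<noteq> 0 then 1 else 0)"
    and wu: "\<And>j. w j = (\<Sum>k\<in>UNIV. hscale (hinner (w j) (u k)) (u k))"
    and uQ: "\<And>Q k. complex_subspace Q \<Longrightarrow> range w \<subseteq> Q \<Longrightarrow> u k \<in> Q"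
    by (rule gram_schmidt[of w]) blast
  have "complex_subspace W"
    unfolding complex_subspace_def W_def
    using Mh subspace_0[OF Msub] subspace_add[OF Msub] by (simp add: hinner_add_left hinner_hscale_left)
  then have uW: "u k \<in> W" for k
    by (rule uQ) (use wW in auto)
  have uM: "u k \<in> M" and uS: "\<And>v. v \<in> M \<Longrightarrow> hinner (u k) (Shift v) = 0" for k
    using uW[of k] by (auto simp: W_def)
  have SuM: "(Shift ^^ n) (u k) \<in> M" for n k
    using uM shift_module_Shift_power unfolding M_def by blast
  have less: "hinner ((Shift ^^ n) (u k)) ((Shift ^^ m) (u l)) = 0" if "n < m" for n m k l
  proof -
    have d: "m = n + Suc (m - Suc n)" using that by simp
    have "(Shift ^^ m) (u l) = (Shift ^^ n) (Shift ((Shift ^^ (m - Suc n)) (u l)))"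
      by (subst d) (simp only: funpow_add o_apply funpow.simps)
    then show ?thesis by (simp only: hinner_Shift_power uS[OF SuM])
  qed
  have wand: "wandering u"
    unfolding wandering_def
  proof (intro allI)
    fix k l and n m :: nat
    consider "n < m" | "n = m" | "m < n" by linarith
    then show "hinner ((Shift ^^ n) (u k)) ((Shift ^^ m) (u l)) = (if k = l \<and> n = m \<and> u k \<noteq> 0 then 1 else 0)"
    proof cases
      case 3
      then show ?thesis
        using less[OF 3, of l k] hinner_commute[of "(Shift ^^ m) (u l)" "(Shift ^^ n) (u k)"] by simp
    qed (auto simp: less hinner_Shift_power orth)
  qed
  define M' where "M' = shift_module u"
  have M'M: "M' \<subseteq> M" unfolding M'_def M_def by (rule shift_module_subset) (use uM in \<open>simp add: M_def\<close>)
  have step: "\<exists>m\<in>M. v = Shift m \<and> (\<forall>n k. hinner m ((Shift ^^ n) (u k)) = 0)"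
    if v: "v \<in> M" "\<And>n k. hinner v ((Shift ^^ n) (u k)) = 0" for v
  proof -
    obtain z where z: "z \<in> Shift ` M" "\<And>x. x \<in> M \<Longrightarrow> hinner (v - z) (Shift x) = 0"
      using proj[of v] by blast
    then obtain m where m: "m \<in> M" "z = Shift m" by blast
    define d where "d = v - z"
    have dM: "d \<in> M" unfolding d_def by (rule subspace_diff[OF Msub v(1) SMM[OF z(1)]])
    have dw: "hinner d (w j) = 0" for j
    proof -
      have "hinner (w j) v = (\<Sum>k\<in>UNIV. hinner (w j) (u k) * hinner (u k) v)"
        by (subst wu) (simp add: hinner_sum_left hinner_hscale_left)
      also have "\<dots> = 0"
        using v(2)[of 0] by (intro sum.neutral) (simp add: hinner_commute[of v])
      finally have "hinner (w j) v = 0" .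
      moreover have "hinner (w j) z = 0" using wW[of j] m by (simp add: W_def)
      ultimately show ?thesis
        unfolding d_def hinner_diff_left by (subst (1 2) hinner_commute) simp
    qed
    have d\<xi>: "hinner d (\<xi> j) = 0" for j
    proof -
      obtain x where x: "y j = Shift x" "x \<in> M" using yM by blast
      have "\<xi> j = w j + Shift x" by (simp add: w_def x)
      then show ?thesis using dw[of j] z(2)[OF x(2)] by (simp add: hinner_add_right d_def)
    qed
    have "d = 0"
    proof -
      have "inner d x \<in> {0}" if x: "x \<in> M" for x
      proof (rule closure_span_linear_image[OF bounded_linear_inner_right _ _ _ x[unfolded M_def shift_module_def]])
        fix h assume "h \<in> gens \<xi>"
        then obtain c n j where h: "h = hscale c ((Shift ^^ n) (\<xi> j))" by (auto simp: gens_def)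
        have "hinner d ((Shift ^^ n) (\<xi> j)) = 0"
        proof (cases n)
          case (Suc n')
          have "(Shift ^^ n') (\<xi> j) \<in> M" using \<xi>M shift_module_Shift_power unfolding M_def by blast
          then show ?thesis using z(2) by (simp add: Suc d_def)
        qed (simp add: d\<xi>)
        then show "inner d h \<in> {0}" by (simp add: h inner_hardy_def hinner_hscale_right)
      qed auto
      then have "inner d d = 0" using dM by blast
      then show ?thesis by simp
    qed
    then have vS: "v = Shift m" by (simp add: d_def m)
    have "hinner m ((Shift ^^ n) (u k)) = 0" for n k
      using v(2)[of "Suc n" k] by (simp add: vS hinner_Shift)
    then show ?thesis using vS m(1) by blast
  qed
  have zero: "v = 0" if v: "v \<in> M" "\<And>n k. hinner v ((Shift ^^ n) (u k)) = 0" for v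
  proof -
    have it: "\<exists>m\<in>M. v = (Shift ^^ N) m \<and> (\<forall>n k. hinner m ((Shift ^^ n) (u k)) = 0)" for N
    proof (induction N)
      case 0
      then show ?case using v by auto
    next
      case (Suc N)
      then obtain m where m: "m \<in> M" "v = (Shift ^^ N) m" "\<And>n k. hinner m ((Shift ^^ n) (u k)) = 0" by blast
      from step[OF m(1,3)] obtain m' where m': "m' \<in> M" "m = Shift m'" "\<And>n k. hinner m' ((Shift ^^ n) (u k)) = 0"
        by blast
      have "v = (Shift ^^ Suc N) m'" by (simp only: m(2) m'(2) funpow_Suc_right o_apply)
      then show ?case using m' by blast
    qed
    show ?thesis
    proof (rule hardy_eqI_pair)
      fix k l
      obtain m where "v = (Shift ^^ Suc l) m" using it[of "Suc l"] by blast
      then have "hcoeff v (prod_encode (k, l)) = 0" by (simp only: hcoeff_Shift_power) simp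
      then show "hcoeff v (prod_encode (k, l)) = hcoeff 0 (prod_encode (k, l))" by (simp add: hcoeff_zero)
    qed
  qed
  have "\<xi> j \<in> M'" for j
  proof -
    obtain q where q: "q \<in> M'" "\<And>v. v \<in> M' \<Longrightarrow> inner (\<xi> j - q) v = 0"
      using orthogonal_projection_exists[of M' "\<xi> j"] shift_module_basic(1,2)[of u] unfolding M'_def by blast
    have "\<xi> j - q = 0"
    proof (rule zero)
      show "\<xi> j - q \<in> M" using q(1) M'M \<xi>M subspace_diff[OF Msub] by blast
      show "hinner (\<xi> j - q) ((Shift ^^ n) (u k)) = 0" for n k
        by (rule hinner_eq_zero_if_inner)
           (use gens_in_shift_module[of 1 n u k] gens_in_shift_module[of \<i> n u k] in \<open>auto intro!: q(2) simp: M'_def\<close>)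
    qed
    then show ?thesis using q(1) by simp
  qed
  then show thesis using that[OF wand] by (simp add: M'_def)
qed

subsection \<open>Coordinates with respect to wandering vectors\<close>

lemma orthogonal_series_summable:
  fixes e :: "nat \<Rightarrow> 'a::{real_inner,banach}"
  assumes orth: "\<And>m n. m \<noteq> n \<Longrightarrow> inner (e m) (e n) = 0" and s: "summable (\<lambda>n. (norm (e n))\<^sup>2)"
  shows "summable e"
  unfolding summable_Cauchy
proof (intro allI impI)
  fix \<epsilon> :: real assume \<epsilon>: "\<epsilon> > 0"
  then obtain N where N: "\<And>m n. m \<ge> N \<Longrightarrow> norm (\<Sum>k=m..<n. (norm (e k))\<^sup>2) < \<epsilon>\<^sup>2"
    using s unfolding summable_Cauchy by (meson zero_less_power)
  have "norm (sum e {m..<n}) < \<epsilon>" if "m \<ge> N" for m n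
  proof (rule power2_less_imp_less)
    have "(norm (sum e {m..<n}))\<^sup>2 = (\<Sum>k=m..<n. (norm (e k))\<^sup>2)"
      by (rule norm_sum_Pythagorean) (auto simp: pairwise_def orthogonal_def orth)
    then show "(norm (sum e {m..<n}))\<^sup>2 < \<epsilon>\<^sup>2" using N[OF that, of n] by simp
  qed (use \<epsilon> in simp)
  then show "\<exists>N. \<forall>m\<ge>N. \<forall>n. norm (sum e {m..<n}) < \<epsilon>" by blast
qed

lemma bessel_inequality:
  assumes I: "finite I"
    and orth: "\<And>i j. i \<in> I \<Longrightarrow> j \<in> I \<Longrightarrow> hinner (e i) (e j) = (if i = j \<and> e i \<noteq> 0 then 1 else 0)"
  shows "(\<Sum>i\<in>I. (norm (hinner v (e i)))\<^sup>2) \<le> (norm v)\<^sup>2"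
proof -
  define p where "p = (\<Sum>i\<in>I. hscale (hinner v (e i)) (e i))"
  have pe: "hinner p (e j) = hinner v (e j)" if j: "j \<in> I" for j
  proof -
    have "hinner p (e j) = (\<Sum>i\<in>I. if i = j then hinner v (e i) else 0)"
      unfolding p_def hinner_sum_left hinner_hscale_left
      by (intro sum.cong) (use orth[OF _ j] in auto)
    then show ?thesis using I j by simp
  qed
  have right: "hinner x p = (\<Sum>i\<in>I. cnj (hinner v (e i)) * hinner x (e i))" for x
    unfolding p_def by (subst hinner_commute) (simp add: hinner_sum_left hinner_hscale_left hinner_commute[of x])
  have vp: "hinner v p = of_real (\<Sum>i\<in>I. (norm (hinner v (e i)))\<^sup>2)"
    unfolding right of_real_sum complex_norm_square by (simp add: mult.commute)
  have "hinner p p = hinner v p" unfolding right by (intro sum.cong) (auto simp: pe)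
  then have "inner (v - p) p = 0" by (simp add: inner_hardy_def hinner_diff_left)
  then have "(norm v)\<^sup>2 = (norm (v - p))\<^sup>2 + (norm p)\<^sup>2"
    using norm_add_Pythagorean[of "v - p" p] by (simp add: orthogonal_def)
  moreover have "(norm p)\<^sup>2 = (\<Sum>i\<in>I. (norm (hinner v (e i)))\<^sup>2)"
    using \<open>hinner p p = hinner v p\<close> by (simp add: power2_norm_eq_inner inner_hardy_def vp)
  ultimately show ?thesis by simp
qed

lemma hinner_scaleR_left: "hinner (t *\<^sub>R x) y = of_real t * hinner x y"
  by (simp add: hinner_hscale_left flip: hscale_of_real)

text \<open>
  The adjoint of the partial isometry that sends \<open>z\<^sup>n\<close> in the \<open>k\<close>-th copy of the Hardy space to \<open>S\<^sup>n u\<^sub>k\<close>.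
\<close>

definition coords :: "('k::finite \<Rightarrow> hardy) \<Rightarrow> hardy \<Rightarrow> hardy^'k" where
  "coords u v = (\<chi> k. hardy_of (\<lambda>n. hinner v ((Shift ^^ n) (u k))))"

lemma vinner_inner: "Re (vinner x y) = inner x y"
  by (simp add: vinner_def inner_vec_def inner_hardy_def)

lemma norm_vec_hardy: "(norm (x :: hardy^'k::finite))\<^sup>2 = (\<Sum>k\<in>UNIV. (norm (x $ k))\<^sup>2)"
  unfolding power2_norm_eq_inner inner_vec_def ..

lemma coords_bound:
  fixes u :: "'k::finite \<Rightarrow> hardy"
  assumes u: "wandering u"
  shows "(\<Sum>k\<in>UNIV. \<Sum>n<N. (norm (hinner v ((Shift ^^ n) (u k))))\<^sup>2) \<le> (norm v)\<^sup>2"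
proof -
  have nz: "(Shift ^^ n) (u k) \<noteq> 0 \<longleftrightarrow> u k \<noteq> 0" for n k
    using hinner_Shift_power[of n "u k" "u k"] by (auto simp: hinner_self norm_hardy_square[symmetric])
  have "(\<Sum>q\<in>UNIV \<times> {..<N}. (norm (hinner v ((Shift ^^ snd q) (u (fst q)))))\<^sup>2) \<le> (norm v)\<^sup>2"
    by (rule bessel_inequality) (use u nz in \<open>auto simp: wandering_def\<close>)
  then show ?thesis by (simp add: sum.cartesian_product case_prod_unfold)
qed

lemma hcoeff_coords:
  assumes u: "wandering u"
  shows "hcoeff (coords u v $ k) n = hinner v ((Shift ^^ n) (u k))"
proof -
  have "(\<Sum>n<N. (norm (hinner v ((Shift ^^ n) (u k))))\<^sup>2) \<le> (norm v)\<^sup>2" for N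
  proof -
    have "(\<Sum>n<N. (norm (hinner v ((Shift ^^ n) (u k))))\<^sup>2) \<le> (\<Sum>k\<in>UNIV. \<Sum>n<N. (norm (hinner v ((Shift ^^ n) (u k))))\<^sup>2)"
      by (rule member_le_sum[of k UNIV "\<lambda>k. \<Sum>n<N. (norm (hinner v ((Shift ^^ n) (u k))))\<^sup>2"]) (auto intro: sum_nonneg)
    then show ?thesis using coords_bound[OF u, where N = N and v = v] by linarith
  qed
  from hardy_of_if_partial_sums_bounded(1)[OF this] show ?thesis
    unfolding coords_def by (simp add: hcoeff_hardy_of)
qed

lemma norm_coords_le:
  assumes u: "wandering u"
  shows "norm (coords u v) \<le> norm v"
proof (rule power2_le_imp_le)
  show "(norm (coords u v))\<^sup>2 \<le> (norm v)\<^sup>2"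
    unfolding norm_vec_hardy
  proof (rule LIMSEQ_le_const2)
    show "(\<lambda>N. \<Sum>k\<in>UNIV. \<Sum>n<N. (norm (hcoeff (coords u v $ k) n))\<^sup>2) \<longlonglongrightarrow> (\<Sum>k\<in>UNIV. (norm (coords u v $ k))\<^sup>2)"
      by (intro tendsto_sum) (use norm_hardy_sums in \<open>simp add: sums_def\<close>)
    show "\<exists>N. \<forall>n\<ge>N. (\<Sum>k\<in>UNIV. \<Sum>n<n. (norm (hcoeff (coords u v $ k) n))\<^sup>2) \<le> (norm v)\<^sup>2"
      using coords_bound[OF u] by (simp add: hcoeff_coords[OF u])
  qed
qed simp

lemma bounded_linear_coords: assumes u: "wandering u" shows "bounded_linear (coords u)"
proof (rule bounded_linear_intro[of _ 1])
  show "coords u (x + y) = coords u x + coords u y" for x y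
    by (simp add: vec_eq_iff) (auto intro!: hardy_eqI simp: hcoeff_coords u hcoeff_add hinner_add_left)
  show "coords u (t *\<^sub>R x) = t *\<^sub>R coords u x" for t x
    by (simp add: vec_eq_iff)
       (auto intro!: hardy_eqI simp: hcoeff_coords u hcoeff_scaleR hinner_scaleR_left scaleR_conv_of_real)
qed (use norm_coords_le[OF u] in simp)

lemma bounded_linear_vinner_left: "bounded_linear (\<lambda>x. vinner x y)"
  unfolding vinner_def
  by (intro bounded_linear_sum bounded_linear_compose[OF bounded_linear_hinner_left bounded_linear_vec_nth])

text \<open>
  Parseval's identity for the subspace generated by \<open>u\<close>. Both sides are continuous and linear in \<open>v\<close>, so it is
  enough to take \<open>v = S\<^sup>n u\<^sub>k\<close>.
\<close>

lemma hinner_coords: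
  assumes u: "wandering u" and v: "v \<in> shift_module u"
  shows "hinner v w = vinner (coords u v) (coords u w)"
proof (rule closure_span_linear_eq[of "\<lambda>v. hinner v w" "\<lambda>v. vinner (coords u v) (coords u w)" "gens u"])
  show "bounded_linear (\<lambda>v. hinner v w)" by (rule bounded_linear_hinner_left)
  show "bounded_linear (\<lambda>v. vinner (coords u v) (coords u w))"
    by (rule bounded_linear_compose[OF bounded_linear_vinner_left bounded_linear_coords[OF u]])
  show "v \<in> closure (span (gens u))" using v by (simp add: shift_module_def)
  fix g assume "g \<in> gens u"
  then obtain c n k where g: "g = hscale c ((Shift ^^ n) (u k))" by (auto simp: gens_def)
  show "hinner g w = vinner (coords u g) (coords u w)"
  proof (cases "u k = 0")
    case True
    have "(Shift ^^ n) (0::hardy) = 0"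
      using Shift_power_hscale[of n 0 0] by simp
    then have "g = 0" by (simp add: g True)
    then show ?thesis
      using bounded_linear.linear[OF bounded_linear_coords[OF u], THEN linear_0] by (simp add: vinner_def)
  next
    case False
    have "coords u g $ l = (if l = k then hscale c (monomial n) else 0)" for l
      using u False
      by (auto intro!: hardy_eqI simp: hcoeff_coords u g hinner_hscale_left wandering_def hcoeff_hscale hcoeff_monomial hcoeff_zero)
    then have "vinner (coords u g) (coords u w) = (\<Sum>l\<in>UNIV. if l = k then hinner (hscale c (monomial n)) (coords u w $ l) else 0)"
      unfolding vinner_def by (intro sum.cong) auto
    also have "\<dots> = c * hinner (monomial n) (coords u w $ k)" by (simp add: hinner_hscale_left)
    also have "hinner (monomial n) (coords u w $ k) = hinner ((Shift ^^ n) (u k)) w"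
      by (subst (1 2) hinner_commute) (simp add: hinner_monomial hcoeff_coords u)
    finally show ?thesis by (simp add: g hinner_hscale_left)
  qed
qed

text \<open>
  The function \<open>f\<close> is the image of \<open>1\<close> under multiplication by \<open>f\<close>.
\<close>

lemma summable_taylor_H_infty:
  assumes "f \<in> H_infty" shows "summable (\<lambda>n. (norm (taylor_coeff f n))\<^sup>2)"
proof -
  have "hcoeff (mult_op f (monomial 0)) n = taylor_coeff f n" for n
  proof -
    have "hcoeff (mult_op f (monomial 0)) n = (\<Sum>i\<le>n. if i = n then taylor_coeff f i else 0)"
      unfolding hcoeff_mult_op[OF assms] by (intro sum.cong) (auto simp: hcoeff_monomial)
    then show ?thesis by simp
  qed
  then show ?thesis using summable_hcoeff[of "mult_op f (monomial 0)"] by simp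
qed

lemma bounded_linear_ampl_op:
  assumes "f \<in> H_infty" shows "bounded_linear (ampl_op f :: hardy^'k::finite \<Rightarrow> hardy^'k)"
proof -
  obtain M where M: "M \<ge> 0" "\<And>z. z \<in> disk \<Longrightarrow> norm (f z) \<le> M" using H_inftyD(3)[OF assms] by blast
  interpret bounded_linear "mult_op f" by (rule bounded_linear_mult_op[OF assms])
  show ?thesis
  proof (rule bounded_linear_intro[of _ M])
    show "norm (ampl_op f x) \<le> norm x * M" for x :: "hardy^'k"
    proof (rule power2_le_imp_le)
      have "(norm (mult_op f (x $ k)))\<^sup>2 \<le> M\<^sup>2 * (norm (x $ k))\<^sup>2" for k
        using power_mono[OF norm_mult_op_le[OF assms M, of "x $ k"], of 2] by (simp add: power_mult_distrib)
      then have "(\<Sum>k\<in>UNIV. (norm (mult_op f (x $ k)))\<^sup>2) \<le> (\<Sum>k\<in>UNIV. M\<^sup>2 * (norm (x $ k))\<^sup>2)"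
        by (rule sum_mono)
      then show "(norm (ampl_op f x))\<^sup>2 \<le> (norm x * M)\<^sup>2"
        by (simp add: norm_vec_hardy ampl_op_def power_mult_distrib sum_distrib_left mult.commute)
    qed (use M in auto)
  qed (auto simp: ampl_op_def vec_eq_iff add scaleR)
qed

text \<open>
  For a generator \<open>e\<close> the vectors \<open>S\<^sup>m e\<close> are orthogonal and of equal norm, so the series
  \<open>\<Sum>m. f\<^sub>m S\<^sup>m e\<close> with the Taylor coefficients \<open>f\<^sub>m\<close> of \<open>f\<close> converges in norm. Every coefficient of its sum is a
  finite sum, which identifies the sum with the image of \<open>e\<close>; the coordinates are compared in the same
  way.
\<close>

lemma coords_inf_ampl:
  assumes u: "wandering u" and f: "f \<in> H_infty" and v: "v \<in> shift_module u"
  shows "inf_ampl f v \<in> shift_module u" "coords u (inf_ampl f v) = ampl_op f (coords u v)"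
proof -
  have gen: "inf_ampl f e \<in> shift_module u \<and> coords u (inf_ampl f e) = ampl_op f (coords u e)" if eg: "e \<in> gens u" for e
  proof -
    obtain c n k where e: "e = hscale c ((Shift ^^ n) (u k))" using eg by (auto simp: gens_def)
    let ?t = "\<lambda>m. hscale (taylor_coeff f m) ((Shift ^^ m) e)"
    have eM: "e \<in> shift_module u" unfolding e by (rule gens_in_shift_module)
    have comp: "(Shift ^^ m) ((Shift ^^ n) x) = (Shift ^^ (m + n)) x" for m n x
      by (simp add: funpow_add)
    have orth: "hinner ((Shift ^^ m) e) ((Shift ^^ m') e) = 0" if "m \<noteq> m'" for m m'
      using u that by (simp add: e Shift_power_hscale hinner_hscale_left hinner_hscale_right comp wandering_def)
    have "norm ((Shift ^^ m) e) = norm e" for m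
      using hinner_Shift_power[of m e e] by (simp add: norm_eq_sqrt_inner inner_hardy_def)
    then have "summable (\<lambda>m. (norm (?t m))\<^sup>2)"
      by (simp add: norm_hscale power_mult_distrib summable_mult2 summable_taylor_H_infty[OF f])
    then have "summable ?t"
    proof (rule orthogonal_series_summable[rotated])
      show "inner (?t m) (?t m') = 0" if "m \<noteq> m'" for m m'
        by (simp only: inner_hardy_def hinner_hscale_left hinner_hscale_right orth[OF that]) simp
    qed
    then obtain g where g: "?t sums g" by (auto simp: summable_def)
    have fin: "(\<lambda>m. taylor_coeff f m * (if m \<le> q then b m else 0)) sums (\<Sum>m\<le>q. taylor_coeff f m * b m)" for q b
      using sums_If_finite_set[of "{..q}" "\<lambda>m. taylor_coeff f m * b m"]
      by (simp add: if_distrib[of "\<lambda>a. _ * a"] cong: if_cong)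
    have "hcoeff g (prod_encode (j, q)) = hcoeff (inf_ampl f e) (prod_encode (j, q))" for j q
    proof -
      have "(\<lambda>m. hcoeff (?t m) (prod_encode (j, q))) sums hcoeff g (prod_encode (j, q))"
        by (rule bounded_linear.sums[OF bounded_linear_hcoeff g])
      moreover have "(\<lambda>m. hcoeff (?t m) (prod_encode (j, q))) sums hcoeff (inf_ampl f e) (prod_encode (j, q))"
      proof -
        have sh: "hcoeff ((Shift ^^ m) e) (prod_encode (j, q)) = (if m \<le> q then hcoeff e (prod_encode (j, q - m)) else 0)" for m
          by (simp add: hcoeff_Shift_power)
        show ?thesis unfolding hcoeff_inf_ampl[OF f] hcoeff_hscale sh by (rule fin)
      qed
      ultimately show ?thesis by (rule sums_unique2)
    qed
    then have gF: "g = inf_ampl f e" by (rule hardy_eqI_pair)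
    have "inf_ampl f e \<in> shift_module u"
    proof (rule closed_sequentially[OF shift_module_closed])
      show "(\<lambda>N. \<Sum>m<N. ?t m) \<longlonglongrightarrow> inf_ampl f e" using g by (simp add: sums_def gF)
      show "(\<Sum>m<N. ?t m) \<in> shift_module u" for N
        by (auto intro!: subspace_sum[OF shift_module_subspace] shift_module_hscale shift_module_Shift_power eM)
    qed
    moreover have "coords u (inf_ampl f e) $ l = ampl_op f (coords u e) $ l" for l
    proof (rule hardy_eqI)
      fix q
      have co: "hinner ((Shift ^^ m) e) ((Shift ^^ q) (u l)) = (if m \<le> q then hcoeff (coords u e $ l) (q - m) else 0)" for m
      proof (cases "m \<le> q")
        case True
        then have "(Shift ^^ q) (u l) = (Shift ^^ m) ((Shift ^^ (q - m)) (u l))" by (simp add: comp)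
        then show ?thesis using True by (simp add: hinner_Shift_power hcoeff_coords u)
      next
        case False
        then show ?thesis
          using u by (simp add: e Shift_power_hscale hinner_hscale_left comp wandering_def)
      qed
      have "(\<lambda>m. hinner (?t m) ((Shift ^^ q) (u l))) sums hinner (inf_ampl f e) ((Shift ^^ q) (u l))"
        unfolding gF[symmetric] by (rule bounded_linear.sums[OF bounded_linear_hinner_left g])
      then have "(\<lambda>m. taylor_coeff f m * (if m \<le> q then hcoeff (coords u e $ l) (q - m) else 0)) sums hcoeff (coords u (inf_ampl f e) $ l) q"
        by (simp only: hcoeff_coords[OF u, of "inf_ampl f e"] hinner_hscale_left co)
      then show "hcoeff (coords u (inf_ampl f e) $ l) q = hcoeff (ampl_op f (coords u e) $ l) q"
        using sums_unique2[OF _ fin[of q "\<lambda>m. hcoeff (coords u e $ l) (q - m)"]]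
        by (simp add: ampl_op_def hcoeff_mult_op[OF f])
    qed
    ultimately show ?thesis by (simp add: vec_eq_iff)
  qed
  show "inf_ampl f v \<in> shift_module u"
    by (rule closure_span_linear_image[OF bounded_linear_inf_ampl[OF f] _ shift_module_subspace shift_module_closed v[unfolded shift_module_def]])
       (use gen in blast)
  show "coords u (inf_ampl f v) = ampl_op f (coords u v)"
    by (rule closure_span_linear_eq[OF bounded_linear_compose[OF bounded_linear_coords[OF u] bounded_linear_inf_ampl[OF f]]
          bounded_linear_compose[OF bounded_linear_ampl_op[OF f] bounded_linear_coords[OF u]] _ v[unfolded shift_module_def]])
       (use gen in blast)
qed

text \<open>
  Functionals on \<open>k \<times> k\<close> matrices of multipliers with infinite multiplicity already occur with
  multiplicity \<open>k\<close>: pass to coordinates in the invariant subspace generated by the \<open>k\<close> vectors \<open>\<xi>\<^sub>j\<close>.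
\<close>

theorem multiplicity_reduction:
  fixes \<xi> \<eta> :: "'k::finite \<Rightarrow> hardy"
  obtains X Y :: "(hardy^'k)^'k" where
    "\<And>j. norm (X $ j) \<le> norm (\<xi> j)" "\<And>i. norm (Y $ i) \<le> norm (\<eta> i)"
    "\<And>f i j. f \<in> H_infty \<Longrightarrow> hinner (inf_ampl f (\<xi> j)) (\<eta> i) = vinner (ampl_op f (X $ j)) (Y $ i)"
proof -
  obtain u :: "'k \<Rightarrow> hardy" where u: "wandering u" "\<And>j. \<xi> j \<in> shift_module u"
    by (rule wandering_generators[of \<xi>]) blast
  show thesis
    by (rule that[of "\<chi> j. coords u (\<xi> j)" "\<chi> i. coords u (\<eta> i)"])
       (use u norm_coords_le[OF u(1)] hinner_coords[OF u(1) coords_inf_ampl(1)[OF u(1)]] coords_inf_ampl(2)[OF u(1)] in simp_all)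
qed

section \<open>Weak-* continuous functionals on matrices of multipliers\<close>

lemma bounded_linear_vec_lambda:
  fixes g :: "'i::finite \<Rightarrow> 'a::real_normed_vector \<Rightarrow> 'b::real_normed_vector"
  assumes "\<And>i. bounded_linear (g i)"
  shows "bounded_linear (\<lambda>x. \<chi> i. g i x)"
proof -
  interpret g: bounded_linear "g i" for i by (rule assms)
  have "\<forall>i. \<exists>K. \<forall>x. norm (g i x) \<le> norm x * K" using g.bounded by blast
  from choice[OF this] obtain K where K: "\<And>i x. norm (g i x) \<le> norm x * K i" by blast
  show ?thesis
  proof (rule bounded_linear_intro[of _ "\<Sum>i\<in>UNIV. K i"])
    show "norm (\<chi> i. g i x) \<le> norm x * (\<Sum>i\<in>UNIV. K i)" for x
    proof -
      have "norm (\<chi> i. g i x) \<le> (\<Sum>i\<in>UNIV. norm (g i x))"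
        unfolding norm_vec_def by (rule order_trans[OF L2_set_le_sum]) auto
      also have "\<dots> \<le> (\<Sum>i\<in>UNIV. norm x * K i)" by (intro sum_mono K)
      finally show ?thesis by (simp add: sum_distrib_left)
    qed
  qed (simp_all add: vec_eq_iff g.add g.scaleR)
qed

lemma bounded_linear_matrix_op:
  "G \<in> matrices H_infty \<Longrightarrow> bounded_linear (matrix_op G :: hardy^'r::finite \<Rightarrow> _)"
  unfolding matrix_op_def
  by (intro bounded_linear_vec_lambda bounded_linear_sum bounded_linear_compose[OF bounded_linear_mult_op bounded_linear_vec_nth])
     (auto simp: matrices_def)

lemma bounded_linear_ampl_matrix_op:
  "G \<in> matrices H_infty \<Longrightarrow> bounded_linear (ampl_matrix_op G :: (hardy^'s::finite)^'r::finite \<Rightarrow> _)"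
  unfolding ampl_matrix_op_def
  by (intro bounded_linear_vec_lambda bounded_linear_sum bounded_linear_compose[OF bounded_linear_ampl_op bounded_linear_vec_nth])
     (auto simp: matrices_def)

definition l2_seq :: "(nat \<Rightarrow> 'a::real_normed_vector) \<Rightarrow> bool" where
  "l2_seq x \<longleftrightarrow> summable (\<lambda>n. (norm (x n))\<^sup>2)"

text \<open>
  The value \<open>0\<close> on other matrices makes two pairings equal as functions as soon as they agree on matrices of
  multipliers.
\<close>

definition pairing ::
    "(nat \<Rightarrow> hardy^'r) \<Rightarrow> (nat \<Rightarrow> hardy^'r) \<Rightarrow> (complex \<Rightarrow> complex)^'r^'r \<Rightarrow> real" where
  "pairing x y G = (if G \<in> matrices H_infty then \<Sum>n. inner (matrix_op G (x n)) (y n) else 0)"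

text \<open>
  Compared with the product of the norms of \<open>x\<close> and \<open>y\<close>, which it dominates, half the sum of the squares is
  additive for \<open>interleave\<close>. Rescaling \<open>x\<close> and \<open>y\<close> shows that the infimum over all representations of a
  functional is the same in either case.
\<close>

definition energy :: "(nat \<Rightarrow> 'a::real_normed_vector) \<Rightarrow> (nat \<Rightarrow> 'a) \<Rightarrow> real" where
  "energy x y = ((\<Sum>n. (norm (x n))\<^sup>2) + (\<Sum>n. (norm (y n))\<^sup>2)) / 2"

text \<open>
  Adding two functionals amounts to merging the sequences that represent them.
\<close>

definition interleave :: "(nat \<Rightarrow> 'a) \<Rightarrow> (nat \<Rightarrow> 'a) \<Rightarrow> nat \<Rightarrow> 'a" where
  "interleave x x' n = (if even n then x' (n div 2) else x ((n - 1) div 2))"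

lemma sums_interleave:
  fixes F :: "'a \<Rightarrow> 'b \<Rightarrow> real"
  assumes "(\<lambda>n. F (x n) (y n)) sums a" "(\<lambda>n. F (x' n) (y' n)) sums b"
  shows "(\<lambda>n. F (interleave x x' n) (interleave y y' n)) sums (a + b)"
proof -
  have "(\<lambda>n. F (interleave x x' n) (interleave y y' n))
      = (\<lambda>n. if even n then F (x' (n div 2)) (y' (n div 2)) else F (x ((n - 1) div 2)) (y ((n - 1) div 2)))"
    by (auto simp: interleave_def)
  then show ?thesis using sums_if[OF assms] by simp
qed

lemma sums_interleave_complex:
  fixes F :: "'a \<Rightarrow> 'b \<Rightarrow> complex"
  assumes "(\<lambda>n. F (x n) (y n)) sums a" "(\<lambda>n. F (x' n) (y' n)) sums b"
  shows "(\<lambda>n. F (interleave x x' n) (interleave y y' n)) sums (a + b)"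
  using assms sums_interleave[of "\<lambda>u v. Re (F u v)" x y _ x' y'] sums_interleave[of "\<lambda>u v. Im (F u v)" x y _ x' y']
  by (simp add: sums_complex_iff)

lemma l2_seq_interleave:
  assumes "l2_seq x" "l2_seq x'"
  shows "l2_seq (interleave x x')"
    and "(\<Sum>n. (norm (interleave x x' n))\<^sup>2) = (\<Sum>n. (norm (x n))\<^sup>2) + (\<Sum>n. (norm (x' n))\<^sup>2)"
proof -
  have "(\<lambda>n. (norm (interleave x x' n))\<^sup>2) sums ((\<Sum>n. (norm (x n))\<^sup>2) + (\<Sum>n. (norm (x' n))\<^sup>2))"
    using sums_interleave[of "\<lambda>u _. (norm u)\<^sup>2" x x _ x' x'] assms
    by (simp add: l2_seq_def summable_sums)
  then show "l2_seq (interleave x x')"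
    "(\<Sum>n. (norm (interleave x x' n))\<^sup>2) = (\<Sum>n. (norm (x n))\<^sup>2) + (\<Sum>n. (norm (x' n))\<^sup>2)"
    by (auto simp: l2_seq_def sums_iff)
qed

lemma energy_interleave:
  assumes "l2_seq x" "l2_seq x'" "l2_seq y" "l2_seq y'"
  shows "energy (interleave x x') (interleave y y') = energy x y + energy x' y'"
  using assms by (simp add: energy_def l2_seq_interleave(2) field_simps)

lemma l2_seq_scaleR: "l2_seq x \<Longrightarrow> l2_seq (\<lambda>n. c *\<^sub>R x n)"
  by (simp add: l2_seq_def power_mult_distrib summable_mult)

lemma energy_scaleR:
  assumes "l2_seq x" "l2_seq y" "c \<ge> 0"
  shows "energy (\<lambda>n. sqrt c *\<^sub>R x n) (\<lambda>n. sqrt c *\<^sub>R y n) = c * energy x y"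
  using assms by (simp add: energy_def power_mult_distrib suminf_mult l2_seq_def distrib_left)

lemma energy_minus: "energy (\<lambda>n. - x n) y = energy x y"
  by (simp add: energy_def)

lemma l2_seq_prod_summable:
  assumes "l2_seq x" "l2_seq y"
  shows "summable (\<lambda>n. norm (x n) * norm (y n))"
  using summable_prod_of_square_summable[of "\<lambda>n. of_real (norm (x n))" "\<lambda>n. of_real (norm (y n))"] assms
  by (simp add: l2_seq_def)

lemma summable_inner_bounded:
  assumes T: "bounded_linear T" and xy: "l2_seq x" "l2_seq y"
  shows "summable (\<lambda>n. inner (T (x n)) (y n))"
proof -
  obtain K where K: "\<And>v. norm (T v) \<le> norm v * K" using bounded_linear.bounded[OF T] by blast
  show ?thesis
  proof (rule summable_comparison_test)
    have "\<bar>inner (T (x n)) (y n)\<bar> \<le> (norm (x n) * norm (y n)) * K" for n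
    proof -
      have "\<bar>inner (T (x n)) (y n)\<bar> \<le> norm (T (x n)) * norm (y n)" by (rule Cauchy_Schwarz_ineq2)
      also have "\<dots> \<le> (norm (x n) * K) * norm (y n)" by (intro mult_right_mono K) auto
      finally show ?thesis by (simp add: mult_ac)
    qed
    then show "\<exists>N. \<forall>n\<ge>N. norm (inner (T (x n)) (y n)) \<le> (norm (x n) * norm (y n)) * K" by simp
    show "summable (\<lambda>n. norm (x n) * norm (y n) * K)"
      by (intro summable_mult2 l2_seq_prod_summable xy)
  qed
qed

lemma pairing_sums:
  assumes "G \<in> matrices H_infty" "l2_seq x" "l2_seq y"
  shows "(\<lambda>n. inner (matrix_op G (x n)) (y n)) sums pairing x y G"
  using summable_inner_bounded[OF bounded_linear_matrix_op[OF assms(1)] assms(2,3)] assms(1)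
  by (simp add: pairing_def summable_sums)

lemma pairing_interleave:
  assumes "l2_seq x" "l2_seq x'" "l2_seq y" "l2_seq y'"
  shows "pairing (interleave x x') (interleave y y') = (\<lambda>G. pairing x y G + pairing x' y' G)"
proof
  fix G :: "(complex \<Rightarrow> complex)^'a^'a"
  show "pairing (interleave x x') (interleave y y') G = pairing x y G + pairing x' y' G"
  proof (cases "G \<in> matrices H_infty")
    case True
    have "(\<lambda>n. inner (matrix_op G (interleave x x' n)) (interleave y y' n)) sums (pairing x y G + pairing x' y' G)"
      by (rule sums_interleave) (rule pairing_sums[OF True], fact+)+
    then show ?thesis
      using pairing_sums[OF True l2_seq_interleave(1)[OF assms(1,2)] l2_seq_interleave(1)[OF assms(3,4)]] sums_unique2
      by blast
  qed (simp add: pairing_def)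
qed

lemma pairing_scaleR:
  assumes "l2_seq x" "l2_seq y"
  shows "pairing (\<lambda>n. c *\<^sub>R x n) (\<lambda>n. d *\<^sub>R y n) = (\<lambda>G. c * d * pairing x y G)"
proof
  fix G :: "(complex \<Rightarrow> complex)^'a^'a"
  show "pairing (\<lambda>n. c *\<^sub>R x n) (\<lambda>n. d *\<^sub>R y n) G = c * d * pairing x y G"
  proof (cases "G \<in> matrices H_infty")
    case True
    interpret bounded_linear "matrix_op G :: hardy^'a \<Rightarrow> _" by (rule bounded_linear_matrix_op[OF True])
    show ?thesis
      using sums_mult[OF pairing_sums[OF True assms], of "c * d"] True
      by (simp add: pairing_def scaleR sums_iff mult_ac)
  qed (simp add: pairing_def)
qed

definition functionals :: "((complex \<Rightarrow> complex)^'r^'r::finite \<Rightarrow> real) set" where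
  "functionals = {pairing x y | x y. l2_seq x \<and> l2_seq y}"

lemma functionals_fun_space: "fun_space (functionals :: ((complex \<Rightarrow> complex)^'r^'r::finite \<Rightarrow> real) set)"
  unfolding fun_space_def
proof (intro conjI ballI allI)
  have "l2_seq (\<lambda>n. 0 :: hardy^'r)" by (simp add: l2_seq_def)
  then show "(functionals :: ((complex \<Rightarrow> complex)^'r^'r::finite \<Rightarrow> real) set) \<noteq> {}"
    by (auto simp: functionals_def)
next
  fix u v :: "(complex \<Rightarrow> complex)^'r^'r \<Rightarrow> real" assume "u \<in> functionals" "v \<in> functionals"
  then obtain x y x' y' where *: "u = pairing x y" "v = pairing x' y'" "l2_seq x" "l2_seq y" "l2_seq x'" "l2_seq y'"
    by (auto simp: functionals_def)
  then have "(\<lambda>G. u G + v G) = pairing (interleave x x') (interleave y y')"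
    by (simp add: pairing_interleave)
  then show "(\<lambda>G. u G + v G) \<in> functionals"
    using * l2_seq_interleave(1) unfolding functionals_def by blast
next
  fix c and u :: "(complex \<Rightarrow> complex)^'r^'r \<Rightarrow> real" assume "u \<in> functionals"
  then obtain x y where *: "u = pairing x y" "l2_seq x" "l2_seq y" by (auto simp: functionals_def)
  then have "(\<lambda>G. c * u G) = pairing (\<lambda>n. c *\<^sub>R x n) y"
    using pairing_scaleR[of x y c 1] by simp
  then show "(\<lambda>G. c * u G) \<in> functionals"
    using * l2_seq_scaleR unfolding functionals_def by blast
qed

text \<open>
  The \<open>j\<close>-th components of the vectors \<open>x\<^sub>n\<close> form one vector \<open>\<xi>\<^sub>j\<close> in a direct sum of infinitely many copies,
  to which the reduction of multiplicity applies.
\<close>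

theorem pairing_reduction:
  fixes x y :: "nat \<Rightarrow> hardy^'r::finite"
  assumes x: "l2_seq x" and y: "l2_seq y"
  obtains X Y :: "(hardy^'r)^'r" where
    "(norm X)\<^sup>2 \<le> (\<Sum>n. (norm (x n))\<^sup>2)" "(norm Y)\<^sup>2 \<le> (\<Sum>n. (norm (y n))\<^sup>2)"
    "\<And>G. G \<in> matrices H_infty \<Longrightarrow> pairing x y G = inner (ampl_matrix_op G X) Y"
proof -
  have comp: "square_summable (\<lambda>n. z n $ j)" if "l2_seq z" for z :: "nat \<Rightarrow> hardy^'r" and j
    unfolding square_summable_def
    by (rule summable_comparison_test'[of "\<lambda>n. (norm (z n))\<^sup>2" 0])
       (use that in \<open>auto simp: l2_seq_def Finite_Cartesian_Product.norm_nth_le intro!: power_mono\<close>)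
  define \<xi> where "\<xi> j = enc (\<lambda>n. x n $ j)" for j
  define \<eta> where "\<eta> i = enc (\<lambda>n. y n $ i)" for i
  obtain X Y :: "(hardy^'r)^'r" where X: "\<And>j. norm (X $ j) \<le> norm (\<xi> j)" and Y: "\<And>i. norm (Y $ i) \<le> norm (\<eta> i)"
    and XY: "\<And>f i j. f \<in> H_infty \<Longrightarrow> hinner (inf_ampl f (\<xi> j)) (\<eta> i) = vinner (ampl_op f (X $ j)) (Y $ i)"
    by (rule multiplicity_reduction[of \<xi> \<eta>]) blast
  have bound: "(norm Z)\<^sup>2 \<le> (\<Sum>n. (norm (z n))\<^sup>2)"
    if z: "l2_seq z" and Z: "\<And>j. norm (Z $ j) \<le> norm (enc (\<lambda>n. z n $ j))"
    for z :: "nat \<Rightarrow> hardy^'r" and Z :: "(hardy^'r)^'r"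
  proof -
    have "(norm Z)\<^sup>2 = (\<Sum>j\<in>UNIV. (norm (Z $ j))\<^sup>2)" unfolding power2_norm_eq_inner inner_vec_def[of Z] ..
    also have "\<dots> \<le> (\<Sum>j\<in>UNIV. \<Sum>n. (norm (z n $ j))\<^sup>2)"
      by (intro sum_mono order_trans[OF power_mono[OF Z] norm_enc_le[OF comp[OF z]]]) auto
    also have "\<dots> = (\<Sum>n. \<Sum>j\<in>UNIV. (norm (z n $ j))\<^sup>2)"
      by (rule suminf_sum[symmetric]) (use comp[OF z] in \<open>simp add: square_summable_def\<close>)
    finally show ?thesis by (simp add: norm_vec_hardy)
  qed
  have "pairing x y G = inner (ampl_matrix_op G X) Y" if G: "G \<in> matrices H_infty" for G
  proof -
    have f: "G $ i $ j \<in> H_infty" for i j using G by (simp add: matrices_def)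
    have one: "(\<lambda>n. inner (mult_op f (x n $ j)) (y n $ i)) sums inner (ampl_op f (X $ j)) (Y $ i)"
      if f: "f \<in> H_infty" for f i j
    proof -
      have "(\<lambda>n. hinner (mult_op f (x n $ j)) (dec (\<eta> i) n)) sums hinner (inf_ampl f (\<xi> j)) (\<eta> i)"
        using hinner_enc_sums[OF square_summable_mult_op[OF f comp[OF x]], of j "\<eta> i"]
        by (simp add: inf_ampl_def \<xi>_def dec_enc comp[OF x])
      then have "(\<lambda>n. hinner (mult_op f (x n $ j)) (y n $ i)) sums vinner (ampl_op f (X $ j)) (Y $ i)"
        by (simp add: XY[OF f]) (simp add: \<eta>_def dec_enc comp[OF y])
      then show ?thesis by (simp add: sums_complex_iff vinner_inner flip: inner_hardy_def)
    qed
    have "(\<lambda>n. \<Sum>i\<in>UNIV. \<Sum>j\<in>UNIV. inner (mult_op (G $ i $ j) (x n $ j)) (y n $ i)) sums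
        (\<Sum>i\<in>UNIV. \<Sum>j\<in>UNIV. inner (ampl_op (G $ i $ j) (X $ j)) (Y $ i))"
      by (intro sums_sum one f)
    moreover have "inner (matrix_op G (x n)) (y n) = (\<Sum>i\<in>UNIV. \<Sum>j\<in>UNIV. inner (mult_op (G $ i $ j) (x n $ j)) (y n $ i))" for n
      unfolding inner_vec_def[of "matrix_op G (x n)" "y n"] by (simp add: matrix_op_def inner_sum_left)
    moreover have "inner (ampl_matrix_op G X) Y = (\<Sum>i\<in>UNIV. \<Sum>j\<in>UNIV. inner (ampl_op (G $ i $ j) (X $ j)) (Y $ i))"
      unfolding inner_vec_def[of "ampl_matrix_op G X" Y] by (simp add: ampl_matrix_op_def inner_sum_left)
    ultimately show ?thesis using G by (simp add: pairing_def sums_iff)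
  qed
  then show thesis
    using that[of X Y] bound[OF x, of X] bound[OF y, of Y] X Y by (simp add: \<xi>_def \<eta>_def)
qed

section \<open>Weak-* closed spaces of multipliers are cut out by functionals\<close>

abbreviation tpair :: "(nat \<Rightarrow> hardy) \<Rightarrow> (nat \<Rightarrow> hardy) \<Rightarrow> (complex \<Rightarrow> complex) \<Rightarrow> complex" where
  "tpair x y f \<equiv> trace_pairing x y (mult_op f)"

lemma tpair_sums:
  assumes f: "f \<in> H_infty" and x: "square_summable x" and y: "square_summable y"
  shows "(\<lambda>n. hinner (mult_op f (x n)) (y n)) sums tpair x y f"
proof -
  have "(\<lambda>k. hinner (mult_op f (x k)) (dec (enc y) k)) sums hinner (enc (\<lambda>k. mult_op f (x k))) (enc y)"
    by (rule hinner_enc_sums[OF square_summable_mult_op[OF f x]])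
  then show ?thesis by (simp add: dec_enc y trace_pairing_def sums_iff)
qed

lemma tpair_add:
  assumes "f \<in> H_infty" "g \<in> H_infty" and xy: "square_summable x" "square_summable y"
  shows "tpair x y (\<lambda>z. f z + g z) = tpair x y f + tpair x y g"
  using sums_add[OF tpair_sums[OF assms(1) xy] tpair_sums[OF assms(2) xy]]
    tpair_sums[OF H_infty_add[OF assms(1,2)] xy]
  by (simp add: mult_op_add_left assms hinner_add_left sums_unique2)

lemma tpair_cmult:
  assumes "f \<in> H_infty" and xy: "square_summable x" "square_summable y"
  shows "tpair x y (\<lambda>z. c * f z) = c * tpair x y f"
  using sums_mult[OF tpair_sums[OF assms(1) xy], of c] tpair_sums[OF H_infty_cmult[OF assms(1)] xy, of c]
  by (simp add: mult_op_cmult_left assms hinner_hscale_left sums_unique2)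

lemma tpair_combination:
  assumes "square_summable x" "square_summable y" "square_summable x'" "square_summable y'"
  obtains x'' y'' where "square_summable x''" "square_summable y''"
    "\<And>f. f \<in> H_infty \<Longrightarrow> tpair x'' y'' f = tpair x y f + c * tpair x' y' f"
proof -
  let ?x' = "\<lambda>n. hscale c (x' n)"
  have sx: "square_summable ?x'"
    using assms(3) by (simp add: square_summable_def norm_hscale power_mult_distrib summable_mult)
  have s: "square_summable (interleave u v)" if "square_summable u" "square_summable v" for u v
    using l2_seq_interleave(1)[of u v] that by (simp add: square_summable_def l2_seq_def)
  show thesis
  proof (rule that[of "interleave x ?x'" "interleave y y'"])
    show "square_summable (interleave x ?x')" "square_summable (interleave y y')"
      by (intro s assms sx)+
    fix f assume f: "f \<in> H_infty"
    have "(\<lambda>n. hinner (mult_op f (?x' n)) (y' n)) sums (c * tpair x' y' f)"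
      using sums_mult[OF tpair_sums[OF f assms(3,4)], of c] by (simp add: mult_op_hscale f hinner_hscale_left)
    from sums_interleave_complex[of "\<lambda>u v. hinner (mult_op f u) v", OF tpair_sums[OF f assms(1,2)] this]
    show "tpair (interleave x ?x') (interleave y y') f = tpair x y f + c * tpair x' y' f"
      by (simp add: trace_pairing_def sums_iff)
  qed
qed

definition linear_set :: "(complex \<Rightarrow> complex) set \<Rightarrow> bool" where
  "linear_set A \<longleftrightarrow> A \<subseteq> H_infty \<and> A \<noteq> {} \<and> (\<forall>f\<in>A. \<forall>g\<in>A. (\<lambda>z. f z + g z) \<in> A) \<and> (\<forall>c. \<forall>f\<in>A. (\<lambda>z. c * f z) \<in> A)"

text \<open>
  Linear algebra in finite dimension: if the values of finitely many functionals at \<open>f\<close> are not taken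
  simultaneously on \<open>A\<close>, a combination of the functionals separates \<open>f\<close> from \<open>A\<close>. In the induction, a
  functional that does not vanish on \<open>A\<close> is eliminated by passing to its kernel in \<open>A\<close> and correcting
  \<open>f\<close> by a multiple of some \<open>a\<close> in \<open>A\<close> on which it is \<open>1\<close>.
\<close>

lemma finite_separation:
  assumes "\<And>x y. (x, y) \<in> set ps \<Longrightarrow> square_summable x \<and> square_summable y"
    and "linear_set A" "f \<in> H_infty" "\<not> (\<exists>g\<in>A. \<forall>(x, y)\<in>set ps. tpair x y g = tpair x y f)"
  shows "\<exists>x y. square_summable x \<and> square_summable y \<and> (\<forall>g\<in>A. tpair x y g = 0) \<and> tpair x y f \<noteq> 0"
  using assms
proof (induction ps arbitrary: A f)
  case Nil
  then show ?case by (auto simp: linear_set_def)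
next
  case (Cons p ps)
  obtain x y where p: "p = (x, y)" by (cases p)
  then have xy: "square_summable x" "square_summable y" using Cons.prems(1) by auto
  have ps: "\<And>x y. (x, y) \<in> set ps \<Longrightarrow> square_summable x \<and> square_summable y" using Cons.prems(1) by auto
  have AH: "g \<in> H_infty" if "g \<in> A" for g using Cons.prems(2) that by (auto simp: linear_set_def)
  have Aadd: "(\<lambda>z. g z + h z) \<in> A" if "g \<in> A" "h \<in> A" for g h using Cons.prems(2) that by (auto simp: linear_set_def)
  have Acm: "(\<lambda>z. c * g z) \<in> A" if "g \<in> A" for g c using Cons.prems(2) that by (auto simp: linear_set_def)
  show ?case
  proof (cases "\<forall>g\<in>A. tpair x y g = 0")
    case True
    show ?thesis
    proof (cases "tpair x y f = 0")
      case False then show ?thesis using xy True by blast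
    next
      case f0: True
      show ?thesis
        by (rule Cons.IH[OF ps Cons.prems(2,3)]) (use Cons.prems(4) True f0 in \<open>auto simp: p\<close>)
    qed
  next
    case False
    then obtain a0 where a0: "a0 \<in> A" "tpair x y a0 \<noteq> 0" by blast
    define a where "a = (\<lambda>z. inverse (tpair x y a0) * a0 z)"
    have a: "a \<in> A" unfolding a_def by (rule Acm[OF a0(1)])
    have a1: "tpair x y a = 1" unfolding a_def using a0 by (simp add: tpair_cmult AH xy)
    define A' where "A' = {g \<in> A. tpair x y g = 0}"
    define f' where "f' = (\<lambda>z. f z + (- tpair x y f) * a z)"
    have caH: "(\<lambda>z. c * a z) \<in> H_infty" for c by (rule H_infty_cmult[OF AH[OF a]])
    have f'H: "f' \<in> H_infty" unfolding f'_def by (rule H_infty_add[OF Cons.prems(3) caH])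
    have shift: "tpair x' y' (\<lambda>z. g z + c * a z) = tpair x' y' g + c * tpair x' y' a"
      if "square_summable x'" "square_summable y'" "g \<in> H_infty" for x' y' g c
      by (simp add: tpair_add[OF that(3) caH that(1,2)] tpair_cmult[OF AH[OF a] that(1,2)])
    have "linear_set A'"
    proof -
      have "(\<lambda>z. 0 * a z) \<in> A'" unfolding A'_def using Acm[OF a, of 0] tpair_cmult[OF AH[OF a] xy, of 0] by simp
      then show ?thesis
        unfolding linear_set_def by (auto simp: A'_def AH Aadd Acm tpair_add tpair_cmult xy)
    qed
    moreover have "\<not> (\<exists>g\<in>A'. \<forall>(x', y')\<in>set ps. tpair x' y' g = tpair x' y' f')"
    proof
      assume "\<exists>g\<in>A'. \<forall>(x', y')\<in>set ps. tpair x' y' g = tpair x' y' f'"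
      then obtain g where g: "g \<in> A" "tpair x y g = 0" and eq: "\<And>x' y'. (x', y') \<in> set ps \<Longrightarrow> tpair x' y' g = tpair x' y' f'"
        by (auto simp: A'_def)
      define h where "h = (\<lambda>z. g z + tpair x y f * a z)"
      have "h \<in> A" unfolding h_def by (intro Aadd Acm g a)
      moreover have "tpair x y h = tpair x y f"
        unfolding h_def by (simp add: shift xy AH g a1)
      moreover have "tpair x' y' h = tpair x' y' f" if "(x', y') \<in> set ps" for x' y'
      proof -
        have s: "square_summable x'" "square_summable y'" using ps[OF that] by auto
        have "tpair x' y' g = tpair x' y' f + (- tpair x y f) * tpair x' y' a"
          unfolding eq[OF that] f'_def by (rule shift[OF s Cons.prems(3)])
        then show ?thesis unfolding h_def by (simp add: shift[OF s] AH g)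
      qed
      ultimately show False using Cons.prems(4) by (auto simp: p)
    qed
    ultimately obtain x1 y1 where 1: "square_summable x1" "square_summable y1" "\<And>g. g \<in> A' \<Longrightarrow> tpair x1 y1 g = 0" "tpair x1 y1 f' \<noteq> 0"
      using Cons.IH[OF ps _ f'H, of A'] by blast
    obtain x2 y2 where 2: "square_summable x2" "square_summable y2"
      "\<And>f. f \<in> H_infty \<Longrightarrow> tpair x2 y2 f = tpair x1 y1 f + (- tpair x1 y1 a) * tpair x y f"
      by (rule tpair_combination[OF 1(1,2) xy]) blast
    have "tpair x2 y2 g = 0" if g: "g \<in> A" for g
    proof -
      let ?g = "\<lambda>z. g z + (- tpair x y g) * a z"
      have "tpair x y ?g = 0" by (simp only: shift[OF xy AH[OF g]] a1) simp
      then have "?g \<in> A'" unfolding A'_def using Aadd[OF g Acm[OF a]] by blast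
      from 1(3)[OF this] show ?thesis
        using shift[OF 1(1,2) AH[OF g], of "- tpair x y g"] 2(3)[OF AH[OF g]] by (simp add: algebra_simps)
    qed
    moreover have "tpair x2 y2 f \<noteq> 0"
    proof -
      have "tpair x1 y1 f' = tpair x1 y1 f + (- tpair x y f) * tpair x1 y1 a"
        unfolding f'_def by (rule shift[OF 1(1,2) Cons.prems(3)])
      then show ?thesis using 1(4) 2(3)[OF Cons.prems(3)] by (simp add: mult.commute)
    qed
    ultimately show ?thesis using 2 by blast
  qed
qed

lemma generate_topology_on_finite_Inter:
  assumes "generate_topology_on S U" "a \<in> U"
  shows "\<exists>F. finite F \<and> F \<subseteq> S \<and> a \<in> \<Inter>F \<and> \<Inter>F \<subseteq> U"
  using assms
proof (induction)
  case (Int U V)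
  then obtain F G where "finite F" "F \<subseteq> S" "a \<in> \<Inter>F" "\<Inter>F \<subseteq> U" "finite G" "G \<subseteq> S" "a \<in> \<Inter>G" "\<Inter>G \<subseteq> V" by blast
  then show ?case by (intro exI[of _ "F \<union> G"]) auto
next
  case (UN K)
  then obtain k where k: "k \<in> K" "a \<in> k" by blast
  from UN.IH[OF this] obtain F where "finite F" "F \<subseteq> S" "a \<in> \<Inter>F" "\<Inter>F \<subseteq> k" by blast
  then show ?case using k(1) by (intro exI[of _ F]) auto
next
  case (Basis s)
  then show ?case by (intro exI[of _ "{s}"]) auto
qed auto

lemma hardy_fun_monomial_0: assumes z: "z \<in> disk" shows "hardy_fun (monomial 0) z = 1"
proof -
  have "(\<lambda>n. hcoeff (monomial 0) n * z ^ n) sums 1"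
    using sums_If_finite_set[of "{0}" "\<lambda>n. z ^ n"]
    by (simp add: hcoeff_monomial if_distrib[of "\<lambda>a. a * _"] cong: if_cong)
  then show ?thesis using hardy_fun_sums[OF z] sums_unique2 by blast
qed

lemma mult_op_inj:
  assumes "f \<in> H_infty" "g \<in> H_infty" "mult_op f = mult_op g"
  shows "f = g"
proof
  fix z
  show "f z = g z"
  proof (cases "z \<in> disk")
    case True
    then show ?thesis
      using arg_cong[OF assms(3), of "\<lambda>T. hardy_fun (T (monomial 0)) z"]
      by (simp only: hardy_fun_mult_op assms(1,2) hardy_fun_monomial_0 mult_1_right)
  qed (use assms in \<open>simp add: H_infty_def\<close>)
qed

lemma dual_subalgebraD:
  assumes "dual_subalgebra A"
  shows "A \<subseteq> H_infty" "indicator disk \<in> A" "f \<in> A \<Longrightarrow> g \<in> A \<Longrightarrow> (\<lambda>z. f z + g z) \<in> A"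
    "f \<in> A \<Longrightarrow> g \<in> A \<Longrightarrow> (\<lambda>z. f z * g z) \<in> A" "f \<in> A \<Longrightarrow> (\<lambda>z. c * f z) \<in> A"
    "closedin weak_star_topology (mult_op ` A)"
  using assms by (auto simp: dual_subalgebra_def)

text \<open>
  A weak-* neighbourhood of \<open>f\<close> that misses the closed set \<open>A\<close> is governed by finitely many functionals,
  so the finite-dimensional separation applies.
\<close>

theorem dual_subalgebra_separation:
  assumes A: "dual_subalgebra A" and f: "f \<in> H_infty" "f \<notin> A"
  shows "\<exists>x y. square_summable x \<and> square_summable y \<and> (\<forall>g\<in>A. tpair x y g = 0) \<and> tpair x y f \<noteq> 0"
proof -
  note A' = dual_subalgebraD[OF A]
  let ?S = "{{T \<in> bounded_ops. trace_pairing x y T \<in> U} | x y U. square_summable x \<and> square_summable y \<and> open U}"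
  have z: "square_summable (\<lambda>n. 0)" by (simp add: square_summable_def)
  have top: "mult_op f \<in> topspace weak_star_topology"
    unfolding weak_star_topology_def topology_generated_by_topspace
    using mult_op_bounded_ops[OF f(1)] z open_UNIV by blast
  have "mult_op f \<notin> mult_op ` A" using mult_op_inj[OF f(1)] f(2) A'(1) by blast
  then have mem: "mult_op f \<in> topspace weak_star_topology - mult_op ` A" using top by blast
  have "openin weak_star_topology (topspace weak_star_topology - mult_op ` A)"
    using A'(6) by (simp add: closedin_def)
  then have "generate_topology_on ?S (topspace weak_star_topology - mult_op ` A)"
    by (simp only: weak_star_topology_def openin_topology_generated_by_iff)
  from generate_topology_on_finite_Inter[OF this mem]
  obtain F where F: "finite F" "F \<subseteq> ?S" "mult_op f \<in> \<Inter>F"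
    and sub: "\<Inter>F \<subseteq> topspace weak_star_topology - mult_op ` A" by (elim exE conjE)
  have F4: "T \<notin> mult_op ` A" if "T \<in> \<Inter>F" for T using subsetD[OF sub that] by simp
  have "\<forall>s\<in>F. \<exists>q. square_summable (fst q) \<and> square_summable (snd q) \<and>
      (\<forall>g\<in>H_infty. tpair (fst q) (snd q) g = tpair (fst q) (snd q) f \<longrightarrow> mult_op g \<in> s)"
  proof
    fix s assume s: "s \<in> F"
    from subsetD[OF F(2) s] obtain x y U where "s = {T \<in> bounded_ops. trace_pairing x y T \<in> U}"
      "square_summable x" "square_summable y" by auto
    then show "\<exists>q. square_summable (fst q) \<and> square_summable (snd q) \<and>
      (\<forall>g\<in>H_infty. tpair (fst q) (snd q) g = tpair (fst q) (snd q) f \<longrightarrow> mult_op g \<in> s)"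
      using F(3) s mult_op_bounded_ops by (intro exI[of _ "(x, y)"]) auto
  qed
  from bchoice[OF this] obtain q where q: "\<And>s. s \<in> F \<Longrightarrow> square_summable (fst (q s)) \<and> square_summable (snd (q s)) \<and>
      (\<forall>g\<in>H_infty. tpair (fst (q s)) (snd (q s)) g = tpair (fst (q s)) (snd (q s)) f \<longrightarrow> mult_op g \<in> s)" by blast
  obtain ps where ps: "set ps = q ` F" using F(1) finite_list by (meson finite_imageI)
  have psq: "square_summable x \<and> square_summable y" if xy: "(x, y) \<in> set ps" for x y
  proof -
    obtain s where "s \<in> F" "(x, y) = q s" using xy ps by auto
    then show ?thesis using q[of s] by (metis fst_conv snd_conv)
  qed
  show ?thesis
  proof (rule finite_separation[OF psq _ f(1)])
    show "linear_set A" unfolding linear_set_def using A' by blast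
    show "\<not> (\<exists>g\<in>A. \<forall>(x, y)\<in>set ps. tpair x y g = tpair x y f)"
    proof
      assume "\<exists>g\<in>A. \<forall>(x, y)\<in>set ps. tpair x y g = tpair x y f"
      then obtain g where g: "g \<in> A" and eq: "\<forall>p\<in>set ps. tpair (fst p) (snd p) g = tpair (fst p) (snd p) f"
        by (auto simp: case_prod_unfold)
      have "mult_op g \<in> s" if s: "s \<in> F" for s
        using q[OF s] eq s ps A'(1) g by blast
      then show False using F4[of "mult_op g"] g by blast
    qed
  qed auto
qed

text \<open>
  The reproducing kernel of the Hardy space at the point \<open>z\<close>.
\<close>

definition szego_kernel :: "complex \<Rightarrow> hardy" where
  "szego_kernel z = hardy_of (\<lambda>n. cnj z ^ n)"

lemma hinner_szego_kernel:
  assumes z: "z \<in> disk" shows "hinner x (szego_kernel z) = hardy_fun x z"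
proof -
  have "summable (\<lambda>n. (norm (cnj z ^ n))\<^sup>2)"
    using z by (simp add: norm_power power_mult[symmetric] mult.commute[of _ 2])
      (simp add: power_mult summable_geometric abs_square_less_1)
  then have "hcoeff (szego_kernel z) n = cnj z ^ n" for n unfolding szego_kernel_def by (rule hcoeff_hardy_of)
  then show ?thesis using hardy_fun_sums[OF z, of x] by (simp add: hinner_def sums_iff)
qed

lemma norm_axis: "norm (axis j v :: 'a::real_inner^'n::finite) = norm v"
  by (simp add: norm_eq_sqrt_inner inner_axis)

text \<open>
  Scalar functionals are placed in a single entry of the matrix. Those that kill \<open>A\<close> show that the entries
  of \<open>D\<close> belong to \<open>A\<close>; those given by reproducing kernels at the points of \<open>E\<close> show that the entries vanish
  on \<open>E\<close>.
\<close>

lemma vanishing_ideal_if_annihilated: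
  fixes D :: "(complex \<Rightarrow> complex)^'r^'r::finite"
  assumes A: "dual_subalgebra A" and E: "E \<subseteq> disk" and D: "D \<in> matrices H_infty"
    and ann: "\<And>x y. l2_seq x \<Longrightarrow> l2_seq y \<Longrightarrow> (\<And>G. G \<in> matrices (vanishing_ideal A E) \<Longrightarrow> pairing x y G = 0) \<Longrightarrow> pairing x y D = 0"
  shows "D \<in> matrices (vanishing_ideal A E)"
proof -
  have JH: "vanishing_ideal A E \<subseteq> H_infty" using dual_subalgebraD(1)[OF A] by (auto simp: vanishing_ideal_def)
  have DH: "D $ i $ j \<in> H_infty" for i j using D by (simp add: matrices_def)
  have key: "tpair x y (D $ i $ j) = 0"
    if xy: "square_summable x" "square_summable y" and z: "\<And>g. g \<in> vanishing_ideal A E \<Longrightarrow> tpair x y g = 0" for x y i j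
  proof -
    define c where "c = tpair x y (D $ i $ j)"
    \<comment> \<open>The factor \<open>c\<close> turns the complex value into its squared modulus, which the real part cannot lose.\<close>
    let ?x = "\<lambda>n. axis j (x n)" and ?y = "\<lambda>n. axis i (hscale c (y n))"
    have l2: "l2_seq ?x" "l2_seq ?y"
      using xy by (simp_all add: l2_seq_def square_summable_def norm_hscale power_mult_distrib summable_mult norm_axis)
    have pr: "pairing ?x ?y G = Re (cnj c * tpair x y (G $ i $ j))" if G: "G \<in> matrices H_infty" for G
    proof -
      have GH: "G $ i $ j \<in> H_infty" for i j using G by (simp add: matrices_def)
      have m0: "mult_op (G $ i $ j) 0 = 0" for i j
        using bounded_linear.linear[OF bounded_linear_mult_op[OF GH]] by (rule linear_0)
      have "inner (matrix_op G (?x n)) (?y n) = Re (cnj c * hinner (mult_op (G $ i $ j) (x n)) (y n))" for n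
      proof -
        have "matrix_op G (?x n) $ i = mult_op (G $ i $ j) (x n)"
          unfolding matrix_op_def by (simp add: axis_def if_distrib[of "mult_op _"] m0 cong: if_cong)
        then have "inner (matrix_op G (?x n)) (?y n) = inner (mult_op (G $ i $ j) (x n)) (hscale c (y n))"
          by (simp add: inner_axis)
        then show ?thesis by (simp add: inner_hardy_def hinner_hscale_right)
      qed
      moreover have "(\<lambda>n. Re (cnj c * hinner (mult_op (G $ i $ j) (x n)) (y n))) sums Re (cnj c * tpair x y (G $ i $ j))"
        by (intro sums_Re sums_mult tpair_sums GH xy)
      ultimately show ?thesis using G by (simp add: pairing_def sums_iff)
    qed
    have "pairing ?x ?y D = 0"
    proof (rule ann[OF l2])
      fix G :: "(complex \<Rightarrow> complex)^'r^'r" assume G: "G \<in> matrices (vanishing_ideal A E)"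
      then have "G \<in> matrices H_infty" using JH by (auto simp: matrices_def)
      from pr[OF this] show "pairing ?x ?y G = 0" using z[of "G $ i $ j"] G by (simp add: matrices_def)
    qed
    then have "Re (cnj c * c) = 0" using pr[OF D] by (simp add: c_def)
    then have "c = 0" by (simp add: complex_eq_iff sum_power2_eq_zero_iff flip: power2_eq_square)
    then show ?thesis by (simp add: c_def)
  qed
  have "D $ i $ j \<in> A" for i j
  proof (rule ccontr)
    assume "D $ i $ j \<notin> A"
    from dual_subalgebra_separation[OF A DH this] show False
      using key unfolding vanishing_ideal_def by blast
  qed
  moreover have "(D $ i $ j) z = 0" if z: "z \<in> E" for i j z
  proof -
    let ?s = "\<lambda>u n. if n = (0::nat) then u else (0::hardy)"
    have ss: "square_summable (?s u)" for u
      using square_summable_single[of 0 u] by simp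
    have zd: "z \<in> disk" using z E by blast
    have ev: "tpair (?s (monomial 0)) (?s (szego_kernel z)) f = f z" if f: "f \<in> H_infty" for f
    proof -
      have "tpair (?s (monomial 0)) (?s (szego_kernel z)) f = (\<Sum>n\<in>{0}. hinner (mult_op f (?s (monomial 0) n)) (?s (szego_kernel z) n))"
        unfolding trace_pairing_def by (rule suminf_finite) auto
      then show ?thesis by (simp add: hinner_szego_kernel[OF zd] hardy_fun_mult_op[OF f] hardy_fun_monomial_0[OF zd])
    qed
    have "tpair (?s (monomial 0)) (?s (szego_kernel z)) (D $ i $ j) = 0"
      by (rule key[OF ss ss]) (use ev JH z in \<open>auto simp: vanishing_ideal_def\<close>)
    then show ?thesis using ev[OF DH] by simp
  qed
  ultimately show ?thesis by (simp add: matrices_def vanishing_ideal_def)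
qed

section \<open>Compressions to the residual spaces\<close>

lemma vinner_eq_inner: "vinner x y = Complex (inner x y) (inner x (vscale \<i> y))"
  by (simp add: vinner_def inner_vec_def vscale_def hinner_eq_inner complex_eq_iff)

lemma vinner_eq_0_iff: "vinner x y = 0 \<longleftrightarrow> inner x y = 0 \<and> inner x (vscale \<i> y) = 0"
  by (simp add: vinner_eq_inner complex_eq_iff)

lemma vinner_commute: "vinner y x = cnj (vinner x y)"
  unfolding vinner_def by (simp add: hinner_commute[of "y $ _"])

lemma inner_if_vinner: "vinner x y = 0 \<Longrightarrow> inner x y = 0"
  by (simp add: vinner_eq_0_iff)

lemma vscale_of_real: "vscale (of_real t) x = t *\<^sub>R x"
  by (simp add: vscale_def vec_eq_iff hscale_of_real)

lemma vinner_vscale_left: "vinner (vscale c x) y = c * vinner x y"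
  by (simp add: vinner_def vscale_def hinner_hscale_left sum_distrib_left)

lemma bounded_linear_vscale: "bounded_linear (vscale c :: hardy^'s::finite \<Rightarrow> _)"
  unfolding vscale_def
  by (intro bounded_linear_vec_lambda bounded_linear_compose[OF bounded_linear_hscale bounded_linear_vec_nth])

lemma closed_subspaceD:
  assumes "closed_subspace L"
  shows "closed L" "subspace L" "x \<in> L \<Longrightarrow> vscale c x \<in> L"
  using assms unfolding closed_subspace_def subspace_def by (auto simp flip: vscale_of_real)

lemma orth_proj_eqI:
  assumes N: "closed_subspace N" and y: "y \<in> N" "\<And>v. v \<in> N \<Longrightarrow> vinner (x - y) v = 0"
  shows "orth_proj N x = y"
  unfolding orth_proj_def
proof (rule the_equality)
  fix y' assume y': "y' \<in> N \<and> (\<forall>v\<in>N. vinner (x - y') v = 0)"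
  have d: "y' - y \<in> N" using subspace_diff[OF closed_subspaceD(2)[OF N]] y y' by blast
  have "inner (x - y) (y' - y) = 0" "inner (x - y') (y' - y) = 0"
    using y(2)[OF d] y' d by (auto intro!: inner_if_vinner)
  then have "inner (y' - y) (y' - y) = 0" by (simp add: inner_diff_left)
  then show "y' = y" by simp
qed (use y in blast)

lemma
  assumes N: "closed_subspace N"
  shows orth_proj_in: "orth_proj N x \<in> N"
    and vinner_orth_proj: "v \<in> N \<Longrightarrow> vinner (x - orth_proj N x) v = 0"
proof -
  note N' = closed_subspaceD[OF N]
  obtain y where y: "y \<in> N" "\<And>v. v \<in> N \<Longrightarrow> inner (x - y) v = 0"
    using orthogonal_projection_exists[OF N'(2,1)] by blast
  have v: "vinner (x - y) v = 0" if "v \<in> N" for v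
    using y(2)[OF that] y(2)[OF N'(3)[OF that]] by (simp add: vinner_eq_0_iff)
  have "orth_proj N x = y" by (rule orth_proj_eqI[OF N y(1) v])
  then show "orth_proj N x \<in> N" "v \<in> N \<Longrightarrow> vinner (x - orth_proj N x) v = 0" using y(1) v by auto
qed

lemma inner_orth_proj:
  assumes N: "closed_subspace N" and v: "v \<in> N"
  shows "inner (orth_proj N x) v = inner x v" "inner v (orth_proj N x) = inner v x"
proof -
  have "inner (x - orth_proj N x) v = 0" by (rule inner_if_vinner[OF vinner_orth_proj[OF N v]])
  then show "inner (orth_proj N x) v = inner x v" by (simp add: inner_diff_left)
  then show "inner v (orth_proj N x) = inner v x" by (simp only: inner_commute)
qed

lemma norm_orth_proj_le:
  assumes N: "closed_subspace N" shows "norm (orth_proj N x) \<le> norm x"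
proof -
  have "(norm (orth_proj N x))\<^sup>2 = inner x (orth_proj N x)"
    using inner_orth_proj(1)[OF N orth_proj_in[OF N], of x x] by (simp add: power2_norm_eq_inner)
  also have "\<dots> \<le> norm x * norm (orth_proj N x)" by (rule norm_cauchy_schwarz)
  finally show ?thesis
    by (cases "norm (orth_proj N x) = 0") (auto simp: power2_eq_square mult_le_cancel_right)
qed

lemma bounded_linear_orth_proj:
  assumes N: "closed_subspace N" shows "bounded_linear (orth_proj N)"
proof (rule bounded_linear_intro[of _ 1])
  note S = closed_subspaceD(2)[OF N]
  interpret v: bounded_linear "\<lambda>x. vinner x w" for w :: "hardy^'a" by (rule bounded_linear_vinner_left)
  show "orth_proj N (x + y) = orth_proj N x + orth_proj N y" for x y
  proof (rule orth_proj_eqI[OF N subspace_add[OF S orth_proj_in[OF N] orth_proj_in[OF N]]])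
    fix v assume v: "v \<in> N"
    have "x + y - (orth_proj N x + orth_proj N y) = (x - orth_proj N x) + (y - orth_proj N y)" by simp
    then show "vinner (x + y - (orth_proj N x + orth_proj N y)) v = 0"
      by (simp only: v.add vinner_orth_proj[OF N v] add_0_left)
  qed
  show "orth_proj N (t *\<^sub>R x) = t *\<^sub>R orth_proj N x" for t x
  proof (rule orth_proj_eqI[OF N subspace_scale[OF S orth_proj_in[OF N]]])
    fix v assume v: "v \<in> N"
    show "vinner (t *\<^sub>R x - t *\<^sub>R orth_proj N x) v = 0"
      by (simp only: scaleR_diff_right[symmetric] v.scaleR vinner_orth_proj[OF N v] scaleR_zero_right)
  qed
qed (use norm_orth_proj_le[OF N] in simp)

lemma closed_subspace_residual_space:
  assumes L: "closed_subspace L" shows "closed_subspace (residual_space A E L)"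
proof -
  note L' = closed_subspaceD[OF L]
  interpret v: bounded_linear "\<lambda>x. vinner x w" for w :: "hardy^'a" by (rule bounded_linear_vinner_left)
  have "closed {v. vinner v w = 0}" for w :: "hardy^'a"
    by (intro closed_Collect_eq linear_continuous_on bounded_linear_vinner_left continuous_on_const)
  moreover have "residual_space A E L = L \<inter> (\<Inter>g\<in>vanishing_ideal A E. \<Inter>x\<in>L. {v. vinner v (ampl_op g x) = 0})"
    by (auto simp: residual_space_def)
  ultimately have "closed (residual_space A E L)" using L'(1) by auto
  then show ?thesis
    using L'(3) subspace_0[OF L'(2)] subspace_add[OF L'(2)]
    by (auto simp: closed_subspace_def residual_space_def v.zero v.add vinner_vscale_left)
qed

lemma bounded_linear_proj_tensor_id:
  assumes N: "closed_subspace N" shows "bounded_linear (proj_tensor_id N :: (hardy^'s::finite)^'r::finite \<Rightarrow> _)"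
  unfolding proj_tensor_id_def
  by (intro bounded_linear_vec_lambda bounded_linear_compose[OF bounded_linear_orth_proj[OF N] bounded_linear_vec_nth])

lemma norm_vec_vec: "(norm (x :: ('a::real_inner^'s::finite)^'r::finite))\<^sup>2 = (\<Sum>i\<in>UNIV. (norm (x $ i))\<^sup>2)"
  by (simp only: power2_norm_eq_inner inner_vec_def[of x])

lemma norm_proj_tensor_id_le:
  assumes N: "closed_subspace N" shows "norm (proj_tensor_id N x) \<le> norm (x :: (hardy^'s::finite)^'r::finite)"
proof (rule power2_le_imp_le)
  show "(norm (proj_tensor_id N x))\<^sup>2 \<le> (norm x)\<^sup>2"
    unfolding norm_vec_vec proj_tensor_id_def
    by (intro sum_mono power_mono) (simp_all add: norm_orth_proj_le[OF N])
qed simp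

lemma LatD:
  assumes "L \<in> Lat A" shows "closed_subspace L" "f \<in> A \<Longrightarrow> x \<in> L \<Longrightarrow> ampl_op f x \<in> L"
  using assms by (auto simp: Lat_def)

abbreviation compression ::
    "(complex \<Rightarrow> complex)^'r^'r \<Rightarrow> (hardy^'s) set \<Rightarrow> (hardy^'s)^'r::finite \<Rightarrow> (hardy^'s)^'r" where
  "compression F N \<equiv> \<lambda>x. proj_tensor_id N (ampl_matrix_op F (proj_tensor_id N x))"

lemma bounded_linear_compression:
  assumes "closed_subspace N" "F \<in> matrices H_infty"
  shows "bounded_linear (compression F N :: (hardy^'s::finite)^'r::finite \<Rightarrow> _)"
  by (rule bounded_linear_compose[OF bounded_linear_proj_tensor_id[OF assms(1)]
      bounded_linear_compose[OF bounded_linear_ampl_matrix_op[OF assms(2)] bounded_linear_proj_tensor_id[OF assms(1)]]])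

text \<open>
  The ampliation is an orthogonal sum of copies of the operator, one for each index \<open>k\<close>.
\<close>

lemma norm_ampl_matrix_op_diff_le:
  fixes y :: "(hardy^'s::finite)^'r::finite"
  assumes F: "F \<in> matrices H_infty" and G: "G \<in> matrices H_infty"
  shows "norm (ampl_matrix_op F y - ampl_matrix_op G y) \<le> onorm (\<lambda>x. matrix_op F x - matrix_op G x) * norm y"
proof (rule power2_le_imp_le)
  let ?T = "\<lambda>x. matrix_op F x - matrix_op G x"
  define z where "z k = (\<chi> j. y $ j $ k)" for k
  have bl: "bounded_linear ?T" by (intro bounded_linear_sub bounded_linear_matrix_op F G)
  have co: "(ampl_matrix_op F y - ampl_matrix_op G y) $ i $ k = ?T (z k) $ i" for i k
    by (simp add: ampl_matrix_op_def matrix_op_def ampl_op_def z_def)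
  have sq: "(norm (w :: (hardy^'s)^'r))\<^sup>2 = (\<Sum>k\<in>UNIV. \<Sum>i\<in>UNIV. (norm (w $ i $ k))\<^sup>2)" for w
    unfolding norm_vec_vec norm_vec_hardy by (rule sum.swap)
  have "(norm (ampl_matrix_op F y - ampl_matrix_op G y))\<^sup>2 = (\<Sum>k\<in>UNIV. (norm (?T (z k)))\<^sup>2)"
    unfolding sq co norm_vec_hardy ..
  also have "\<dots> \<le> (\<Sum>k\<in>UNIV. (onorm ?T * norm (z k))\<^sup>2)"
    by (intro sum_mono power_mono onorm[OF bl]) auto
  also have "\<dots> = (onorm ?T)\<^sup>2 * (\<Sum>k\<in>UNIV. (norm (z k))\<^sup>2)"
    by (simp add: power_mult_distrib sum_distrib_left)
  also have "(\<Sum>k\<in>UNIV. (norm (z k))\<^sup>2) = (norm y)\<^sup>2"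
    unfolding sq[of y] norm_vec_hardy by (simp add: z_def)
  finally show "(norm (ampl_matrix_op F y - ampl_matrix_op G y))\<^sup>2 \<le> (onorm ?T * norm y)\<^sup>2"
    by (simp add: power_mult_distrib)
  show "onorm ?T * norm y \<ge> 0" using onorm_pos_le[OF bl] by simp
qed

text \<open>
  The compression of \<open>G\<close> is \<open>0\<close>, since the residual space is orthogonal to the image of \<open>L\<close> under the ideal.
\<close>

lemma onorm_compression_le:
  fixes L :: "(hardy^'s::finite) set" and F :: "(complex \<Rightarrow> complex)^'r^'r::finite"
  assumes L: "L \<in> Lat A" and F: "F \<in> matrices H_infty" and G: "G \<in> matrices (vanishing_ideal A E)"
    and A: "A \<subseteq> H_infty"
  shows "onorm (compression F (residual_space A E L)) \<le> onorm (\<lambda>x. matrix_op F x - matrix_op G x)"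
proof -
  define N where "N = residual_space A E L"
  have N: "closed_subspace N" unfolding N_def by (rule closed_subspace_residual_space[OF LatD(1)[OF L]])
  have GH: "G \<in> matrices H_infty" using G A by (auto simp: matrices_def vanishing_ideal_def)
  interpret P: bounded_linear "proj_tensor_id N :: (hardy^'s)^'r \<Rightarrow> _" by (rule bounded_linear_proj_tensor_id[OF N])
  interpret p: bounded_linear "orth_proj N" by (rule bounded_linear_orth_proj[OF N])
  have zero: "proj_tensor_id N (ampl_matrix_op G (proj_tensor_id N x)) = 0" for x :: "(hardy^'s)^'r"
  proof -
    have "orth_proj N (ampl_op (G $ i $ j) (orth_proj N (x $ j))) = 0" for i j
    proof (rule orth_proj_eqI[OF N subspace_0[OF closed_subspaceD(2)[OF N]]])
      fix v assume "v \<in> N"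
      moreover have "orth_proj N (x $ j) \<in> L" using orth_proj_in[OF N] by (auto simp: N_def residual_space_def)
      moreover have "G $ i $ j \<in> vanishing_ideal A E" using G by (simp add: matrices_def)
      ultimately have "vinner v (ampl_op (G $ i $ j) (orth_proj N (x $ j))) = 0"
        by (simp add: N_def residual_space_def)
      then show "vinner (ampl_op (G $ i $ j) (orth_proj N (x $ j)) - 0) v = 0"
        using vinner_commute[of v] by simp
    qed
    then show ?thesis by (simp add: proj_tensor_id_def ampl_matrix_op_def p.sum vec_eq_iff)
  qed
  show ?thesis
  proof (rule onorm_bound)
    show "0 \<le> onorm (\<lambda>x. matrix_op F x - matrix_op G x)"
      by (intro onorm_pos_le bounded_linear_sub bounded_linear_matrix_op F GH)
    fix x :: "(hardy^'s)^'r"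
    let ?y = "proj_tensor_id N x"
    have "compression F N x = proj_tensor_id N (ampl_matrix_op F ?y - ampl_matrix_op G ?y)"
      by (simp add: P.diff zero)
    then have "norm (compression F N x) \<le> norm (ampl_matrix_op F ?y - ampl_matrix_op G ?y)"
      using norm_proj_tensor_id_le[OF N] by simp
    also have "\<dots> \<le> onorm (\<lambda>x. matrix_op F x - matrix_op G x) * norm ?y"
      by (rule norm_ampl_matrix_op_diff_le[OF F GH])
    also have "\<dots> \<le> onorm (\<lambda>x. matrix_op F x - matrix_op G x) * norm x"
      by (intro mult_left_mono norm_proj_tensor_id_le[OF N] onorm_pos_le bounded_linear_sub bounded_linear_matrix_op F GH)
    finally show "norm (compression F (residual_space A E L) x) \<le> onorm (\<lambda>x. matrix_op F x - matrix_op G x) * norm x"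
      by (simp add: N_def)
  qed
qed

lemma ampl_op_ampl_op:
  "f \<in> H_infty \<Longrightarrow> g \<in> H_infty \<Longrightarrow> (\<lambda>z. f z * g z) \<in> H_infty \<Longrightarrow> ampl_op f (ampl_op g x) = ampl_op (\<lambda>z. f z * g z) x"
  by (simp add: ampl_op_def vec_eq_iff mult_op_mult_left)

lemma ampl_op_vscale: "f \<in> H_infty \<Longrightarrow> ampl_op f (vscale c x) = vscale c (ampl_op f x)"
  by (simp add: ampl_op_def vscale_def vec_eq_iff mult_op_hscale)

lemma residual_spaceI:
  assumes A: "A \<subseteq> H_infty" and L: "closed_subspace L" and v: "v \<in> L"
    and orth: "\<And>g x. g \<in> vanishing_ideal A E \<Longrightarrow> x \<in> L \<Longrightarrow> inner (ampl_op g x) v = 0"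
  shows "v \<in> residual_space A E L"
  unfolding residual_space_def
proof (intro CollectI conjI ballI v)
  fix g x assume g: "g \<in> vanishing_ideal A E" and x: "x \<in> L"
  have gH: "g \<in> H_infty" using g A by (auto simp: vanishing_ideal_def)
  show "vinner v (ampl_op g x) = 0"
    using orth[OF g x] orth[OF g closed_subspaceD(3)[OF L x, of \<i>]]
    by (simp add: vinner_eq_0_iff ampl_op_vscale[OF gH] inner_commute)
qed

lemma residual_spaceD:
  "v \<in> residual_space A E L \<Longrightarrow> v \<in> L"
  "v \<in> residual_space A E L \<Longrightarrow> g \<in> vanishing_ideal A E \<Longrightarrow> x \<in> L \<Longrightarrow> inner (ampl_op g x) v = 0"
  using inner_if_vinner[of v "ampl_op g x"] by (auto simp: residual_space_def inner_commute)

text \<open>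
  The orthogonal complement of \<open>N\<^sub>L\<close> in \<open>L\<close> is invariant under \<open>A\<close>, because \<open>N\<^sub>L\<close> is invariant under the adjoints
  of the multipliers restricted to \<open>L\<close>: the vector \<open>a'\<close> below is the image of \<open>y\<close> under such an adjoint.
\<close>

lemma complement_of_residual_space:
  assumes A: "dual_subalgebra A" and L: "L \<in> Lat A" and f: "f \<in> A"
    and w: "w \<in> L" "\<And>n. n \<in> residual_space A E L \<Longrightarrow> inner w n = 0" and y: "y \<in> residual_space A E L"
  shows "inner (ampl_op f w) y = 0"
proof -
  note A' = dual_subalgebraD[OF A] and L' = LatD[OF L]
  have bl: "bounded_linear (\<lambda>z. inner (ampl_op f z) y)"
    using A'(1) f by (intro bounded_linear_compose[OF bounded_linear_inner_left bounded_linear_ampl_op]) auto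
  obtain a where a: "\<And>z. inner (ampl_op f z) y = inner z a" using riesz_representation[OF bl] by blast
  define a' where "a' = orth_proj L a"
  have a': "inner (ampl_op f z) y = inner z a'" if "z \<in> L" for z
    unfolding a a'_def by (rule inner_orth_proj(2)[OF L'(1) that, symmetric])
  have "a' \<in> residual_space A E L"
  proof (rule residual_spaceI[OF A'(1) L'(1)])
    show "a' \<in> L" unfolding a'_def by (rule orth_proj_in[OF L'(1)])
    fix g x assume g: "g \<in> vanishing_ideal A E" and x: "x \<in> L"
    then have gA: "g \<in> A" by (simp add: vanishing_ideal_def)
    have "ampl_op f (ampl_op g x) = ampl_op g (ampl_op f x)"
      using A'(4)[OF f gA] A'(4)[OF gA f] A'(1) f gA
      by (simp add: ampl_op_ampl_op subsetD[OF A'(1)] mult.commute)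
    then show "inner (ampl_op g x) a' = 0"
      using a'[OF L'(2)[OF gA x]] residual_spaceD(2)[OF y g L'(2)[OF f x]] by simp
  qed
  then show ?thesis using a'[OF w(1)] w(2) by simp
qed

text \<open>
  With \<open>L\<close> generated by the entries of \<open>X\<close>, the entries of \<open>Y\<close> only matter through their projections to \<open>L\<close>, and
  these lie in \<open>N\<^sub>L\<close> because the functional kills the matrices with one nonzero entry \<open>g * f\<close>, where \<open>g\<close> is in
  the ideal and \<open>f\<close> in \<open>A\<close>.
\<close>

theorem functional_bounded_by_compressions:
  fixes x y :: "nat \<Rightarrow> hardy^'r::finite" and F :: "(complex \<Rightarrow> complex)^'r^'r"
  assumes A: "dual_subalgebra A" and F: "F \<in> matrices A" and xy: "l2_seq x" "l2_seq y"
    and ann: "\<And>G. G \<in> matrices (vanishing_ideal A E) \<Longrightarrow> pairing x y G = 0"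
    and s: "\<And>L :: (hardy^'r) set. L \<in> Lat A \<Longrightarrow>
      onorm (compression F (residual_space A E L) :: (hardy^'r)^'r \<Rightarrow> _) \<le> s"
  shows "pairing x y F \<le> s * energy x y"
proof -
  note A' = dual_subalgebraD[OF A]
  have AH: "f \<in> H_infty" if "f \<in> A" for f using A'(1) that by blast
  have FA: "F $ i $ j \<in> A" for i j using F by (simp add: matrices_def)
  have FH: "F \<in> matrices H_infty" using F A'(1) by (auto simp: matrices_def)
  obtain X Y :: "(hardy^'r)^'r" where X: "(norm X)\<^sup>2 \<le> (\<Sum>n. (norm (x n))\<^sup>2)" and Y: "(norm Y)\<^sup>2 \<le> (\<Sum>n. (norm (y n))\<^sup>2)"
    and XY: "\<And>G. G \<in> matrices H_infty \<Longrightarrow> pairing x y G = inner (ampl_matrix_op G X) Y"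
    by (rule pairing_reduction[OF xy]) blast
  define gs where "gs = {ampl_op f (X $ i) | f i. f \<in> A}"
  define L where "L = closure (span gs)"
  have Lsub: "subspace L" unfolding L_def by (rule subspace_closure_span)
  have Lcl: "closed L" by (simp add: L_def)
  have gsL: "ampl_op f (X $ i) \<in> L" if "f \<in> A" for f i
  proof -
    have "ampl_op f (X $ i) \<in> gs" using that unfolding gs_def by blast
    then show ?thesis unfolding L_def by (rule subsetD[OF closure_subset, OF span_base])
  qed
  have Lin: "T v \<in> L" if "bounded_linear T" "\<And>f i. f \<in> A \<Longrightarrow> T (ampl_op f (X $ i)) \<in> L" "v \<in> L" for T v
    by (rule closure_span_linear_image[OF that(1) _ Lsub Lcl that(3)[unfolded L_def]]) (use that(2) in \<open>auto simp: gs_def\<close>)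
  have Lc: "closed_subspace L"
    unfolding closed_subspace_def
  proof (intro conjI ballI allI Lcl)
    fix c v assume "v \<in> L"
    then show "vscale c v \<in> L"
    proof (rule Lin[OF bounded_linear_vscale, rotated])
      fix f i assume f: "f \<in> A"
      have "vscale c (ampl_op f (X $ i)) = ampl_op (\<lambda>z. c * f z) (X $ i)"
        by (simp add: vscale_def ampl_op_def vec_eq_iff mult_op_cmult_left AH[OF f])
      then show "vscale c (ampl_op f (X $ i)) \<in> L" using gsL A'(5)[OF f] by simp
    qed
  qed (use subspace_0[OF Lsub] subspace_add[OF Lsub] in auto)
  have L: "L \<in> Lat A"
    unfolding Lat_def
  proof (intro CollectI conjI ballI Lc)
    fix g v assume g: "g \<in> A" and "v \<in> L"
    from this(2) show "ampl_op g v \<in> L"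
      by (rule Lin[OF bounded_linear_ampl_op[OF AH[OF g]], rotated])
         (simp add: ampl_op_ampl_op AH A'(4) g gsL)
  qed
  define N where "N = residual_space A E L"
  have N: "closed_subspace N" unfolding N_def by (rule closed_subspace_residual_space[OF Lc])
  \<comment> \<open>The vectors \<open>ampl_op f (X $ j)\<close> lie in \<open>L\<close>, so their inner products with \<open>Y\<close> survive this projection.\<close>
  define Y' where "Y' i = orth_proj L (Y $ i)" for i
  have Y'N: "Y' i \<in> N" for i
    unfolding N_def
  proof (rule residual_spaceI[OF A'(1) Lc])
    show "Y' i \<in> L" unfolding Y'_def by (rule orth_proj_in[OF Lc])
    fix g w assume g: "g \<in> vanishing_ideal A E" and w: "w \<in> L"
    have gA: "g \<in> A" using g by (simp add: vanishing_ideal_def)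
    have "inner (ampl_op g w) (Y' i) \<in> {0}"
    proof (rule closure_span_linear_image[OF bounded_linear_compose[OF bounded_linear_inner_left bounded_linear_ampl_op[OF AH[OF gA]]]
          _ _ _ w[unfolded L_def]])
      fix h assume "h \<in> gs"
      then obtain f j where h: "h = ampl_op f (X $ j)" and f: "f \<in> A" by (auto simp: gs_def)
      define p where "p = (\<lambda>z. g z * f z)"
      have pJ: "p \<in> vanishing_ideal A E"
        using g A'(4)[OF gA f] by (simp add: vanishing_ideal_def p_def)
      then have pA: "p \<in> A" by (simp add: vanishing_ideal_def)
      have gh: "ampl_op g h = ampl_op p (X $ j)"
        unfolding h p_def by (rule ampl_op_ampl_op[OF AH[OF gA] AH[OF f] AH[OF A'(4)[OF gA f]]])
      define G :: "(complex \<Rightarrow> complex)^'r^'r" where "G = (\<chi> a b. if a = i \<and> b = j then p else (\<lambda>z. 0))"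
      have zJ: "(\<lambda>z. 0) \<in> vanishing_ideal A E" using A'(5)[OF pA, of 0] by (simp add: vanishing_ideal_def)
      have GJ: "G \<in> matrices (vanishing_ideal A E)" using pJ zJ by (simp add: matrices_def G_def)
      then have GH: "G \<in> matrices H_infty" using A'(1) by (auto simp: matrices_def vanishing_ideal_def)
      have z0: "ampl_op (\<lambda>z. 0) u = 0" for u :: "hardy^'r"
        using mult_op_cmult_left[OF AH[OF pA], of 0] by (simp add: ampl_op_def vec_eq_iff)
      have "ampl_matrix_op G X $ a = (if a = i then ampl_op p (X $ j) else 0)" for a
        unfolding ampl_matrix_op_def G_def
        by (auto simp: z0 if_distrib[of "\<lambda>q. ampl_op q _"] cong: if_cong)
      then have "inner (ampl_matrix_op G X) Y = (\<Sum>a\<in>UNIV. if a = i then inner (ampl_op p (X $ j)) (Y $ a) else 0)"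
        unfolding inner_vec_def[of "ampl_matrix_op G X" Y] by (intro sum.cong) auto
      then have "inner (ampl_op p (X $ j)) (Y $ i) = 0" using XY[OF GH] ann[OF GJ] by simp
      then show "inner (ampl_op g h) (Y' i) \<in> {0}"
        using inner_orth_proj(2)[OF Lc gsL[OF pA], of j "Y $ i"] by (simp add: gh Y'_def)
    qed auto
    then show "inner (ampl_op g w) (Y' i) = 0" by simp
  qed
  define PX where "PX = proj_tensor_id N X"
  have XL: "X $ j \<in> L" for j
  proof -
    have "ampl_op (indicator disk) (X $ j) = X $ j"
      by (simp add: ampl_op_def vec_eq_iff mult_op_indicator AH A'(2))
    then show ?thesis using gsL[OF A'(2), of j] by simp
  qed
  have NL: "v \<in> L" if "v \<in> N" for v using that residual_spaceD(1) by (auto simp: N_def)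
  have step: "inner (ampl_op f (X $ j)) (Y $ i) = inner (ampl_op f (PX $ j)) (Y' i)" if f: "f \<in> A" for f i j
  proof -
    interpret bounded_linear "ampl_op f :: hardy^'r \<Rightarrow> _" by (rule bounded_linear_ampl_op[OF AH[OF f]])
    have "inner (ampl_op f (X $ j - orth_proj N (X $ j))) (Y' i) = 0"
    proof (rule complement_of_residual_space[OF A L f _ _ Y'N[unfolded N_def]])
      show "X $ j - orth_proj N (X $ j) \<in> L"
        by (rule subspace_diff[OF Lsub XL NL[OF orth_proj_in[OF N]]])
      show "inner (X $ j - orth_proj N (X $ j)) n = 0" if "n \<in> residual_space A E L" for n
        by (rule inner_if_vinner[OF vinner_orth_proj[OF N]]) (use that in \<open>simp add: N_def\<close>)
    qed
    moreover have "inner (ampl_op f (X $ j)) (Y' i) = inner (ampl_op f (X $ j)) (Y $ i)"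
      unfolding Y'_def by (rule inner_orth_proj(2)[OF Lc gsL[OF f]])
    ultimately show ?thesis by (simp add: diff inner_diff_left PX_def proj_tensor_id_def)
  qed
  let ?Y = "\<chi> i. Y' i"
  have bl: "bounded_linear (compression F N :: (hardy^'r)^'r \<Rightarrow> _)" by (rule bounded_linear_compression[OF N FH])
  have "pairing x y F = inner (ampl_matrix_op F X) Y" by (rule XY[OF FH])
  also have "\<dots> = (\<Sum>i\<in>UNIV. \<Sum>j\<in>UNIV. inner (ampl_op (F $ i $ j) (X $ j)) (Y $ i))"
    unfolding inner_vec_def[of "ampl_matrix_op F X" Y] by (simp add: ampl_matrix_op_def inner_sum_left)
  also have "\<dots> = (\<Sum>i\<in>UNIV. \<Sum>j\<in>UNIV. inner (ampl_op (F $ i $ j) (PX $ j)) (Y' i))"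
    by (simp only: step[OF FA])
  also have "\<dots> = (\<Sum>i\<in>UNIV. inner (ampl_matrix_op F PX $ i) (Y' i))"
    by (simp add: ampl_matrix_op_def inner_sum_left)
  also have "\<dots> = (\<Sum>i\<in>UNIV. inner (compression F N X $ i) (Y' i))"
    unfolding PX_def proj_tensor_id_def[of N "ampl_matrix_op F (proj_tensor_id N X)"]
    by (simp add: inner_orth_proj(1)[OF N Y'N])
  also have "\<dots> = inner (compression F N X) ?Y"
    unfolding inner_vec_def[of "compression F N X" ?Y] by simp
  also have "\<dots> \<le> norm (compression F N X) * norm ?Y" by (rule norm_cauchy_schwarz)
  also have "\<dots> \<le> (s * norm X) * norm Y"
  proof (intro mult_mono)
    have "norm (compression F N X) \<le> onorm (compression F N :: (hardy^'r)^'r \<Rightarrow> _) * norm X" by (rule onorm[OF bl])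
    also have "\<dots> \<le> s * norm X" using s[OF L] by (intro mult_right_mono) (auto simp: N_def)
    finally show *: "norm (compression F N X) \<le> s * norm X" .
    show "0 \<le> s * norm X" by (rule order_trans[OF norm_ge_zero *])
    have "?Y = proj_tensor_id L Y" by (simp add: proj_tensor_id_def Y'_def)
    then show "norm ?Y \<le> norm Y" using norm_proj_tensor_id_le[OF Lc] by simp
  qed simp
  also have "\<dots> \<le> s * energy x y"
  proof -
    have s0: "s \<ge> 0" using order_trans[OF onorm_pos_le[OF bl]] s[OF L] by (simp add: N_def)
    have "2 * (norm X * norm Y) \<le> (norm X)\<^sup>2 + (norm Y)\<^sup>2" using sum_squares_bound[of "norm X" "norm Y"] by simp
    then have "norm X * norm Y \<le> energy x y" using X Y by (simp add: energy_def)
    then show ?thesis using s0 by (simp add: mult.assoc mult_left_mono)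
  qed
  finally show ?thesis .
qed

section \<open>Operators commuting with the shift\<close>

lemma shift_monomial: "shift (monomial n) = monomial (Suc n)"
  by (rule hardy_eqI) (auto simp: hcoeff_shift hcoeff_monomial)

lemma szego_kernel_nonzero: assumes z: "z \<in> disk" shows "szego_kernel z \<noteq> 0"
  using hinner_szego_kernel[OF z, of "monomial 0"] hardy_fun_monomial_0[OF z] by auto

text \<open>
  The multiplier is the image of \<open>1\<close>. Multiplication by it agrees with \<open>T\<close> on monomials, hence everywhere
  since point evaluations are continuous, and it is bounded because its values are eigenvalues of the
  adjoint of \<open>T\<close> for the reproducing kernels.
\<close>

lemma commutant_of_shift:
  assumes T: "bounded_linear T" and c: "\<And>c x. T (hscale c x) = hscale c (T x)"
    and s: "\<And>x. T (shift x) = shift (T x)"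
  shows "\<exists>f\<in>H_infty. T = mult_op f"
proof -
  define f where "f = hardy_fun (T (monomial 0))"
  have val: "hardy_fun (T x) z = f z * hardy_fun x z" if z: "z \<in> disk" for x z
  proof -
    have mon: "hardy_fun (T (monomial n)) z = f z * hardy_fun (monomial n) z" for n
    proof (induction n)
      case 0
      then show ?case by (simp add: f_def hardy_fun_monomial_0[OF z])
    next
      case (Suc n)
      then show ?case
        by (simp add: shift_monomial[symmetric] s hardy_fun_mult_op coord_fun_H_infty)
    qed
    have "hinner (T x) (szego_kernel z) = f z * hinner x (szego_kernel z)"
    proof (rule bounded_linear_eq_on_monomials[where T = "\<lambda>x. hinner (T x) (szego_kernel z)"
          and T' = "\<lambda>x. f z * hinner x (szego_kernel z)"])
      show "bounded_linear (\<lambda>x. hinner (T x) (szego_kernel z))"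
        by (rule bounded_linear_compose[OF bounded_linear_hinner_left T])
      show "bounded_linear (\<lambda>x. f z * hinner x (szego_kernel z))"
        by (rule bounded_linear_compose[OF bounded_linear_mult_right bounded_linear_hinner_left])
      show "hinner (T (hscale a (monomial n))) (szego_kernel z) = f z * hinner (hscale a (monomial n)) (szego_kernel z)" for a n
        by (simp add: hinner_szego_kernel[OF z] c hardy_fun_hscale mon)
    qed
    then show ?thesis by (simp add: hinner_szego_kernel[OF z])
  qed
  obtain K where K: "\<And>x. norm (T x) \<le> norm x * K" using bounded_linear.bounded[OF T] by blast
  have "norm (f z) \<le> K" if z: "z \<in> disk" for z
  proof -
    let ?k = "szego_kernel z"
    have k: "norm ?k > 0" using szego_kernel_nonzero[OF z] by simp
    have "hinner (T ?k) ?k = f z * hinner ?k ?k" by (simp add: hinner_szego_kernel[OF z] val[OF z])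
    moreover have "hinner ?k ?k = of_real (norm ?k * norm ?k)"
      by (simp only: hinner_self norm_hardy_square[symmetric]) (simp only: power2_eq_square)
    ultimately have "norm (f z) * (norm ?k * norm ?k) = norm (hinner (T ?k) ?k)"
      by (simp add: norm_mult)
    also have "\<dots> \<le> norm (T ?k) * norm ?k" by (rule norm_hinner_le)
    also have "\<dots> \<le> (norm ?k * K) * norm ?k" by (intro mult_right_mono K) simp
    also have "\<dots> = K * (norm ?k * norm ?k)" by simp
    finally show ?thesis by (rule mult_right_le_imp_le) (use k in simp)
  qed
  then have f: "f \<in> H_infty"
    using holomorphic_hardy_fun hardy_fun_outside by (auto simp: H_infty_def f_def bounded_iff intro!: exI[of _ K])
  have "T x = mult_op f x" for x
    by (rule hardy_fun_eqI) (simp add: val hardy_fun_mult_op[OF f])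
  then show ?thesis using f by auto
qed

section \<open>The dual description of the distance\<close>

definition rank_one :: "hardy^'r \<Rightarrow> hardy^'r \<Rightarrow> (complex \<Rightarrow> complex)^'r^'r::finite \<Rightarrow> real" where
  "rank_one u v G = (if G \<in> matrices H_infty then inner (matrix_op G u) v else 0)"

lemma pairing_unfold_first:
  assumes "l2_seq x" "l2_seq y"
  shows "pairing x y = (\<lambda>G. rank_one (x 0) (y 0) G + pairing (\<lambda>n. x (Suc n)) (\<lambda>n. y (Suc n)) G)"
proof
  fix G
  show "pairing x y G = rank_one (x 0) (y 0) G + pairing (\<lambda>n. x (Suc n)) (\<lambda>n. y (Suc n)) G"
    using suminf_split_head[OF sums_summable[OF pairing_sums[OF _ assms, of G]]]
    by (simp add: pairing_def rank_one_def)
qed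

lemma l2_seq_shift: "l2_seq x \<Longrightarrow> l2_seq (\<lambda>n. x (n + N))"
  unfolding l2_seq_def by (rule summable_ignore_initial_segment)

lemma l2_seq_zero: "l2_seq (\<lambda>n. 0)" by (simp add: l2_seq_def)

lemma pairing_zero: "pairing (\<lambda>n. 0) y = (\<lambda>G. 0)"
proof
  fix G :: "(complex \<Rightarrow> complex)^'a^'a"
  show "pairing (\<lambda>n. 0) y G = 0"
    using bounded_linear.linear[OF bounded_linear_matrix_op, THEN linear_0, of G]
    by (auto simp: pairing_def)
qed

lemma rank_one_in_functionals:
  "rank_one u v = pairing (\<lambda>n. if n = 0 then u else 0) (\<lambda>n. if n = 0 then v else 0)"
  "l2_seq (\<lambda>n. if n = 0 then u else 0)"
proof -
  show *: "l2_seq (\<lambda>n. if n = 0 then u else 0)" for u :: "hardy^'a"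
    unfolding l2_seq_def by (rule summable_finite[of "{0}"]) auto
  show "rank_one u v = pairing (\<lambda>n. if n = 0 then u else 0) (\<lambda>n. if n = 0 then v else 0)"
    by (subst pairing_unfold_first[OF * *]) (simp add: pairing_zero)
qed

lemma energy_rank_one:
  "energy (\<lambda>n. if n = 0 then u else 0) (\<lambda>n. if n = 0 then v else 0) = ((norm u)\<^sup>2 + (norm v)\<^sup>2) / 2"
proof -
  have "(\<Sum>n. (norm (if n = 0 then w else 0))\<^sup>2) = (norm w)\<^sup>2" for w :: 'a
    by (subst suminf_finite[of "{0::nat}"]) auto
  then show ?thesis by (simp add: energy_def)
qed

lemma pairing_uminus: "l2_seq x \<Longrightarrow> l2_seq y \<Longrightarrow> pairing (\<lambda>n. - x n) y = (\<lambda>G. - pairing x y G)"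
  using pairing_scaleR[of x y "-1" 1] by simp

lemma l2_seq_uminus: "l2_seq x \<Longrightarrow> l2_seq (\<lambda>n. - x n)"
  by (simp add: l2_seq_def)

lemma energy_tail:
  assumes "l2_seq x" "l2_seq y"
  shows "(\<lambda>N. energy (\<lambda>n. x (n + N)) (\<lambda>n. y (n + N))) \<longlonglongrightarrow> 0"
proof -
  have "(\<lambda>N. ((\<Sum>n. (norm (x (n + N)))\<^sup>2) + (\<Sum>n. (norm (y (n + N)))\<^sup>2)) / 2) \<longlonglongrightarrow> (0 + 0) / 2"
    using assms unfolding l2_seq_def
    by (intro tendsto_intros suminf_exist_split2) auto
  then show ?thesis by (simp add: energy_def)
qed

text \<open>
  The Hahn-Banach theorem is applied to the infimum \<open>q\<close> of \<open>t * energy x y + \<eta> F\<close> over all decompositions of a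
  functional as \<open>pairing x y + \<eta>\<close>, where \<open>\<eta>\<close> kills \<open>J\<close>. A linear functional below \<open>q\<close> is at most
  \<open>t * energy x y\<close> on \<open>pairing x y\<close> and at most evaluation at \<open>F\<close> on the annihilator of \<open>J\<close>, hence equal to it
  there. The hypothesis serves to bound \<open>q\<close> from below.
\<close>

lemma functional_extension:
  fixes F :: "(complex \<Rightarrow> complex)^'r^'r::finite" and J :: "((complex \<Rightarrow> complex)^'r^'r) set"
  assumes bound: "\<And>x y. l2_seq x \<Longrightarrow> l2_seq y \<Longrightarrow> (\<And>G. G \<in> J \<Longrightarrow> pairing x y G = 0) \<Longrightarrow> pairing x y F \<le> t * energy x y"
  obtains l where
    "\<And>u v. u \<in> functionals \<Longrightarrow> v \<in> functionals \<Longrightarrow> l (\<lambda>G. u G + v G) = l u + l v"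
    "\<And>c u. u \<in> functionals \<Longrightarrow> l (\<lambda>G. c * u G) = c * l u"
    "\<And>x y. l2_seq x \<Longrightarrow> l2_seq y \<Longrightarrow> l (pairing x y) \<le> t * energy x y"
    "\<And>x y. l2_seq x \<Longrightarrow> l2_seq y \<Longrightarrow> (\<And>G. G \<in> J \<Longrightarrow> pairing x y G = 0) \<Longrightarrow> l (pairing x y) = pairing x y F"
proof -
  let ?X = "functionals :: ((complex \<Rightarrow> complex)^'r^'r \<Rightarrow> real) set"
  note X = functionals_fun_space[where 'r = 'r]
  define Y where "Y = {u \<in> ?X. \<forall>G\<in>J. u G = 0}"
  have Yadd: "(\<lambda>G. u G + v G) \<in> Y" if "u \<in> Y" "v \<in> Y" for u v
    using that fun_space_add[OF X] by (auto simp: Y_def)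
  have Ycm: "(\<lambda>G. c * u G) \<in> Y" if "u \<in> Y" for u c
    using that fun_space_cmult[OF X] by (auto simp: Y_def)
  have pX: "pairing x y \<in> ?X" if "l2_seq x" "l2_seq y" for x y
    using that by (auto simp: functionals_def)
  have zX: "(\<lambda>G. 0) \<in> ?X" using pX[OF l2_seq_zero l2_seq_zero] by (simp add: pairing_zero)
  have zY: "(\<lambda>G. 0) \<in> Y" using zX by (simp add: Y_def)
  have Yb: "pairing x y F \<le> t * energy x y" if "pairing x y \<in> Y" "l2_seq x" "l2_seq y" for x y
    by (rule bound[OF that(2,3)]) (use that(1) in \<open>auto simp: Y_def\<close>)
  define S where "S u = {t * energy x y + \<eta> F | x y \<eta>. l2_seq x \<and> l2_seq y \<and> \<eta> \<in> Y \<and> u = (\<lambda>G. pairing x y G + \<eta> G)}" for u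
  define q where "q u = Inf (S u)" for u
  have memS: "t * energy x y + \<eta> F \<in> S u" if "l2_seq x" "l2_seq y" "\<eta> \<in> Y" "u = (\<lambda>G. pairing x y G + \<eta> G)" for x y \<eta> u
    using that by (auto simp: S_def)
  have ne: "S u \<noteq> {}" if u: "u \<in> ?X" for u
  proof -
    obtain x y where "u = pairing x y" "l2_seq x" "l2_seq y" using u by (auto simp: functionals_def)
    then show ?thesis using memS[OF _ _ zY, of x y u] by auto
  qed
  have bdd: "bdd_below (S u)" if u: "u \<in> ?X" for u
  proof -
    obtain x0 y0 where u0: "u = pairing x0 y0" "l2_seq x0" "l2_seq y0" using u by (auto simp: functionals_def)
    have "- t * energy x0 y0 \<le> e" if eS: "e \<in> S u" for e
    proof -
      obtain x y \<eta> where e: "e = t * energy x y + \<eta> F" "l2_seq x" "l2_seq y" "\<eta> \<in> Y"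
        "u = (\<lambda>G. pairing x y G + \<eta> G)" using eS by (auto simp: S_def)
      let ?x = "interleave x (\<lambda>n. - x0 n)" and ?y = "interleave y y0"
      have s: "l2_seq ?x" "l2_seq ?y" by (rule l2_seq_interleave(1) l2_seq_uminus e(2,3) u0(2,3))+
      have eq: "pairing ?x ?y = (\<lambda>G. - \<eta> G)"
      proof
        fix G
        have "pairing x0 y0 G = pairing x y G + \<eta> G" using fun_cong[OF e(5), of G] by (simp add: u0(1))
        then show "pairing ?x ?y G = - \<eta> G"
          by (simp add: pairing_interleave l2_seq_uminus e(2,3) u0(2,3) pairing_uminus)
      qed
      have "(\<lambda>G. - \<eta> G) \<in> Y" using Ycm[OF e(4), of "-1"] by simp
      then have "- \<eta> F \<le> t * energy ?x ?y"
        using Yb[OF _ s] unfolding eq by simp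
      also have "energy ?x ?y = energy x y + energy x0 y0"
        by (simp add: energy_interleave l2_seq_uminus e u0 energy_minus)
      finally show ?thesis by (simp add: e algebra_simps)
    qed
    then show ?thesis by (rule bdd_belowI)
  qed
  have q_le: "q u \<le> e" if "u \<in> ?X" "e \<in> S u" for u e
    unfolding q_def by (rule cInf_lower[OF that(2) bdd[OF that(1)]])
  have "sublinear_on ?X q"
    unfolding q_def
  proof (rule sublinear_on_Inf[OF X ne bdd])
    fix u v d e assume "d \<in> S u" "e \<in> S v"
    then obtain x y \<eta> x' y' \<eta>' where d: "d = t * energy x y + \<eta> F" "l2_seq x" "l2_seq y" "\<eta> \<in> Y"
        "u = (\<lambda>G. pairing x y G + \<eta> G)"
      and e: "e = t * energy x' y' + \<eta>' F" "l2_seq x'" "l2_seq y'" "\<eta>' \<in> Y"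
        "v = (\<lambda>G. pairing x' y' G + \<eta>' G)" by (auto simp: S_def)
    have "t * energy (interleave x x') (interleave y y') + (\<eta> F + \<eta>' F) \<in> S (\<lambda>G. u G + v G)"
      by (rule memS[OF l2_seq_interleave(1) l2_seq_interleave(1) Yadd])
         (use d e in \<open>auto simp: pairing_interleave\<close>)
    then show "\<exists>b\<in>S (\<lambda>G. u G + v G). b \<le> d + e"
      by (rule bexI[rotated]) (simp add: d e energy_interleave algebra_simps)
  next
    fix c :: real and u e assume c: "c > 0" and "e \<in> S u"
    then obtain x y \<eta> where e: "e = t * energy x y + \<eta> F" "l2_seq x" "l2_seq y" "\<eta> \<in> Y"
      "u = (\<lambda>G. pairing x y G + \<eta> G)" by (auto simp: S_def)
    have "t * energy (\<lambda>n. sqrt c *\<^sub>R x n) (\<lambda>n. sqrt c *\<^sub>R y n) + c * \<eta> F \<in> S (\<lambda>G. c * u G)"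
      by (rule memS[OF l2_seq_scaleR l2_seq_scaleR Ycm])
         (use e c in \<open>auto simp: pairing_scaleR distrib_left\<close>)
    then show "\<exists>b\<in>S (\<lambda>G. c * u G). b \<le> c * e"
      by (rule bexI[rotated]) (use c in \<open>simp add: e energy_scaleR algebra_simps\<close>)
  qed
  from linear_below_sublinear[OF X this] obtain l where
    add: "\<And>u v. u \<in> ?X \<Longrightarrow> v \<in> ?X \<Longrightarrow> l (\<lambda>G. u G + v G) = l u + l v"
    and cm: "\<And>c u. u \<in> ?X \<Longrightarrow> l (\<lambda>G. c * u G) = c * l u"
    and le: "\<And>u. u \<in> ?X \<Longrightarrow> l u \<le> q u" by blast
  have lp: "l (pairing x y) \<le> t * energy x y" if "l2_seq x" "l2_seq y" for x y
    using le[OF pX[OF that]] q_le[OF pX[OF that] memS[OF that zY]] by simp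
  have lY: "l \<eta> \<le> \<eta> F" if "\<eta> \<in> Y" for \<eta>
  proof -
    have X': "\<eta> \<in> ?X" using that by (simp add: Y_def)
    have "t * energy (\<lambda>n. 0 :: hardy^'r) (\<lambda>n. 0) + \<eta> F \<in> S \<eta>"
      by (rule memS[OF l2_seq_zero l2_seq_zero that]) (simp add: pairing_zero)
    then have "\<eta> F \<in> S \<eta>" by (simp add: energy_def)
    then show ?thesis using le[OF X'] q_le[OF X'] by fastforce
  qed
  have "l (pairing x y) = pairing x y F" if xy: "l2_seq x" "l2_seq y" and "\<And>G. G \<in> J \<Longrightarrow> pairing x y G = 0" for x y
  proof -
    have Yp: "pairing x y \<in> Y" using that pX by (auto simp: Y_def)
    have "l (\<lambda>G. - 1 * pairing x y G) \<le> - 1 * pairing x y F" by (rule lY[OF Ycm[OF Yp]])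
    then show ?thesis using lY[OF Yp] cm[OF pX[OF xy], of "-1"] by simp
  qed
  then show thesis using that[of l] add cm lp by blast
qed

lemma axis_expansion: "(\<Sum>j\<in>UNIV. axis j (u $ j)) = (u :: 'a::comm_monoid_add^'n::finite)"
  by (simp add: vec_eq_iff axis_def cong: if_cong)

text \<open>
  Normalizing both arguments turns the bound by half the sum of the squares into a bound by the product.
\<close>

lemma bilinear_norm_bound:
  fixes B :: "'a::real_inner \<Rightarrow> 'b::real_inner \<Rightarrow> real"
  assumes l: "\<And>c u v. B (c *\<^sub>R u) v = c * B u v" and r: "\<And>c u v. B u (c *\<^sub>R v) = c * B u v"
    and b: "\<And>u v. B u v \<le> t * (((norm u)\<^sup>2 + (norm v)\<^sup>2) / 2)"
  shows "\<bar>B u v\<bar> \<le> t * norm u * norm v"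
proof (cases "u = 0 \<or> v = 0")
  case True
  then show ?thesis using l[of 0 u v] r[of u 0 v] by auto
next
  case False
  have one: "B u v \<le> t * norm u * norm v" if "u \<noteq> 0" "v \<noteq> 0" for u v
  proof -
    have "B (inverse (norm u) *\<^sub>R u) (inverse (norm v) *\<^sub>R v) \<le> t"
      using b[of "inverse (norm u) *\<^sub>R u" "inverse (norm v) *\<^sub>R v"] that by simp
    then have "B u v / (norm u * norm v) \<le> t" by (simp add: l r divide_inverse mult_ac)
    then show ?thesis using that by (simp add: field_simps)
  qed
  show ?thesis using one[of u v] one[of "-1 *\<^sub>R u" v] l[of "-1" u v] False by (simp add: abs_le_iff)
qed

lemma shift_adjoint: "\<exists>b'. \<forall>x. inner (shift x) b = inner x b'"
  by (rule riesz_representation)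
     (rule bounded_linear_compose[OF bounded_linear_inner_left bounded_linear_mult_op[OF coord_fun_H_infty]])

lemma mult_op_shift: "f \<in> H_infty \<Longrightarrow> mult_op f (shift x) = shift (mult_op f x)"
  by (rule hardy_fun_eqI) (simp add: hardy_fun_mult_op coord_fun_H_infty)

text \<open>
  The bilinear form \<open>B\<close> given by the values of \<open>l\<close> on rank one functionals splits into \<open>r \<times> r\<close> forms on the
  Hardy space, which the Riesz theorem turns into operators \<open>T i j\<close>. Shifting \<open>u\<close> or applying the adjoint
  of the shift to \<open>v\<close> gives the same rank one functional on multipliers, so the \<open>T i j\<close> commute with the
  shift and are multipliers. The bound on \<open>l\<close> makes it continuous along partial sums, which carries the
  formula from rank one functionals to all pairings.
\<close>

theorem functional_represented_by_multiplier:
  fixes l :: "((complex \<Rightarrow> complex)^'r^'r::finite \<Rightarrow> real) \<Rightarrow> real"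
  assumes add: "\<And>u v. u \<in> functionals \<Longrightarrow> v \<in> functionals \<Longrightarrow> l (\<lambda>G. u G + v G) = l u + l v"
    and cm: "\<And>c u. u \<in> functionals \<Longrightarrow> l (\<lambda>G. c * u G) = c * l u"
    and le: "\<And>x y. l2_seq x \<Longrightarrow> l2_seq y \<Longrightarrow> l (pairing x y) \<le> t * energy x y"
    and t: "t \<ge> 0"
  obtains H where "H \<in> matrices H_infty" "onorm (matrix_op H :: hardy^'r \<Rightarrow> _) \<le> t"
    "\<And>x y. l2_seq x \<Longrightarrow> l2_seq y \<Longrightarrow> l (pairing x y) = pairing x y H"
proof -
  have rX: "rank_one u v \<in> functionals" for u v :: "hardy^'r"
    unfolding rank_one_in_functionals(1)[of u v] functionals_def using rank_one_in_functionals(2) by blast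
  define B where "B u v = l (rank_one u v)" for u v :: "hardy^'r"
  have lin: "linear (matrix_op G :: hardy^'r \<Rightarrow> _)" if "G \<in> matrices H_infty" for G
    using bounded_linear_matrix_op[OF that] by (rule bounded_linear.linear)
  have "rank_one (u + u') v = (\<lambda>G. rank_one u v G + rank_one u' v G)" for u u' v :: "hardy^'r"
    by (auto simp: rank_one_def fun_eq_iff linear_add[OF lin] inner_add_left)
  then have Badd: "B (u + u') v = B u v + B u' v" for u u' v by (simp add: B_def add rX)
  have "rank_one (c *\<^sub>R u) v = (\<lambda>G. c * rank_one u v G)" for c and u v :: "hardy^'r"
    by (auto simp: rank_one_def fun_eq_iff linear_scale[OF lin])
  then have Bsc: "B (c *\<^sub>R u) v = c * B u v" for c u v by (simp add: B_def cm rX)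
  have "rank_one u (v + v') = (\<lambda>G. rank_one u v G + rank_one u v' G)" for u v v' :: "hardy^'r"
    by (auto simp: rank_one_def fun_eq_iff inner_add_right)
  then have Badd': "B u (v + v') = B u v + B u v'" for u v v' by (simp add: B_def add rX)
  have "rank_one u (c *\<^sub>R v) = (\<lambda>G. c * rank_one u v G)" for c and u v :: "hardy^'r"
    by (auto simp: rank_one_def fun_eq_iff)
  then have Bsc': "B u (c *\<^sub>R v) = c * B u v" for c u v by (simp add: B_def cm rX)
  have Ble: "B u v \<le> t * (((norm u)\<^sup>2 + (norm v)\<^sup>2) / 2)" for u v
    unfolding B_def rank_one_in_functionals(1)[of u v]
    using le[OF rank_one_in_functionals(2) rank_one_in_functionals(2), of u v] by (simp only: energy_rank_one)
  have Babs: "\<bar>B u v\<bar> \<le> t * norm u * norm v" for u v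
    by (rule bilinear_norm_bound[of B, OF Bsc Bsc' Ble])
  have linB: "linear (\<lambda>u. B u v)" "linear (\<lambda>v. B u v)" for u v
    by (rule linearI; simp add: Badd Bsc Badd' Bsc')+
  have ax: "axis i (a + b) = axis i a + axis i b" "axis i (c *\<^sub>R a) = c *\<^sub>R axis i a" for i :: 'r and a b :: hardy and c
    by (auto simp: vec_eq_iff axis_def)
  have bl: "bounded_linear (\<lambda>b. B (axis j a) (axis i b))" for i j a
    by (rule bounded_linear_intro[of _ "t * norm a"])
       (use Babs[of "axis j a" "axis i _"] in \<open>auto simp: ax Badd' Bsc' norm_axis mult_ac\<close>)
  have "\<forall>p. \<exists>w. \<forall>b. B (axis (snd (fst p)) (snd p)) (axis (fst (fst p)) b) = inner b w"
    using riesz_representation[OF bl] by blast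
  from choice[OF this] obtain w where w: "\<And>p b. B (axis (snd (fst p)) (snd p)) (axis (fst (fst p)) b) = inner b (w p)"
    by blast
  define T where "T i j a = w ((i, j), a)" for i j a
  have T: "B (axis j a) (axis i b) = inner b (T i j a)" for i j a b
    using w[of "((i, j), a)" b] by (simp add: T_def)
  have T_eqI: "T i j a = c" if "\<And>b. inner b (T i j a) = inner b c" for i j a c
    using vector_eq_ldot[of "T i j a" c] that by auto
  have Tadd: "T i j (a + b) = T i j a + T i j b" for i j a b
    by (rule T_eqI) (simp add: inner_add_right ax Badd flip: T)
  have Tsc: "T i j (c *\<^sub>R a) = c *\<^sub>R T i j a" for i j a c
    by (rule T_eqI) (simp add: ax Bsc flip: T)
  have Tnorm: "norm (T i j a) \<le> norm a * t" for i j a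
  proof -
    have "(norm (T i j a))\<^sup>2 = B (axis j a) (axis i (T i j a))" by (simp add: T power2_norm_eq_inner)
    also have "\<dots> \<le> (norm a * t) * norm (T i j a)"
      using Babs[of "axis j a" "axis i (T i j a)"] by (simp add: norm_axis mult_ac)
    finally show ?thesis
      using t by (cases "T i j a = 0") (auto simp: power2_eq_square mult_le_cancel_right)
  qed
  have Tbl: "bounded_linear (T i j)" for i j by (rule bounded_linear_intro[OF Tadd Tsc Tnorm])
  have entry: "inner (matrix_op G (axis j a)) (axis i b) = inner (mult_op (G $ i $ j) a) b"
    if G: "G \<in> matrices H_infty" for G i j a b
  proof -
    have "mult_op (G $ i $ j) 0 = 0" for i j
      using G bounded_linear.linear[OF bounded_linear_mult_op, THEN linear_0] by (auto simp: matrices_def)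
    then have "matrix_op G (axis j a) $ i = mult_op (G $ i $ j) a"
      unfolding matrix_op_def by (simp add: axis_def if_distrib[of "mult_op _"] cong: if_cong)
    then show ?thesis by (simp add: inner_axis)
  qed
  have GH: "G $ i $ j \<in> H_infty" if "G \<in> matrices H_infty" for G :: "(complex \<Rightarrow> complex)^'r^'r" and i j
    using that by (simp add: matrices_def)
  have Thscale: "T i j (hscale c a) = hscale c (T i j a)" for i j c a
  proof (rule T_eqI)
    fix b
    have "rank_one (axis j (hscale c a)) (axis i b) = rank_one (axis j a) (axis i (hscale (cnj c) b))"
      by (auto simp: rank_one_def fun_eq_iff entry mult_op_hscale GH inner_hscale)
    then have "B (axis j (hscale c a)) (axis i b) = B (axis j a) (axis i (hscale (cnj c) b))" by (simp add: B_def)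
    then show "inner b (T i j (hscale c a)) = inner b (hscale c (T i j a))" by (simp add: T inner_hscale)
  qed
  have Tshift: "T i j (shift a) = shift (T i j a)" for i j a
  proof (rule T_eqI)
    fix b
    obtain b' where b': "\<And>x. inner (shift x) b = inner x b'" using shift_adjoint by blast
    have "rank_one (axis j (shift a)) (axis i b) = rank_one (axis j a) (axis i b')"
      by (auto simp: rank_one_def fun_eq_iff entry mult_op_shift GH b')
    then have "B (axis j (shift a)) (axis i b) = B (axis j a) (axis i b')" by (simp add: B_def)
    then show "inner b (T i j (shift a)) = inner b (shift (T i j a))"
      using b'[of "T i j a"] by (simp add: T inner_commute)
  qed
  have "\<forall>p. \<exists>f. f \<in> H_infty \<and> T (fst p) (snd p) = mult_op f"
    using commutant_of_shift[OF Tbl Thscale Tshift] by blast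
  from choice[OF this] obtain f where f: "\<And>p. f p \<in> H_infty" "\<And>p. T (fst p) (snd p) = mult_op (f p)" by blast
  define H :: "(complex \<Rightarrow> complex)^'r^'r" where "H = (\<chi> i j. f (i, j))"
  have H: "H \<in> matrices H_infty" by (simp add: H_def matrices_def f)
  have TH: "T i j = mult_op (H $ i $ j)" for i j using f(2)[of "(i, j)"] by (simp add: H_def)
  have BH: "B u v = inner (matrix_op H u) v" for u v
  proof -
    have "B u v = B (\<Sum>j\<in>UNIV. axis j (u $ j)) (\<Sum>i\<in>UNIV. axis i (v $ i))" by (simp only: axis_expansion)
    also have "\<dots> = (\<Sum>i\<in>UNIV. \<Sum>j\<in>UNIV. B (axis j (u $ j)) (axis i (v $ i)))"
      by (subst linear_sum[OF linB(2)]) (subst linear_sum[OF linB(1)], rule refl)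
    also have "\<dots> = (\<Sum>i\<in>UNIV. \<Sum>j\<in>UNIV. inner (mult_op (H $ i $ j) (u $ j)) (v $ i))"
      by (simp only: T TH inner_commute)
    also have "\<dots> = inner (matrix_op H u) v"
      unfolding inner_vec_def[of "matrix_op H u" v] by (simp add: matrix_op_def inner_sum_left)
    finally show ?thesis .
  qed
  have on: "onorm (matrix_op H :: hardy^'r \<Rightarrow> _) \<le> t"
  proof (rule onorm_bound[OF t])
    fix u :: "hardy^'r"
    have "(norm (matrix_op H u))\<^sup>2 \<le> (t * norm u) * norm (matrix_op H u)"
      using Babs[of u "matrix_op H u"] by (simp add: BH power2_norm_eq_inner)
    then show "norm (matrix_op H u) \<le> t * norm u"
      using t by (cases "matrix_op H u = 0") (auto simp: power2_eq_square mult_le_cancel_right)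
  qed
  have rep: "l (pairing x y) = pairing x y H" if xy: "l2_seq x" "l2_seq y" for x y
  proof -
    have pX: "pairing x y \<in> functionals" if "l2_seq x" "l2_seq y" for x y :: "nat \<Rightarrow> hardy^'r"
      using that by (auto simp: functionals_def)
    have split: "l (pairing x y) = (\<Sum>n<N. B (x n) (y n)) + l (pairing (\<lambda>n. x (n + N)) (\<lambda>n. y (n + N)))" for N
    proof (induction N)
      case (Suc N)
      have "l (pairing (\<lambda>n. x (n + N)) (\<lambda>n. y (n + N)))
          = B (x N) (y N) + l (pairing (\<lambda>n. x (n + Suc N)) (\<lambda>n. y (n + Suc N)))"
        using l2_seq_shift[OF xy(1), of "Suc N"] l2_seq_shift[OF xy(2), of "Suc N"]
        by (subst pairing_unfold_first[OF l2_seq_shift[OF xy(1)] l2_seq_shift[OF xy(2)]])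
           (simp add: add[OF rX pX] B_def)
      then show ?case using Suc by simp
    qed simp
    have small: "norm (l (pairing (\<lambda>n. x (n + N)) (\<lambda>n. y (n + N)))) \<le> t * energy (\<lambda>n. x (n + N)) (\<lambda>n. y (n + N))" for N
    proof -
      let ?x = "\<lambda>n. x (n + N)" and ?y = "\<lambda>n. y (n + N)"
      have s: "l2_seq ?x" "l2_seq ?y" by (rule l2_seq_shift xy)+
      have "l (pairing (\<lambda>n. - ?x n) ?y) = - l (pairing ?x ?y)"
        using cm[OF pX[OF s], of "-1"] by (simp add: pairing_uminus s)
      then have "- l (pairing ?x ?y) \<le> t * energy ?x ?y"
        using le[OF l2_seq_uminus[OF s(1)] s(2)] by (simp add: energy_minus)
      then show ?thesis using le[OF s] by (simp add: abs_le_iff)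
    qed
    have tail: "(\<lambda>N. l (pairing (\<lambda>n. x (n + N)) (\<lambda>n. y (n + N)))) \<longlonglongrightarrow> 0"
    proof (rule Lim_null_comparison)
      show "\<forall>\<^sub>F N in sequentially. norm (l (pairing (\<lambda>n. x (n + N)) (\<lambda>n. y (n + N))))
          \<le> t * energy (\<lambda>n. x (n + N)) (\<lambda>n. y (n + N))"
        by (rule always_eventually, rule allI, rule small)
      show "(\<lambda>N. t * energy (\<lambda>n. x (n + N)) (\<lambda>n. y (n + N))) \<longlonglongrightarrow> 0"
        using tendsto_mult[OF tendsto_const[of t] energy_tail[OF xy]] by simp
    qed
    have "(\<Sum>n<N. B (x n) (y n)) = l (pairing x y) - l (pairing (\<lambda>n. x (n + N)) (\<lambda>n. y (n + N)))" for N
      using split[of N] by simp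
    then have "(\<lambda>N. \<Sum>n<N. B (x n) (y n)) \<longlonglongrightarrow> l (pairing x y)"
      using tendsto_diff[OF tendsto_const[of "l (pairing x y)"] tail] by simp
    moreover have "(\<lambda>N. \<Sum>n<N. B (x n) (y n)) \<longlonglongrightarrow> pairing x y H"
      using pairing_sums[OF H xy] by (simp add: BH sums_def)
    ultimately show ?thesis by (rule LIMSEQ_unique)
  qed
  show thesis by (rule that[OF H on rep])
qed

text \<open>
  If \<open>H\<close> represents a norm preserving extension of evaluation at \<open>F\<close>, then \<open>F - H\<close> is the matrix sought.
\<close>

theorem distance_attained:
  fixes F :: "(complex \<Rightarrow> complex)^'r^'r::finite"
  assumes A: "dual_subalgebra A" and E: "E \<subseteq> disk" and F: "F \<in> matrices A" and t: "t \<ge> 0"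
    and bound: "\<And>x y. l2_seq x \<Longrightarrow> l2_seq y \<Longrightarrow>
      (\<And>G. G \<in> matrices (vanishing_ideal A E) \<Longrightarrow> pairing x y G = 0) \<Longrightarrow> pairing x y F \<le> t * energy x y"
  shows "\<exists>G\<in>matrices (vanishing_ideal A E). onorm (\<lambda>x. matrix_op F x - matrix_op G x) \<le> t"
proof -
  have FH: "F \<in> matrices H_infty" using F dual_subalgebraD(1)[OF A] by (auto simp: matrices_def)
  obtain l where
    add: "\<And>u v. u \<in> functionals \<Longrightarrow> v \<in> functionals \<Longrightarrow> l (\<lambda>G. u G + v G) = l u + l v"
    and cm: "\<And>c u. u \<in> functionals \<Longrightarrow> l (\<lambda>G. c * u G) = c * l u"
    and le: "\<And>x y. l2_seq x \<Longrightarrow> l2_seq y \<Longrightarrow> l (pairing x y) \<le> t * energy x y"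
    and ext: "\<And>x y. l2_seq x \<Longrightarrow> l2_seq y \<Longrightarrow> (\<And>G. G \<in> matrices (vanishing_ideal A E) \<Longrightarrow> pairing x y G = 0) \<Longrightarrow>
      l (pairing x y) = pairing x y F"
    by (rule functional_extension[OF bound]) blast+
  obtain H where H: "H \<in> matrices H_infty" "onorm (matrix_op H :: hardy^'r \<Rightarrow> _) \<le> t"
    and rep: "\<And>x y. l2_seq x \<Longrightarrow> l2_seq y \<Longrightarrow> l (pairing x y) = pairing x y H"
    by (rule functional_represented_by_multiplier[OF add cm le t]) blast+
  define G :: "(complex \<Rightarrow> complex)^'r^'r" where "G = (\<chi> i j. (\<lambda>z. (F $ i $ j) z + (- 1) * (H $ i $ j) z))"
  have Fe: "F $ i $ j \<in> H_infty" and He: "H $ i $ j \<in> H_infty" for i j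
    using FH H(1) by (auto simp: matrices_def)
  have Ge: "G $ i $ j = (\<lambda>z. (F $ i $ j) z + (- 1) * (H $ i $ j) z)" for i j
    unfolding G_def by simp
  have "G $ i $ j \<in> H_infty" for i j
    unfolding Ge by (rule H_infty_add[OF Fe H_infty_cmult[OF He]])
  then have GH: "G \<in> matrices H_infty" by (simp add: matrices_def)
  have Gop: "matrix_op G u = matrix_op F u - matrix_op H u" for u :: "hardy^'r"
  proof -
    have "mult_op (G $ i $ j) a = mult_op (F $ i $ j) a - mult_op (H $ i $ j) a" for i j a
      unfolding Ge
      by (simp only: mult_op_add_left[OF Fe H_infty_cmult[OF He]] mult_op_cmult_left[OF He]
          minus_hardy_def uminus_hardy_def)
    then show ?thesis by (simp add: matrix_op_def vec_eq_iff sum_subtractf)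
  qed
  have "G \<in> matrices (vanishing_ideal A E)"
  proof (rule vanishing_ideal_if_annihilated[OF A E GH])
    fix x y :: "nat \<Rightarrow> hardy^'r"
    assume xy: "l2_seq x" "l2_seq y" and ann: "\<And>G. G \<in> matrices (vanishing_ideal A E) \<Longrightarrow> pairing x y G = 0"
    have "(\<lambda>n. inner (matrix_op G (x n)) (y n)) sums (pairing x y F - pairing x y H)"
      unfolding Gop inner_diff_left by (intro sums_diff pairing_sums FH H xy)
    then have "pairing x y G = pairing x y F - pairing x y H"
      using pairing_sums[OF GH xy] sums_unique2 by blast
    then show "pairing x y G = 0" using rep[OF xy] ext[OF xy ann] by simp
  qed
  moreover have "(\<lambda>x. matrix_op F x - matrix_op G x) = (matrix_op H :: hardy^'r \<Rightarrow> _)"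
    by (simp add: Gop)
  ultimately show ?thesis using H(2) by (metis (no_types, lifting))
qed

theorem theorem7p5:
  fixes A :: "(complex \<Rightarrow> complex) set"
  assumes "dual_subalgebra A"
  shows "nevanlinna_pick_family TYPE('r::finite) A (Lat A :: (hardy^'r) set set)"
  unfolding nevanlinna_pick_family_def
proof (intro allI impI ballI)
  fix E and F :: "(complex \<Rightarrow> complex)^'r^'r"
  assume "finite E \<and> E \<subseteq> disk \<and> separates A E" and F: "F \<in> matrices A"
  then have E: "E \<subseteq> disk" by blast
  note A = dual_subalgebraD[OF assms]
  let ?J = "matrices (vanishing_ideal A E) :: ((complex \<Rightarrow> complex)^'r^'r) set"
  let ?d = "\<lambda>G. onorm (\<lambda>x :: hardy^'r. matrix_op F x - matrix_op G x)"
  let ?c = "\<lambda>L :: (hardy^'r) set. onorm (compression F (residual_space A E L) :: (hardy^'r)^'r \<Rightarrow> _)"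
  have FH: "F \<in> matrices H_infty" using F A(1) by (auto simp: matrices_def)
  have JH: "G \<in> matrices H_infty" if "G \<in> ?J" for G using that A(1) by (auto simp: matrices_def vanishing_ideal_def)
  have d0: "?d G \<ge> 0" if "G \<in> ?J" for G
    by (intro onorm_pos_le bounded_linear_sub bounded_linear_matrix_op FH JH that)
  have "(\<lambda>z. 0 * indicator disk z) \<in> A" by (rule A(5)[OF A(2)])
  then have "(\<chi> i j. (\<lambda>z. 0)) \<in> ?J" by (simp add: matrices_def vanishing_ideal_def)
  then have ne: "?J \<noteq> {}" by blast
  then obtain G0 where G0: "G0 \<in> ?J" by blast
  have cd: "?c L \<le> ?d G" if "L \<in> Lat A" "G \<in> ?J" for L G
    by (rule onorm_compression_le[OF that(1) FH that(2) A(1)])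
  have U: "UNIV \<in> (Lat A :: (hardy^'r) set set)" by (simp add: Lat_def closed_subspace_def)
  have bdd: "bdd_above (?c ` Lat A)" by (rule bdd_aboveI2[of _ _ "?d G0"]) (rule cd[OF _ G0])
  define s where "s = (SUP L\<in>Lat A. ?c L)"
  have cs: "?c L \<le> s" if "L \<in> Lat A" for L unfolding s_def by (rule cSUP_upper[OF that bdd])
  have "?c UNIV \<ge> 0"
    by (intro onorm_pos_le bounded_linear_compression closed_subspace_residual_space LatD(1)[OF U] FH)
  then have s0: "s \<ge> 0" using cs[OF U] by linarith
  have "s \<le> matrix_dist F ?J"
    unfolding s_def matrix_dist_def
    by (intro cSUP_least cINF_greatest ne cd) (use U in auto)
  moreover have "matrix_dist F ?J \<le> s"
  proof -
    obtain G where G: "G \<in> ?J" "?d G \<le> s"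
      using distance_attained[OF assms E F s0] functional_bounded_by_compressions[OF assms F _ _ _ cs] by blast
    have "matrix_dist F ?J \<le> ?d G"
      unfolding matrix_dist_def by (rule cINF_lower[OF bdd_belowI2[of _ 0] G(1)]) (rule d0)
    then show ?thesis using G(2) by linarith
  qed
  ultimately show "matrix_dist F ?J = (SUP L\<in>Lat A. ?c L)" by (simp add: s_def)
qed

end
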